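(* For each $g\in\mathbb N$ let $$K^{(g)}=\frac1{2^g}\sum_{i=0}^g(-1)^i2^{\frac{i(i-1)}2}\tilde G^{(g)}_i,\qquad \tilde G^{(g)}_d=\sum_{\substack{V\subseteq\mathbb F_2^{2g}\\ \dim V=d}}Q_V^2 .$$ Then the family $(K^{(g)})$ satisfies the hyperelliptic Ansatz, namely $K^{(g)}\in\mathcal B^8_g$, $W_{g_1,g_2}K^{(g)}=K^{(g_1)}\otimes K^{(g_2)}$ whenever $g_1,g_2\in\mathbb N$ with $g_1+g_2=g$, $\sum_{\sigma\in S_{2g+2}}\sigma(K^{(g)})=0$, and $K^{(1)}=\Delta_{B_1}\Delta_{U_1}\Delta_{U'_1}$; furthermore $K^{(g)}=H_g$ for all $g$, where $H_g=\frac{1}{2^g}\frac{1}{g+1}(\Delta_{B_g})^2\sum_{e\in\mathcal E_{2g+2}}\frac{-1}{\psi_e}$.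
   Context: $\mathbb N=\{1,2,\dots\}$. $S_w(r)$ is the set of $f\in\mathbb C[a_1,\dots,a_r]$ with $f(a_1,\dots,a_r)=f(\gamma(a_1),\dots,\gamma(a_r))\prod_i(Ca_i+D)^w$ for all $\begin{pmatrix}A&B\\C&D\end{pmatrix}\in SL_2(\mathbb R)$, $\gamma(z)=\frac{Az+B}{Cz+D}$. Permutations act by $\sigma(f)(a_1,\dots)=f(a_{\sigma(1)},\dots)$. Star map: $f^*$ is the coefficient of the highest power of the last variable; $*\otimes*$ acts factorwise. $\Delta_T=\prod_{i,j\in T,i>j}(a_i-a_j)$; $B_g=\{1,\dots,2g+2\}$, $U_g$ its odd elements, $U'_g$ its even elements; for $T\subseteq B_g$, $T'=B_g\setminus T$. $\psi'_e=\prod_{i=1}^{r-1}(a_{e_i}-a_{e_{i+1}})$, $\psi_e=(a_{e_r}-a_{e_1})\psi'_e$; $\mathcal E_r$ = permutations $(e_1,\dots,e_r)$ of $(1,\dots,r)$ with $e_i\equiv i\pmod2$. $T^{(j)}_{r_1,r_2}(f)$ = coefficient of $t^j$ in $f(a_1,\dots,a_{r_1},\alpha_1+t,\dots,\alpha_{r_2}+t)$; $\nu_{r_1,r_2}(f)$ its $t$-degree. $S_w(2g+2)_0=\{f\in S_w(2g+2):\nu_{2g_1+1,2g_2+1}(f)\le\frac wg(2g_1g_2+g_1+g_2)\ \forall g_1,g_2\in\mathbb N,g_1+g_2=g\}$. $\mathcal S_U$ = permutations $\sigma$ of $B_g$ with $\sigma(U_g)\in\{U_g,U'_g\}$; $\mathcal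 B^8_g=\{f\in S_{4g}(2g+2)_0:\sigma(f)=f\ \forall\sigma\in\mathcal S_U\}$. For $f\in S_{gj}(2g+2)_0$, $W_{g_1,g_2}(f)$ is the unique element of $S_{g_1j}(2g_1+2)\otimes S_{g_2j}(2g_2+2)$ with $( *\otimes* )W_{g_1,g_2}(f)=T^{(j(2g_1g_2+g_1+g_2))}_{2g_1+1,2g_2+1}(f)$. Theta characteristics: elements of $\mathbb F_2^{2g}$ written as $2\times g$ arrays (top row $a$, bottom row $b$). Define $\eta_{2i-1}$ ($1\le i\le g$) with top row the $i$-th unit vector and bottom row having $1$ in positions $1,\dots,i-1$ and $0$ elsewhere; $\eta_{2i}$ with top row the $i$-th unit vector and bottom row $1$ in positions $1,\dots,i$; $\eta_{2g+1}$ with top row $0$ and bottom row all $1$; $\eta_{2g+2}=0$. For $S\subseteq B_g$ of even size, $\eta_S=\sum_{i\in S}\eta_i$; every $\zeta\in\mathbb F_2^{2g}$ equals $\eta_S$ for exactly one pair $\{S,S'\}$ of complementary even subsets. $S$ is balanced if it contains equally many even and odd numbers. For $\zeta=\eta_S$ put $P_\zeta=\Delta_{S\oplus U_g}\Delta_{(S\oplus U_g)'}$ if $S$ is balanced ($\oplus$ = symmetric difference) and $P_\zeta=0$ otherwise (this is, up to sign, the Thomae image $\rho(\theta[\zeta]^4)$). For a subspace $V\subseteq\mathbb F_2^{2g}$ of dimension $d$, $Q_V\in\mathbb Z[a_1,\dots,a_{2g+2}]$ denotes a polynomial with $Q_V^{2^d}=\prod_{\zeta\in V}P_\zeta^2$;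 such $Q_V$ exists and $Q_V^2$ is uniquely determined by $V$. *)

theory Defs
  imports Complex_Main
    "HOL-Library.Poly_Mapping" "HOL-Library.Z2"
    "HOL-Combinatorics.Permutations"
    "HOL-Computational_Algebra.Computational_Algebra"
begin

text \<open>
  Polynomials in variables indexed by a type \<open>'v\<close> with coefficients in \<open>'c\<close> are finitely supported
  functions from monomials (themselves finitely supported exponent functions) to \<open>'c\<close>.
  The variables \<open>a\<^sub>1, \<dots>, a\<^sub>r\<close> are indexed by the natural numbers \<open>1, \<dots>, r\<close>. Polynomials in two
  disjoint groups of variables \<open>a\<^sub>i\<close> and \<open>\<alpha>\<^sub>i\<close> are indexed by \<open>Inl i\<close> and \<open>Inr i\<close>.
\<close>

type_synonym ('v, 'c) mpol = "('v \<Rightarrow>\<^sub>0 nat) \<Rightarrow>\<^sub>0 'c"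

definition Const :: "'c \<Rightarrow> ('v, 'c::zero) mpol" where
  "Const c = Poly_Mapping.single 0 c"

definition Var :: "'v \<Rightarrow> ('v, 'c::zero_neq_one) mpol" where
  "Var v = Poly_Mapping.single (Poly_Mapping.single v 1) 1"

definition mvars :: "('v, 'c::zero) mpol \<Rightarrow> 'v set" where
  "mvars f = (\<Union>m \<in> Poly_Mapping.keys f. Poly_Mapping.keys m)"

text \<open>\<open>msubst \<kappa> x f\<close> applies \<open>\<kappa>\<close> to the coefficients of \<open>f\<close> and substitutes \<open>x v\<close> for each variable \<open>v\<close>.\<close>

definition msubst :: "('c \<Rightarrow> 'b) \<Rightarrow> ('v \<Rightarrow> 'b) \<Rightarrow> ('v, 'c::zero) mpol \<Rightarrow> 'b::comm_ring_1" where
  "msubst \<kappa> x f =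
     (\<Sum>m \<in> Poly_Mapping.keys f.
        \<kappa> (Poly_Mapping.lookup f m) * (\<Prod>v \<in> Poly_Mapping.keys m. x v ^ Poly_Mapping.lookup m v))"

definition rename :: "('v \<Rightarrow> 'u) \<Rightarrow> ('v, 'c::comm_ring_1) mpol \<Rightarrow> ('u, 'c) mpol" where
  "rename \<sigma> f = msubst Const (\<lambda>v. Var (\<sigma> v)) f"


subsection \<open>The spaces of invariants, star map and tensor products\<close>

text \<open>
  The identity of rational functions is stated at all points of \<open>\<complex>\<^sup>r\<close> where no denominator vanishes.
\<close>

definition Sinv :: "nat \<Rightarrow> nat \<Rightarrow> (nat, complex) mpol set" where
  "Sinv w r = {f. mvars f \<subseteq> {1..r} \<and>
     (\<forall>A B C D :: real. A * D - B * C = 1 \<longrightarrow>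
       (\<forall>a :: nat \<Rightarrow> complex.
         (\<forall>i \<in> {1..r}. of_real C * a i + of_real D \<noteq> 0) \<longrightarrow>
         msubst id a f =
           msubst id (\<lambda>i. (of_real A * a i + of_real B) / (of_real C * a i + of_real D)) f
           * (\<Prod>i \<in> {1..r}. (of_real C * a i + of_real D) ^ w)))}"

text \<open>The leading coefficient of \<open>f \<in> \<complex>[a\<^sub>1, \<dots>, a\<^sub>r]\<close>, viewed as a polynomial in \<open>a\<^sub>r\<close>.\<close>

definition star :: "nat \<Rightarrow> (nat, complex) mpol \<Rightarrow> (nat, complex) mpol" where
  "star r f = lead_coeff
     (msubst (\<lambda>c. [:Const c:]) (\<lambda>i. if i = r then [:0, 1:] else [:Var i:]) f)"

definition tensor ::
  "(nat, complex) mpol \<Rightarrow> (nat, complex) mpol \<Rightarrow> (nat + nat, complex) mpol" where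
  "tensor f h = rename Inl f * rename Inr h"

text \<open>
  The graph of the linear map \<open>*\<otimes>*\<close> on \<open>S\<^bsub>w1\<^esub>(r1) \<otimes> S\<^bsub>w2\<^esub>(r2)\<close>, the tensor product being realised
  as the span of the products \<open>f(a) h(\<alpha>)\<close>; membership of \<open>X\<close> in the tensor product is included.
\<close>

definition star_tensor ::
  "nat \<Rightarrow> nat \<Rightarrow> nat \<Rightarrow> nat \<Rightarrow> (nat + nat, complex) mpol \<Rightarrow> (nat + nat, complex) mpol \<Rightarrow> bool" where
  "star_tensor w1 r1 w2 r2 X Y \<longleftrightarrow>
     (\<exists>(n::nat) f h. (\<forall>k<n. f k \<in> Sinv w1 r1 \<and> h k \<in> Sinv w2 r2) \<and>
        X = (\<Sum>k<n. tensor (f k) (h k)) \<and>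
        Y = (\<Sum>k<n. tensor (star r1 (f k)) (star r2 (h k))))"


subsection \<open>Degeneration\<close>

text \<open>\<open>f(a\<^sub>1, \<dots>, a\<^bsub>r1\<^esub>, \<alpha>\<^sub>1 + t, \<alpha>\<^sub>2 + t, \<dots>)\<close> as a univariate polynomial in \<open>t\<close>.\<close>

definition shift_poly :: "nat \<Rightarrow> (nat, complex) mpol \<Rightarrow> (nat + nat, complex) mpol poly" where
  "shift_poly r1 f =
     msubst (\<lambda>c. [:Const c:])
       (\<lambda>i. if i \<le> r1 then [:Var (Inl i):] else [:Var (Inr (i - r1)), 1:]) f"

text \<open>
  The number \<open>r2\<close> of variables \<open>\<alpha>\<^sub>i\<close> needs no separate argument, since \<open>f\<close> is a polynomial in
  \<open>a\<^sub>1, \<dots>, a\<^bsub>r1+r2\<^esub>\<close>.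
\<close>

definition Tcoeff :: "nat \<Rightarrow> nat \<Rightarrow> (nat, complex) mpol \<Rightarrow> (nat + nat, complex) mpol" where
  "Tcoeff j r1 f = Polynomial.coeff (shift_poly r1 f) j"

definition nu :: "nat \<Rightarrow> (nat, complex) mpol \<Rightarrow> nat" where
  "nu r1 f = Polynomial.degree (shift_poly r1 f)"

definition Sinv0 :: "nat \<Rightarrow> nat \<Rightarrow> (nat, complex) mpol set" where
  "Sinv0 w g = {f \<in> Sinv w (2 * g + 2).
     \<forall>g1 g2 :: nat. g1 \<ge> 1 \<and> g2 \<ge> 1 \<and> g1 + g2 = g \<longrightarrow>
       real (nu (2 * g1 + 1) f) \<le> real w / real g * real (2 * g1 * g2 + g1 + g2)}"

definition W :: "nat \<Rightarrow> nat \<Rightarrow> nat \<Rightarrow> (nat, complex) mpol \<Rightarrow> (nat + nat, complex) mpol" where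
  "W j g1 g2 f = (THE X.
     star_tensor (g1 * j) (2 * g1 + 2) (g2 * j) (2 * g2 + 2) X
       (Tcoeff (j * (2 * g1 * g2 + g1 + g2)) (2 * g1 + 1) f))"


subsection \<open>Index sets, symmetries and discriminants\<close>

definition Bset :: "nat \<Rightarrow> nat set" where
  "Bset g = {1..2 * g + 2}"

definition Uset :: "nat \<Rightarrow> nat set" where
  "Uset g = {i \<in> Bset g. odd i}"

definition Uset' :: "nat \<Rightarrow> nat set" where
  "Uset' g = {i \<in> Bset g. even i}"

definition SU :: "nat \<Rightarrow> (nat \<Rightarrow> nat) set" where
  "SU g = {\<sigma>. \<sigma> permutes Bset g \<and> \<sigma> ` Uset g \<in> {Uset g, Uset' g}}"

definition B8 :: "nat \<Rightarrow> (nat, complex) mpol set" where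
  "B8 g = {f \<in> Sinv0 (4 * g) g. \<forall>\<sigma> \<in> SU g. rename \<sigma> f = f}"

definition Delta :: "nat set \<Rightarrow> (nat, 'c::comm_ring_1) mpol" where
  "Delta T = (\<Prod>(i, j) \<in> {(i, j). i \<in> T \<and> j \<in> T \<and> i > j}. Var i - Var j)"

definition hyperelliptic_ansatz :: "(nat \<Rightarrow> (nat, complex) mpol) \<Rightarrow> bool" where
  "hyperelliptic_ansatz F \<longleftrightarrow>
     (\<forall>g\<ge>1. F g \<in> B8 g) \<and>
     (\<forall>g\<ge>1. \<forall>g1\<ge>1. \<forall>g2\<ge>1. g1 + g2 = g \<longrightarrow> W 4 g1 g2 (F g) = tensor (F g1) (F g2)) \<and>
     (\<forall>g\<ge>1. (\<Sum>\<sigma> | \<sigma> permutes Bset g. rename \<sigma> (F g)) = 0) \<and>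
     F 1 = Delta (Bset 1) * Delta (Uset 1) * Delta (Uset' 1)"


subsection \<open>Theta characteristics\<close>

text \<open>
  A \<open>2 \<times> g\<close> array over \<open>\<bbbF>\<^sub>2\<close> is a function on positions (row, column), supported on
  \<open>{1, 2} \<times> {1..g}\<close>; row 1 is the top row.
\<close>

type_synonym char_array = "(nat \<times> nat) \<Rightarrow>\<^sub>0 bit"

definition chars :: "nat \<Rightarrow> char_array set" where
  "chars g = {\<zeta>. Poly_Mapping.keys \<zeta> \<subseteq> {1, 2} \<times> {1..g}}"

definition char_scale :: "bit \<Rightarrow> char_array \<Rightarrow> char_array" where
  "char_scale c \<zeta> = Poly_Mapping.map ((*) c) \<zeta>"

lemma lookup_char_scale:
  "Poly_Mapping.lookup (char_scale c \<zeta>) p = c * Poly_Mapping.lookup \<zeta> p"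
  unfolding char_scale_def by (simp add: Poly_Mapping.map.rep_eq when_def)

global_interpretation char_space: vector_space char_scale
  by unfold_locales
     (rule poly_mapping_eqI, simp only: lookup_char_scale lookup_add
      distrib_left distrib_right mult.assoc mult_1_left)+

definition eta :: "nat \<Rightarrow> nat \<Rightarrow> char_array" where
  "eta g k =
     (if k = 2 * g + 2 then 0
      else if k = 2 * g + 1 then (\<Sum>l \<in> {1..g}. Poly_Mapping.single (2, l) 1)
      else if odd k then
        (let i = (k + 1) div 2
         in Poly_Mapping.single (1, i) 1 + (\<Sum>l \<in> {1..i - 1}. Poly_Mapping.single (2, l) 1))
      else
        (let i = k div 2
         in Poly_Mapping.single (1, i) 1 + (\<Sum>l \<in> {1..i}. Poly_Mapping.single (2, l) 1)))"

definition eta_set :: "nat \<Rightarrow> nat set \<Rightarrow> char_array" where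
  "eta_set g S = (\<Sum>i \<in> S. eta g i)"

definition balanced :: "nat set \<Rightarrow> bool" where
  "balanced S \<longleftrightarrow> card {i \<in> S. even i} = card {i \<in> S. odd i}"

text \<open>
  The chosen \<open>S\<close> is determined up to complement in \<open>Bset g\<close>, and replacing \<open>S\<close> by its complement
  only swaps the two factors.
\<close>

definition Ptheta :: "nat \<Rightarrow> char_array \<Rightarrow> (nat, int) mpol" where
  "Ptheta g \<zeta> =
     (let S = (SOME S. S \<subseteq> Bset g \<and> even (card S) \<and> eta_set g S = \<zeta>);
          T = sym_diff S (Uset g)
      in if balanced S then Delta T * Delta (Bset g - T) else 0)"

text \<open>The choice is unique up to sign, and only \<open>(Qpoly g V)\<^sup>2\<close> is used below.\<close>

definition Qpoly :: "nat \<Rightarrow> char_array set \<Rightarrow> (nat, int) mpol" where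
  "Qpoly g V = (SOME Q. mvars Q \<subseteq> Bset g \<and>
     Q ^ (2 ^ char_space.dim V) = (\<Prod>\<zeta> \<in> V. (Ptheta g \<zeta>)\<^sup>2))"

definition Gtilde :: "nat \<Rightarrow> nat \<Rightarrow> (nat, int) mpol" where
  "Gtilde g d =
     (\<Sum>V | char_space.subspace V \<and> V \<subseteq> chars g \<and> char_space.dim V = d. (Qpoly g V)\<^sup>2)"

definition Kpoly :: "nat \<Rightarrow> (nat, complex) mpol" where
  "Kpoly g = Const (1 / 2 ^ g) *
     (\<Sum>i \<in> {0..g}. (-1) ^ i * 2 ^ (i * (i - 1) div 2) * Poly_Mapping.map of_int (Gtilde g i))"


subsection \<open>The rational function built from cycles\<close>

definition psi' :: "nat \<Rightarrow> (nat \<Rightarrow> nat) \<Rightarrow> (nat, complex) mpol" where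
  "psi' r e = (\<Prod>i \<in> {1..r - 1}. Var (e i) - Var (e (i + 1)))"

definition psi :: "nat \<Rightarrow> (nat \<Rightarrow> nat) \<Rightarrow> (nat, complex) mpol" where
  "psi r e = (Var (e r) - Var (e 1)) * psi' r e"

definition Eset :: "nat \<Rightarrow> (nat \<Rightarrow> nat) set" where
  "Eset r = {e. e permutes {1..r} \<and> (\<forall>i \<in> {1..r}. e i mod 2 = i mod 2)}"

definition Hrat :: "nat \<Rightarrow> (nat, complex) mpol fract" where
  "Hrat g = 1 / 2 ^ g * (1 / of_nat (g + 1)) * (to_fract (Delta (Bset g)))\<^sup>2 *
     (\<Sum>e \<in> Eset (2 * g + 2). - 1 / to_fract (psi (2 * g + 2) e))"

end

theory Submission
  imports Defs "HOL-Combinatorics.Multiset_Permutations"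
begin

text \<open>
  Let \<open>\<epsilon>\<^sub>i = 1\<close> for even \<open>i\<close> and \<open>\<epsilon>\<^sub>i = -1\<close> for odd \<open>i\<close>, and let \<open>R(S)\<close> be the product of
  \<open>(a\<^sub>i - a\<^sub>j)\<^bsup>2\<epsilon>\<^sub>i\<epsilon>\<^sub>j\<^esup>\<close> over the pairs in \<open>S\<close>, replaced by \<open>0\<close> if \<open>S\<close> is not balanced.
  Let \<open>\<kappa>\<^sub>p(C)\<close> be minus the sum, over the parity-alternating Hamiltonian cycles of \<open>C\<close> through \<open>p\<close>,
  of \<open>1/\<psi>\<close>. Partial fractions give \<open>R(S) = \<Sum>\<^bsub>p\<in>C\<subseteq>S\<^esub> \<kappa>\<^sub>p(C) R(S - C)\<close>.

  For a subspace \<open>V\<close> call \<open>i, j\<close> equivalent if no \<open>S\<close> with \<open>\<eta>\<^sub>S \<in> V\<close> separates them. Then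
  \<open>Q\<^sub>V\<^sup>2 = \<Delta>\<^sup>2 \<Prod>R(\<beta>)\<close> over the equivalence classes \<open>\<beta>\<close>. Inserting the recursion for \<open>R\<close> into the
  alternating sum over \<open>V\<close>, Moebius inversion in the lattice of subspaces kills every term but
  \<open>C = B\<^sub>g\<close>, whence \<open>K = 2\<^bsup>-g\<^esup> \<Delta>\<^sup>2 \<kappa>\<^sub>p(B\<^sub>g)\<close> for every \<open>p\<close>. Averaging over odd \<open>p\<close> yields \<open>H\<^sub>g\<close>,
  from which Moebius invariance and the symmetries are read off; the sum over all
  permutations vanishes because the sum of \<open>1/\<psi>\<close> over all cycles does. As a block of variables
  tends to infinity, \<open>t\<^sup>2 \<kappa>\<^sub>p\<close> converges to a product of one factor per block, by induction along
  the recursion for \<open>R\<close>; the star map is the case of a single variable.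
\<close>

subsection \<open>Pair products, partial fractions and sums over paths\<close>

text \<open>For balanced \<open>S\<close>, R(S) is the square of the Cauchy determinant of 1/(a_i -
  a_j), i odd and j even. Expanding the square over pairs of permutations covers \<open>S\<close> by
  directed alternating cycles, an edge used by both permutations being a cycle of length two. For a
  cycle of k odd and k even indices the permutation sign (-1)^(k-1) and the k reversed differences
  combine to -1, so it has weight -1/psi. Thus kappa is the connected part of R, and the recursion
  splits off the cycle through p.

  The obstacle is that these expressions have poles where variables coincide. K is evaluated through
  them only at points with distinct coordinates; polynomial identities are recovered from such
  points, and values elsewhere by continuity.

  The discriminant of two blocks of sizes 2g1+1 and 2g2+1 contributes growth of order
  t^(2(2g1+1)(2g2+1)) = t^(4(2g1g2+g1+g2)+2). A cycle meeting both blocks crosses between them at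
  least twice, at a cost of 1/t per crossing; the resulting t^-2 lowers the exponent to exactly the
  one prescribed in the definition of \<open>W\<close>.\<close>

definition pair_prod :: "(nat \<Rightarrow> nat \<Rightarrow> 'c::comm_semiring_1) \<Rightarrow> nat set \<Rightarrow> 'c" where
  "pair_prod f S = (\<Prod>j\<in>S. \<Prod>i\<in>{i\<in>S. i < j}. f i j)"

lemma pair_prod_empty [simp]: "pair_prod f {} = 1"
  by (simp add: pair_prod_def)

lemma pair_prod_cong:
  "(\<And>i j. i \<in> S \<Longrightarrow> j \<in> S \<Longrightarrow> i < j \<Longrightarrow> f i j = f' i j) \<Longrightarrow> pair_prod f S = pair_prod f' S"
  unfolding pair_prod_def by (intro prod.cong) auto

lemma pair_prod_mult: "pair_prod (\<lambda>i j. f i j * f' i j) S = pair_prod f S * pair_prod f' S"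
  unfolding pair_prod_def by (simp add: prod.distrib)

lemma pair_prod_power: "pair_prod (\<lambda>i j. f i j ^ n) S = pair_prod f S ^ n"
  unfolding pair_prod_def by (simp add: prod_power_distrib)

text \<open>A new x lies above some elements of \<open>S\<close> and below others; symmetry of
  \<open>f\<close> lets all new factors be written \<open>f x u\<close>.\<close>

lemma pair_prod_insert:
  assumes "finite S" "x \<notin> S" and sym: "\<And>i j. i \<in> insert x S \<Longrightarrow> j \<in> insert x S \<Longrightarrow> f i j = f j i"
  shows "pair_prod f (insert x S) = pair_prod f S * (\<Prod>u\<in>S. f x u)"
proof -
  have 1: "(\<Prod>i\<in>{i\<in>insert x S. i < j}. f i j)
      = (\<Prod>i\<in>{i\<in>S. i < j}. f i j) * (if x < j then f x j else 1)" if "j \<in> S" for j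
  proof (cases "x < j")
    case True
    have "{i\<in>insert x S. i < j} = insert x {i\<in>S. i < j}" using True by auto
    then show ?thesis using True assms by (simp add: mult.commute)
  next
    case False
    have "{i\<in>insert x S. i < j} = {i\<in>S. i < j}" using False by auto
    then show ?thesis using False by simp
  qed
  have 2: "(\<Prod>i\<in>{i\<in>insert x S. i < x}. f i x) = (\<Prod>u\<in>S. if u < x then f x u else 1)"
  proof -
    have "{i\<in>insert x S. i < x} = {i\<in>S. i < x}" by auto
    then have "(\<Prod>i\<in>{i\<in>insert x S. i < x}. f i x) = (\<Prod>i\<in>{i\<in>S. i < x}. f x i)"
      using sym by (auto intro!: prod.cong)
    also have "\<dots> = (\<Prod>u\<in>S. if u < x then f x u else 1)"
      using assms(1) by (simp add: prod.inter_filter)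
    finally show ?thesis .
  qed
  have 3: "(\<Prod>u\<in>S. if u < x then f x u else 1) * (\<Prod>j\<in>S. if x < j then f x j else 1) = (\<Prod>u\<in>S. f x u)"
    unfolding prod.distrib[symmetric] using assms(2) by (intro prod.cong) auto
  have "pair_prod f (insert x S) = (\<Prod>i\<in>{i\<in>insert x S. i < x}. f i x) *
      (\<Prod>j\<in>S. \<Prod>i\<in>{i\<in>insert x S. i < j}. f i j)"
    unfolding pair_prod_def using assms(1,2) by simp
  also have "(\<Prod>j\<in>S. \<Prod>i\<in>{i\<in>insert x S. i < j}. f i j)
      = (\<Prod>j\<in>S. (\<Prod>i\<in>{i\<in>S. i < j}. f i j) * (if x < j then f x j else 1))"
    by (intro prod.cong refl 1)
  also have "\<dots> = pair_prod f S * (\<Prod>j\<in>S. if x < j then f x j else 1)"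
    by (simp only: prod.distrib pair_prod_def)
  finally show ?thesis using 2 3 by (simp add: mult_ac)
qed

lemma pair_prod_Un:
  assumes "finite S" "finite S'" "S \<inter> S' = {}" and sym: "\<And>i j. f i j = f j i"
  shows "pair_prod f (S \<union> S') = pair_prod f S * pair_prod f S' * (\<Prod>i\<in>S. \<Prod>j\<in>S'. f i j)"
  using assms(1,3)
proof (induction S)
  case (insert x S)
  then show ?case using assms(2) sym
    by (simp add: pair_prod_insert prod.union_disjoint mult_ac)
qed simp

lemma pair_prod_image:
  assumes "finite S" "inj_on \<phi> S" and sym: "\<And>i j. f i j = f j i"
  shows "pair_prod f (\<phi> ` S) = pair_prod (\<lambda>i j. f (\<phi> i) (\<phi> j)) S"
  using assms(1,2)
proof (induction S)
  case (insert x S)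
  then show ?case using sym
    by (simp add: pair_prod_insert prod.reindex)
qed simp

text \<open>Lagrange interpolation: \<open>G\<close> agrees with \<open>f\<close> at
  \<open>card M\<close> distinct nodes and both have degree below \<open>card M\<close>, so they
  coincide. Dividing by the product of all z - a_u gives the decomposition into simple
  poles.\<close>

lemma lagrange_partial_fractions:
  fixes a :: "'i \<Rightarrow> complex"
  assumes "finite M" "inj_on a M" "degree f < card M" "z \<notin> a ` M"
  shows "(\<Sum>x\<in>M. poly f (a x) / (\<Prod>u\<in>M-{x}. a x - a u) / (z - a x)) = poly f z / (\<Prod>u\<in>M. z - a u)"
proof -
  define c where "c x = poly f (a x) / (\<Prod>u\<in>M-{x}. a x - a u)" for x
  define G where "G = (\<Sum>x\<in>M. smult (c x) (\<Prod>u\<in>M-{x}. [:- a u, 1:]))"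
  have ne: "(\<Prod>u\<in>M-{x}. a x - a u) \<noteq> 0" if "x \<in> M" for x
    using assms(1,2) that by (auto simp: inj_on_def)
  have degp: "degree (\<Prod>u\<in>N. [:- a u, 1:]) \<le> card N" if "finite N" for N
    using degree_prod_sum_le[OF that, of "\<lambda>u. [:- a u, 1:]"] by simp
  have degG: "degree G \<le> card M - 1"
    unfolding G_def
  proof (rule degree_sum_le[OF assms(1)])
    fix x assume "x \<in> M"
    then show "degree (smult (c x) (\<Prod>u\<in>M-{x}. [:- a u, 1:])) \<le> card M - 1"
      using degp[of "M-{x}"] assms(1) degree_smult_le[of "c x" "\<Prod>u\<in>M-{x}. [:- a u, 1:]"]
      by (simp add: card_Diff_singleton)
  qed
  have eval: "poly G (a y) = poly f (a y)" if y: "y \<in> M" for y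
  proof -
    have "poly G (a y) = (\<Sum>x\<in>M. c x * (\<Prod>u\<in>M-{x}. a y - a u))"
      by (simp add: G_def poly_sum poly_prod)
    also have "\<dots> = (\<Sum>x\<in>M. if x = y then c y * (\<Prod>u\<in>M-{y}. a y - a u) else 0)"
    proof (intro sum.cong refl)
      fix x assume "x \<in> M"
      show "c x * (\<Prod>u\<in>M-{x}. a y - a u) = (if x = y then c y * (\<Prod>u\<in>M-{y}. a y - a u) else 0)"
      proof (cases "x = y")
        case False
        then have "(\<Prod>u\<in>M-{x}. a y - a u) = 0" using y assms(1) by (auto intro!: prod_zero)
        then show ?thesis using False by simp
      qed simp
    qed
    also have "\<dots> = poly f (a y)" using y assms(1) ne by (simp add: c_def)
    finally show ?thesis .
  qed
  have "G = f"
  proof (rule ccontr)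
    assume "G \<noteq> f"
    then have nz: "G - f \<noteq> 0" by simp
    have "a ` M \<subseteq> {x. poly (G - f) x = 0}" using eval by auto
    then have "card (a ` M) \<le> card {x. poly (G - f) x = 0}"
      using poly_roots_finite[OF nz] by (intro card_mono)
    also have "\<dots> \<le> degree (G - f)" by (rule card_poly_roots_bound[OF nz])
    also have "\<dots> \<le> card M - 1"
      using degree_diff_le_max[of G f] degG assms(3) by linarith
    finally show False using card_image[OF assms(2)] assms(3) by simp
  qed
  moreover have "poly G z = (\<Sum>x\<in>M. c x * (\<Prod>u\<in>M-{x}. z - a u))"
    by (simp add: G_def poly_sum poly_prod)
  ultimately have "poly f z = (\<Sum>x\<in>M. c x * (\<Prod>u\<in>M-{x}. z - a u))" by simp
  then have "poly f z / (\<Prod>u\<in>M. z - a u) = (\<Sum>x\<in>M. c x * (\<Prod>u\<in>M-{x}. z - a u) / (\<Prod>u\<in>M. z - a u))"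
    by (simp add: sum_divide_distrib)
  also have "\<dots> = (\<Sum>x\<in>M. c x / (z - a x))"
  proof (intro sum.cong refl)
    fix x assume x: "x \<in> M"
    have "(\<Prod>u\<in>M. z - a u) = (z - a x) * (\<Prod>u\<in>M-{x}. z - a u)"
      using assms(1) x by (rule prod.remove)
    moreover have "(\<Prod>u\<in>M-{x}. z - a u) \<noteq> 0" using assms(1,4) by auto
    ultimately show "c x * (\<Prod>u\<in>M-{x}. z - a u) / (\<Prod>u\<in>M. z - a u) = c x / (z - a x)"
      by simp
  qed
  finally show ?thesis by (simp add: c_def)
qed

fun chain :: "('i \<Rightarrow> 'i \<Rightarrow> 'c::comm_semiring_1) \<Rightarrow> 'i list \<Rightarrow> 'c" where
  "chain w (x # y # zs) = w x y * chain w (y # zs)"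
| "chain w xs = 1"

definition path_sum :: "('i \<Rightarrow> 'i \<Rightarrow> 'c::comm_semiring_1) \<Rightarrow> 'i \<Rightarrow> 'i set \<Rightarrow> 'i \<Rightarrow> 'c" where
  "path_sum w p A q = (\<Sum>xs\<in>permutations_of_set A. chain w (p # xs @ [q]))"

lemma path_sum_empty [simp]: "path_sum w p {} q = w p q"
  by (simp add: path_sum_def)

lemma path_sum_rec:
  assumes "finite A" "A \<noteq> {}"
  shows "path_sum w p A q = (\<Sum>x\<in>A. w p x * path_sum w x (A - {x}) q)"
proof -
  have "path_sum w p A q = (\<Sum>x\<in>A. \<Sum>xs\<in>(\<lambda>xs. x # xs) ` permutations_of_set (A - {x}). chain w (p # xs @ [q]))"
    unfolding path_sum_def permutations_of_set_nonempty[OF assms(2)]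
    by (rule sum.UNION_disjoint) (use assms in auto)
  also have "\<dots> = (\<Sum>x\<in>A. w p x * path_sum w x (A - {x}) q)"
    by (intro sum.cong refl) (simp add: sum.reindex path_sum_def sum_distrib_left)
  finally show ?thesis .
qed

text \<open>Splitting off the first step leaves a partial fraction sum in a_p. At q = p the
  numerator vanishes as soon as \<open>A\<close> has two elements, so the weights of all Hamiltonian
  cycles through p add up to 0; this is what annihilates the sum of K over all permutations.\<close>

lemma path_sum_all:
  fixes a :: "'i \<Rightarrow> complex"
  assumes "finite A" "A \<noteq> {}" "inj_on a A" "a p \<notin> a ` A" "a q \<notin> a ` A"
  shows "path_sum (\<lambda>u v. 1 / (a u - a v)) p A q
    = (a p - a q) ^ (card A - 1) / (\<Prod>s\<in>A. (a p - a s) * (a s - a q))"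
  using assms
proof (induction "card A" arbitrary: A p)
  case (Suc n)
  show ?case
  proof (cases "n = 0")
    case True
    then obtain s where "A = {s}" using Suc.hyps(2) card_1_singletonE by (metis One_nat_def)
    then show ?thesis by (simp add: path_sum_rec)
  next
    case False
    have neq: "a s \<noteq> a q" if "s \<in> A" for s using Suc.prems that by (metis image_eqI)
    have "path_sum (\<lambda>u v. 1 / (a u - a v)) p A q
      = (\<Sum>x\<in>A. 1 / (a p - a x) * path_sum (\<lambda>u v. 1 / (a u - a v)) x (A - {x}) q)"
      using Suc.prems by (intro path_sum_rec)
    also have "\<dots> = (\<Sum>x\<in>A. (a x - a q) ^ n / (\<Prod>u\<in>A-{x}. a x - a u) / (a p - a x)) / (\<Prod>s\<in>A. a s - a q)"
      unfolding sum_divide_distrib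
    proof (intro sum.cong refl)
      fix x assume x: "x \<in> A"
      have c: "card (A - {x}) = n" using x Suc by simp
      have IH: "path_sum (\<lambda>u v. 1 / (a u - a v)) x (A - {x}) q
        = (a x - a q) ^ (n - 1) / (\<Prod>s\<in>A-{x}. (a x - a s) * (a s - a q))"
      proof -
        have "A - {x} \<noteq> {}" using c False by (metis card.empty)
        moreover have "a x \<notin> a ` (A - {x})" using x Suc.prems(3) by (auto simp: inj_on_def)
        moreover have "inj_on a (A - {x})" "a q \<notin> a ` (A - {x})"
          using Suc.prems(3,5) by (auto simp: inj_on_def)
        ultimately show ?thesis using Suc.hyps(1)[of "A - {x}" x] c Suc.prems(1) by simp
      qed
      have e: "(\<Prod>s\<in>A. a s - a q) = (a x - a q) * (\<Prod>s\<in>A-{x}. a s - a q)"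
        using Suc.prems x by (intro prod.remove)
      have n1: "(a x - a q) ^ n = (a x - a q) * (a x - a q) ^ (n - 1)"
        using False by (cases n) auto
      have aux: "1 / P * (y / (D * E)) = X * y / D / P / (X * E)" if "X \<noteq> 0" for P y D E X :: complex
        using that by (cases "D = 0"; cases "E = 0"; cases "P = 0"; simp add: field_simps)
      have "a x - a q \<noteq> 0" using neq[OF x] by simp
      then show "1 / (a p - a x) * path_sum (\<lambda>u v. 1 / (a u - a v)) x (A - {x}) q
        = (a x - a q) ^ n / (\<Prod>u\<in>A-{x}. a x - a u) / (a p - a x) / (\<Prod>s\<in>A. a s - a q)"
        unfolding IH e n1 prod.distrib by (rule aux)
    qed
    also have "(\<Sum>x\<in>A. (a x - a q) ^ n / (\<Prod>u\<in>A-{x}. a x - a u) / (a p - a x))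
        = (a p - a q) ^ n / (\<Prod>s\<in>A. a p - a s)"
    proof -
      \<comment> \<open>There are n + 1 nodes, so the n-th power of z - a_q is the highest one that
        partial fractions still admit.\<close>
      have "degree ([:- a q, 1:] ^ n) < card A"
        using degree_power_le[of "[:- a q, 1:]" n] Suc.hyps(2) by simp
      from lagrange_partial_fractions[OF Suc.prems(1,3) this Suc.prems(4)]
      show ?thesis by (simp add: poly_power)
    qed
    finally show ?thesis using Suc.hyps(2)[symmetric] by (simp only: diff_Suc_1 divide_divide_eq_left prod.distrib)
  qed
qed simp

subsection \<open>The recursion for alternating cycles\<close>

text \<open>The weight 0 on edges of equal parity restricts every path sum to parity-alternating
  paths.\<close>

definition wt :: "(nat \<Rightarrow> complex) \<Rightarrow> nat \<Rightarrow> nat \<Rightarrow> complex" where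
  "wt a u v = (if even u = even v then 0 else 1 / (a u - a v))"

text \<open>The factor \<open>(a\<^sub>u - a\<^sub>v)\<^bsup>\<epsilon>\<^sub>u\<epsilon>\<^sub>v\<^esup>\<close>.\<close>

definition kf :: "(nat \<Rightarrow> complex) \<Rightarrow> nat \<Rightarrow> nat \<Rightarrow> complex" where
  "kf a u v = (if even u = even v then a u - a v else 1 / (a u - a v))"

definition Rp :: "(nat \<Rightarrow> complex) \<Rightarrow> nat set \<Rightarrow> complex" where
  "Rp a = pair_prod (\<lambda>u v. (kf a u v)\<^sup>2)"

definition sg :: "nat \<Rightarrow> int" where "sg i = (if even i then 1 else - 1)"

text \<open>The number of even elements minus the number of odd ones. Besides detecting balance, it
  measures growth: moving a block S2 away from S1 multiplies \<open>Rp\<close> by the order t^(2 exc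
  S1 exc S2).\<close>

definition exc :: "nat set \<Rightarrow> int" where "exc S = (\<Sum>i\<in>S. sg i)"

definition R0 :: "(nat \<Rightarrow> complex) \<Rightarrow> nat set \<Rightarrow> complex" where
  "R0 a S = (if exc S = 0 then Rp a S else 0)"

lemma kf_sq_commute: "(kf a u v)\<^sup>2 = (kf a v u)\<^sup>2"
  by (simp add: kf_def power2_commute power_divide)

lemma kf_nonzero: "a u \<noteq> a v \<Longrightarrow> kf a u v \<noteq> 0"
  by (simp add: kf_def)

lemma exc_empty [simp]: "exc {} = 0"
  by (simp add: exc_def)

lemma exc_insert: "finite S \<Longrightarrow> x \<notin> S \<Longrightarrow> exc (insert x S) = sg x + exc S"
  by (simp add: exc_def)

lemma exc_Un: "finite S \<Longrightarrow> finite T \<Longrightarrow> S \<inter> T = {} \<Longrightarrow> exc (S \<union> T) = exc S + exc T"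
  by (simp add: exc_def sum.union_disjoint)

lemma exc_Diff: "finite S \<Longrightarrow> T \<subseteq> S \<Longrightarrow> exc (S - T) = exc S - exc T"
  by (simp add: exc_def sum_diff)

lemma exc_card: "finite S \<Longrightarrow> exc S = sg p * (int (card {u\<in>S. even u = even p}) - int (card {u\<in>S. even u \<noteq> even p}))"
proof -
  assume "finite S"
  then have "exc S = (\<Sum>i\<in>{u\<in>S. even u = even p}. sg i) + (\<Sum>i\<in>{u\<in>S. even u \<noteq> even p}. sg i)"
    unfolding exc_def by (subst sum.union_disjoint[symmetric]) (auto intro: sum.cong)
  also have "(\<Sum>i\<in>{u\<in>S. even u = even p}. sg i) = (\<Sum>i\<in>{u\<in>S. even u = even p}. sg p)"
    by (intro sum.cong) (auto simp: sg_def)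
  also have "(\<Sum>i\<in>{u\<in>S. even u \<noteq> even p}. sg i) = (\<Sum>i\<in>{u\<in>S. even u \<noteq> even p}. - sg p)"
    by (intro sum.cong) (auto simp: sg_def)
  finally show ?thesis by (simp add: algebra_simps)
qed

lemma balanced_iff_exc: "finite S \<Longrightarrow> balanced S \<longleftrightarrow> exc S = 0"
  using exc_card[of S 0] by (simp add: balanced_def sg_def)

lemma Rp_empty [simp]: "Rp a {} = 1" by (simp add: Rp_def)

lemma R0_empty [simp]: "R0 a {} = 1" by (simp add: R0_def)

lemma Rp_insert: "finite S \<Longrightarrow> x \<notin> S \<Longrightarrow> Rp a (insert x S) = Rp a S * (\<Prod>u\<in>S. kf a x u)\<^sup>2"
  unfolding Rp_def by (subst pair_prod_insert) (auto simp: kf_sq_commute prod_power_distrib)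

lemma Rp_remove: "finite S \<Longrightarrow> x \<in> S \<Longrightarrow> Rp a S = Rp a (S - {x}) * (\<Prod>u\<in>S - {x}. kf a x u)\<^sup>2"
  using Rp_insert[of "S - {x}" x a] by (simp add: insert_absorb)

text \<open>A nonempty set with a marked element x is the same as x together with a set avoiding x;
  here x will be the first interior vertex of a path.\<close>

lemma sum_Pow_first:
  assumes "finite S"
  shows "(\<Sum>C\<in>Pow S - {{}}. \<Sum>x\<in>C. f x (C - {x})) = (\<Sum>x\<in>S. \<Sum>D\<in>Pow (S - {x}). f x D)"
proof -
  have fin: "finite C" if "C \<subseteq> S" for C using that assms finite_subset by auto
  have "(\<Sum>C\<in>Pow S - {{}}. \<Sum>x\<in>C. f x (C - {x}))
      = (\<Sum>(C, x)\<in>Sigma (Pow S - {{}}) (\<lambda>C. C). f x (C - {x}))"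
    using assms fin by (subst sum.Sigma) auto
  also have "\<dots> = (\<Sum>(x, D)\<in>Sigma S (\<lambda>x. Pow (S - {x})). f x D)"
    by (rule sum.reindex_bij_witness[of _ "\<lambda>(x, D). (insert x D, x)" "\<lambda>(C, x). (x, C - {x})"]) auto
  also have "\<dots> = (\<Sum>x\<in>S. \<Sum>D\<in>Pow (S - {x}). f x D)"
    using assms by (subst sum.Sigma) auto
  finally show ?thesis .
qed

text \<open>Unlike the sum over closed paths, the sum over paths from \<open>p\<close> to \<open>q\<close> admits an induction that
  splits off the first step.\<close>

definition Ysum :: "(nat \<Rightarrow> complex) \<Rightarrow> nat set \<Rightarrow> nat \<Rightarrow> nat \<Rightarrow> complex" where
  "Ysum a S p q = (\<Sum>C\<in>Pow S. path_sum (wt a) p C q * R0 a (S - C))"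

lemma Ysum_rec:
  assumes "finite S"
  shows "Ysum a S p q = wt a p q * R0 a S + (\<Sum>x\<in>S. wt a p x * Ysum a (S - {x}) x q)"
proof -
  have "Ysum a S p q = wt a p q * R0 a S + (\<Sum>C\<in>Pow S - {{}}. path_sum (wt a) p C q * R0 a (S - C))"
    unfolding Ysum_def using assms by (subst sum.remove[of _ "{}"]) auto
  also have "(\<Sum>C\<in>Pow S - {{}}. path_sum (wt a) p C q * R0 a (S - C))
    = (\<Sum>C\<in>Pow S - {{}}. \<Sum>x\<in>C. wt a p x * path_sum (wt a) x (C - {x}) q * R0 a (S - {x} - (C - {x})))"
  proof (intro sum.cong refl)
    fix C assume C: "C \<in> Pow S - {{}}"
    then have "finite C" using assms finite_subset by auto
    moreover have "S - {x} - (C - {x}) = S - C" if "x \<in> C" for x using that by auto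
    ultimately show "path_sum (wt a) p C q * R0 a (S - C)
      = (\<Sum>x\<in>C. wt a p x * path_sum (wt a) x (C - {x}) q * R0 a (S - {x} - (C - {x})))"
      using C by (simp add: path_sum_rec sum_distrib_right)
  qed
  also have "\<dots> = (\<Sum>x\<in>S. wt a p x * Ysum a (S - {x}) x q)"
    by (subst sum_Pow_first[OF assms]) (simp add: Ysum_def sum_distrib_left mult.assoc)
  finally show ?thesis .
qed

text \<open>The first step changes the parity of the starting point, so each of the two cases is
  reduced to the other and both must be proved together. After inserting the induction hypothesis,
  the sum over the first step is a partial fraction expansion in a_p whose nodes are the indices of
  parity opposite to p.\<close>

lemma Ysum_closed:
  assumes "finite S" "inj_on a S" "a p \<notin> a ` S" "a q \<notin> a ` S"
  shows "(even p = even q \<longrightarrow> exc S = - sg p \<longrightarrow>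
            Ysum a S p q = - Rp a S * (\<Prod>u\<in>S. kf a p u) * (\<Prod>u\<in>S. kf a q u)) \<and>
         (even p \<noteq> even q \<longrightarrow> exc S = 0 \<longrightarrow> a p \<noteq> a q \<longrightarrow>
            Ysum a S p q = wt a p q * Rp a S * (\<Prod>u\<in>S. kf a p u) * (\<Prod>u\<in>S. kf a q u))"
  using assms
proof (induction "card S" arbitrary: S p rule: less_induct)
  case less
  define M where "M = {u\<in>S. even u \<noteq> even p}"
  define P where "P = {u\<in>S. even u = even p}"
  define f where "f = (\<Prod>u\<in>P. [:- a u, 1:])"
  have fin: "finite M" "finite P" "finite S" and S: "S = P \<union> M" and disj: "P \<inter> M = {}"
    using less.prems by (auto simp: M_def P_def)
  have degf: "degree f \<le> card P"
    using degree_prod_sum_le[OF fin(2), of "\<lambda>u. [:- a u, 1:]"] by (simp add: f_def)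
  have polyf: "poly f z = (\<Prod>u\<in>P. z - a u)" for z by (simp add: f_def poly_prod)
  have pne: "a p \<noteq> a u" "a q \<noteq> a u" if "u \<in> S" for u using that less.prems by auto
  have ine: "a x \<noteq> a u" if "x \<in> S" "u \<in> S" "x \<noteq> u" for x u
    using that less.prems by (auto simp: inj_on_def)
  have injM: "inj_on a M" using less.prems S by (auto simp: inj_on_def)
  \<comment> \<open>As a function of the starting value, this product is rational, with zeros at
    \<open>P\<close> and simple poles at \<open>M\<close>; it is the function to be
    decomposed.\<close>
  have kpP: "(\<Prod>u\<in>S. kf a p u) = poly f (a p) / (\<Prod>u\<in>M. a p - a u)"
  proof -
    have "(\<Prod>u\<in>S. kf a p u) = (\<Prod>u\<in>P. kf a p u) * (\<Prod>u\<in>M. kf a p u)"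
      unfolding S using fin disj by (intro prod.union_disjoint)
    also have "(\<Prod>u\<in>P. kf a p u) = poly f (a p)"
      unfolding polyf by (intro prod.cong) (auto simp: kf_def P_def)
    also have "(\<Prod>u\<in>M. kf a p u) = (\<Prod>u\<in>M. 1 / (a p - a u))"
      by (intro prod.cong) (auto simp: kf_def M_def)
    finally show ?thesis by (simp add: prod_dividef)
  qed
  have kx: "(\<Prod>u\<in>S - {x}. kf a x u) = (\<Prod>u\<in>M - {x}. a x - a u) / poly f (a x)" if "x \<in> M" for x
  proof -
    have "(\<Prod>u\<in>S - {x}. kf a x u) = (\<Prod>u\<in>M - {x}. kf a x u) * (\<Prod>u\<in>P. kf a x u)"
      by (subst prod.union_disjoint[symmetric]) (use fin disj that S in \<open>auto intro!: prod.cong\<close>)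
    also have "(\<Prod>u\<in>M - {x}. kf a x u) = (\<Prod>u\<in>M - {x}. a x - a u)"
      using that by (intro prod.cong) (auto simp: kf_def M_def)
    also have "(\<Prod>u\<in>P. kf a x u) = (\<Prod>u\<in>P. 1 / (a x - a u))"
      using that by (intro prod.cong) (auto simp: kf_def M_def P_def)
    finally show ?thesis by (simp add: prod_dividef polyf)
  qed
  have kx0: "(\<Prod>u\<in>S - {x}. kf a x u) \<noteq> 0" if "x \<in> S" for x
    using that fin ine by (auto intro!: kf_nonzero)
  have Rx: "Rp a (S - {x}) * (\<Prod>u\<in>S - {x}. kf a x u) = Rp a S / (\<Prod>u\<in>S - {x}. kf a x u)"
    if "x \<in> S" for x
    using kx0[OF that] Rp_remove[OF fin(3) that, of a] by (simp add: power2_eq_square)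
  have kq: "(\<Prod>u\<in>S. kf a q u) = kf a q x * (\<Prod>u\<in>S - {x}. kf a q u)" if "x \<in> S" for x
    using fin(3) that by (rule prod.remove)
  have wsum: "(\<Sum>x\<in>S. wt a p x * Ysum a (S - {x}) x q) = (\<Sum>x\<in>M. 1 / (a p - a x) * Ysum a (S - {x}) x q)"
  proof -
    have "(\<Sum>x\<in>S. wt a p x * Ysum a (S - {x}) x q) = (\<Sum>x\<in>M. wt a p x * Ysum a (S - {x}) x q)"
      using fin(3) by (intro sum.mono_neutral_right) (auto simp: M_def wt_def)
    also have "\<dots> = (\<Sum>x\<in>M. 1 / (a p - a x) * Ysum a (S - {x}) x q)"
      by (intro sum.cong) (auto simp: M_def wt_def)
    finally show ?thesis .
  qed
  have excx: "exc (S - {x}) = exc S - sg x" if "x \<in> S" for x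
    using exc_Diff[OF fin(3), of "{x}"] that by (simp add: exc_def)
  have IHp: "card (S - {x}) < card S" "finite (S - {x})" "inj_on a (S - {x})"
      "a x \<notin> a ` (S - {x})" "a q \<notin> a ` (S - {x})" if "x \<in> S" for x
    using card_Diff1_less[OF fin(3) that] fin(3) inj_on_diff[OF less.prems(2)] less.prems(4) ine[OF that]
    by auto
  have cPM: "exc S = sg p * (int (card P) - int (card M))"
    using exc_card[OF fin(3), of p] by (simp add: P_def M_def)
  show ?case
  proof (intro conjI impI)
    assume par: "even p = even q" and e: "exc S = - sg p"
    \<comment> \<open>The excess says that \<open>M\<close> has one element more than
      \<open>P\<close>, exactly what the degree condition on \<open>f\<close> requires.\<close>
    have "card P < card M" using cPM e by (auto simp: sg_def split: if_splits)
    then have df: "degree f < card M" using degf by simp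
    have z: "a p \<notin> a ` M" using less.prems S by auto
    have "Ysum a S p q = (\<Sum>x\<in>M. 1 / (a p - a x) * Ysum a (S - {x}) x q)"
      using Ysum_rec[OF fin(3)] wsum e par by (simp add: wt_def)
    also have "\<dots> = (\<Sum>x\<in>M. - Rp a S * (\<Prod>u\<in>S. kf a q u) *
        (poly f (a x) / (\<Prod>u\<in>M - {x}. a x - a u) / (a p - a x)))"
    proof (intro sum.cong refl)
      fix x assume x: "x \<in> M"
      then have xS: "x \<in> S" and xp: "even x \<noteq> even p" by (auto simp: M_def)
      have "exc (S - {x}) = 0" using excx[OF xS] e xp by (auto simp: sg_def split: if_splits)
      then have "Ysum a (S - {x}) x q = wt a x q * Rp a (S - {x}) * (\<Prod>u\<in>S - {x}. kf a x u) * (\<Prod>u\<in>S - {x}. kf a q u)"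
        using less.hyps[OF IHp[OF xS]] xp par pne[OF xS] by auto
      also have "\<dots> = wt a x q * (Rp a S / (\<Prod>u\<in>S - {x}. kf a x u)) * (\<Prod>u\<in>S - {x}. kf a q u)"
        unfolding Rx[OF xS, symmetric] by (simp add: mult_ac)
      also have "\<dots> = - Rp a S * (\<Prod>u\<in>S. kf a q u) * (poly f (a x) / (\<Prod>u\<in>M - {x}. a x - a u))"
      proof -
        have "wt a x q = 1 / (a x - a q)" "kf a q x = - (1 / (a x - a q))"
          using xp par by (auto simp: wt_def kf_def minus_divide_right)
        then show ?thesis unfolding kq[OF xS] kx[OF x] by simp
      qed
      finally show "1 / (a p - a x) * Ysum a (S - {x}) x q
        = - Rp a S * (\<Prod>u\<in>S. kf a q u) * (poly f (a x) / (\<Prod>u\<in>M - {x}. a x - a u) / (a p - a x))"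
        by simp
    qed
    also have "\<dots> = - Rp a S * (\<Prod>u\<in>S. kf a q u) * (poly f (a p) / (\<Prod>u\<in>M. a p - a u))"
      unfolding sum_distrib_left[symmetric] lagrange_partial_fractions[OF fin(1) injM df z] ..
    finally show "Ysum a S p q = - Rp a S * (\<Prod>u\<in>S. kf a p u) * (\<Prod>u\<in>S. kf a q u)"
      unfolding kpP by (simp add: mult_ac)
  next
    assume par: "even p \<noteq> even q" and e: "exc S = 0" and apq: "a p \<noteq> a q"
    \<comment> \<open>Now \<open>M\<close> alone has one node too few for the degree of
      \<open>f\<close>. The direct step from p to q supplies the missing pole, at a_q.\<close>
    have "card P = card M" using cPM e by (auto simp: sg_def split: if_splits)
    moreover have qM: "q \<notin> M" using less.prems S by auto
    ultimately have df: "degree f < card (insert q M)" using degf fin by simp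
    have z: "a p \<notin> a ` insert q M" using less.prems S apq by auto
    have inj: "inj_on a (insert q M)" using injM less.prems S by auto
    have kqP: "(\<Prod>u\<in>S. kf a q u) = (\<Prod>u\<in>M. a q - a u) / poly f (a q)"
    proof -
      have "(\<Prod>u\<in>S. kf a q u) = (\<Prod>u\<in>M. kf a q u) * (\<Prod>u\<in>P. kf a q u)"
        unfolding S using fin disj by (subst prod.union_disjoint) (auto simp: mult.commute)
      also have "(\<Prod>u\<in>M. kf a q u) = (\<Prod>u\<in>M. a q - a u)"
        using par by (intro prod.cong) (auto simp: kf_def M_def)
      also have "(\<Prod>u\<in>P. kf a q u) = (\<Prod>u\<in>P. 1 / (a q - a u))"
        using par by (intro prod.cong) (auto simp: kf_def P_def)
      finally show ?thesis by (simp add: prod_dividef polyf)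
    qed
    have kq0: "(\<Prod>u\<in>S. kf a q u) \<noteq> 0" using fin pne by (auto intro!: kf_nonzero)
    define g where "g x = poly f (a x) / (\<Prod>u\<in>insert q M - {x}. a x - a u) / (a p - a x)" for x
    have gq: "wt a p q * Rp a S = Rp a S * (\<Prod>u\<in>S. kf a q u) * g q"
    proof -
      have 1: "insert q M - {q} = M" using qM by auto
      have 2: "poly f (a q) \<noteq> 0" "(\<Prod>u\<in>M. a q - a u) \<noteq> 0" using kq0 unfolding kqP by auto
      show ?thesis unfolding g_def 1 kqP using 2 par by (simp add: wt_def)
    qed
    have gx: "1 / (a p - a x) * Ysum a (S - {x}) x q = Rp a S * (\<Prod>u\<in>S. kf a q u) * g x"
      if x: "x \<in> M" for x
    proof -
      from x have xS: "x \<in> S" and xp: "even x \<noteq> even p" by (auto simp: M_def)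
      have 1: "insert q M - {x} = insert q (M - {x})" using qM x by auto
      have "exc (S - {x}) = - sg x" using excx[OF xS] e xp by (auto simp: sg_def split: if_splits)
      then have "Ysum a (S - {x}) x q = - Rp a (S - {x}) * (\<Prod>u\<in>S - {x}. kf a x u) * (\<Prod>u\<in>S - {x}. kf a q u)"
        using less.hyps[OF IHp[OF xS]] xp par pne[OF xS] by auto
      also have "\<dots> = - (Rp a S / (\<Prod>u\<in>S - {x}. kf a x u)) * (\<Prod>u\<in>S - {x}. kf a q u)"
        unfolding Rx[OF xS, symmetric] by (simp add: mult_ac)
      also have "\<dots> = Rp a S * (\<Prod>u\<in>S. kf a q u) * (poly f (a x) / (\<Prod>u\<in>insert q M - {x}. a x - a u))"
      proof -
        have "a x - a q \<noteq> 0" "kf a q x = - (a x - a q)" using pne[OF xS] xp par by (auto simp: kf_def)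
        moreover have "(\<Prod>u\<in>insert q M - {x}. a x - a u) = (a x - a q) * (\<Prod>u\<in>M - {x}. a x - a u)"
          unfolding 1 using fin(1) qM by simp
        moreover have "- (R / (m / F)) * K = R * (- d * K) * (F / (d * m))" if "d \<noteq> 0" for R m F K d :: complex
          using that by (cases "m = 0"; cases "F = 0") simp_all
        ultimately show ?thesis
          unfolding kq[OF xS] kx[OF x] by presburger
      qed
      finally show ?thesis by (simp add: g_def)
    qed
    have "Ysum a S p q = wt a p q * Rp a S + (\<Sum>x\<in>M. 1 / (a p - a x) * Ysum a (S - {x}) x q)"
      using Ysum_rec[OF fin(3)] wsum e by (simp add: R0_def)
    also have "\<dots> = Rp a S * (\<Prod>u\<in>S. kf a q u) * (\<Sum>x\<in>insert q M. g x)"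
      unfolding gq using gx qM fin(1) by (simp add: sum_distrib_left distrib_left)
    also have "(\<Sum>x\<in>insert q M. g x) = poly f (a p) / (\<Prod>u\<in>insert q M. a p - a u)"
      unfolding g_def using fin by (intro lagrange_partial_fractions inj df z) simp
    also have "\<dots> = wt a p q * (\<Prod>u\<in>S. kf a p u)"
      unfolding kpP using fin qM par by (simp add: wt_def)
    finally show "Ysum a S p q = wt a p q * Rp a S * (\<Prod>u\<in>S. kf a p u) * (\<Prod>u\<in>S. kf a q u)"
      by (simp add: mult_ac)
  qed
qed

text \<open>With this sign a pair {p, q} of opposite parities receives 1/(a_p - a_q)^2, which is its
  value under \<open>R0\<close>.\<close>

definition kap :: "(nat \<Rightarrow> complex) \<Rightarrow> nat \<Rightarrow> nat set \<Rightarrow> complex" where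
  "kap a p C = - path_sum (wt a) p (C - {p}) p"

text \<open>The two ends of each edge of an alternating path have opposite signs. Summing sg u + sg
  v over its edges counts interior vertices twice and the end points once, so an alternating path
  forces sg p + 2 exc A + sg q = 0.\<close>

lemma path_sum_wt_zero:
  assumes "finite A" "p \<notin> A" "q \<notin> A"
    and "2 * exc A \<noteq> - sg p - sg q"
  shows "path_sum (wt a) p A q = 0"
  using assms
proof (induction "card A" arbitrary: A p)
  case 0
  then show ?case by (auto simp: wt_def sg_def split: if_splits)
next
  case (Suc n)
  have ne: "A \<noteq> {}" using Suc.hyps(2) by auto
  have "wt a p x * path_sum (wt a) x (A - {x}) q = 0" if x: "x \<in> A" for x
  proof (cases "even p = even x")
    case False
    have "exc A = sg x + exc (A - {x})" using exc_insert[of "A - {x}" x] Suc.prems(1) x by (simp add: insert_absorb)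
    moreover have "sg p = - sg x" using False by (simp add: sg_def)
    ultimately have "2 * exc (A - {x}) \<noteq> - sg x - sg q" using Suc.prems(4) by presburger
    moreover have "n = card (A - {x})" using Suc.hyps(2) x Suc.prems(1) by simp
    ultimately have "path_sum (wt a) x (A - {x}) q = 0"
      using Suc.prems(1,3) by (intro Suc.hyps(1)) simp_all
    then show ?thesis by simp
  qed (simp add: wt_def)
  then show ?case unfolding path_sum_rec[OF Suc.prems(1) ne] by (intro sum.neutral) auto
qed

lemma kap_unbalanced:
  assumes "finite C" "p \<in> C" "exc C \<noteq> 0"
  shows "kap a p C = 0"
proof -
  have "exc C = sg p + exc (C - {p})" using exc_insert[of "C - {p}" p] assms by (simp add: insert_absorb)
  then show ?thesis unfolding kap_def using assms by (subst path_sum_wt_zero) auto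
qed

text \<open>This is the case q = p of \<open>Ysum_closed\<close> on \<open>S - {p}\<close>: the two
  products of \<open>kf\<close> factors coincide, and their product is the factor by which
  \<open>Rp\<close> grows when p is adjoined. If \<open>S\<close> is unbalanced, then C and its
  complement in \<open>S\<close> cannot both be balanced, and every term vanishes.\<close>

theorem R0_kap_rec:
  assumes "finite S" "inj_on a S" "p \<in> S"
  shows "R0 a S = (\<Sum>C | p \<in> C \<and> C \<subseteq> S. kap a p C * R0 a (S - C))"
proof (cases "exc S = 0")
  case True
  define T where "T = S - {p}"
  have T: "finite T" "inj_on a T" "p \<notin> T" "S = insert p T" "a p \<notin> a ` T"
    using assms by (auto simp: T_def inj_on_def)
  have "exc T = - sg p" using exc_insert[of T p] T True by simp
  then have "Ysum a T p p = - Rp a T * (\<Prod>u\<in>T. kf a p u) * (\<Prod>u\<in>T. kf a p u)"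
    using Ysum_closed[OF T(1,2,5,5)] by simp
  then have "R0 a S = - Ysum a T p p"
    unfolding R0_def using True T Rp_insert[OF T(1,3), of a] by (simp add: power2_eq_square)
  also have "\<dots> = (\<Sum>C\<in>Pow T. kap a p (insert p C) * R0 a (T - C))"
    unfolding Ysum_def sum_negf[symmetric] using T(3)
    by (intro sum.cong refl) (auto simp: kap_def insert_Diff_if intro!: arg_cong[of _ _ "\<lambda>X. path_sum (wt a) p X p"])
  also have "\<dots> = (\<Sum>C | p \<in> C \<and> C \<subseteq> S. kap a p C * R0 a (S - C))"
    by (rule sum.reindex_bij_witness[of _ "\<lambda>C. C - {p}" "insert p"])
       (use T in \<open>auto intro!: arg_cong[of _ _ "R0 a"] simp: insert_absorb\<close>)
  finally show ?thesis .
next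
  case False
  have "kap a p C * R0 a (S - C) = 0" if "p \<in> C" "C \<subseteq> S" for C
    using that kap_unbalanced[of C p a] exc_Diff[OF assms(1), of C] False finite_subset[of C S] assms(1)
    by (auto simp: R0_def)
  then show ?thesis using False by (auto simp: R0_def intro!: sum.neutral)
qed

subsection \<open>Degeneration of cycles\<close>

lemma chain_map: "chain w (map \<phi> xs) = chain (\<lambda>u v. w (\<phi> u) (\<phi> v)) xs"
  by (induction "\<lambda>u v. w (\<phi> u) (\<phi> v)" xs rule: chain.induct) auto

lemma chain_cong:
  "(\<And>u v. u \<in> set xs \<Longrightarrow> v \<in> set xs \<Longrightarrow> w u v = w' u v) \<Longrightarrow> chain w xs = chain w' xs"
  by (induction w xs rule: chain.induct) auto

lemma path_sum_image:
  assumes "inj_on \<phi> A"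
  shows "path_sum w (\<phi> p) (\<phi> ` A) (\<phi> q) = path_sum (\<lambda>u v. w (\<phi> u) (\<phi> v)) p A q"
proof -
  have inj: "inj_on (map \<phi>) (permutations_of_set A)"
    using assms by (intro inj_onI) (metis map_inj_on permutations_of_setD(1) Un_absorb)
  show ?thesis
    unfolding path_sum_def permutations_of_set_image_inj[OF assms] sum.reindex[OF inj]
    by (intro sum.cong refl) (simp flip: chain_map)
qed

lemma path_sum_cong:
  assumes "\<And>u v. u \<in> insert p (insert q A) \<Longrightarrow> v \<in> insert p (insert q A) \<Longrightarrow> w u v = w' u v"
  shows "path_sum w p A q = path_sum w' p A q"
  unfolding path_sum_def using assms by (intro sum.cong refl chain_cong) (auto dest: permutations_of_setD)

text \<open>One block's share in the limit of t^2 \<open>R0\<close>: two blocks of excesses 1 and -1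
  interact with order t^-2.\<close>

definition Rt :: "(nat \<Rightarrow> complex) \<Rightarrow> nat set \<Rightarrow> complex" where
  "Rt a S = (if \<bar>exc S\<bar> = 1 then Rp a S else 0)"

text \<open>The factor that a block of variables contributes to the limit of \<open>t\<^sup>2 kap\<close>, defined so that
  \<open>Rt_lam\<close> holds.\<close>

function lam :: "(nat \<Rightarrow> complex) \<Rightarrow> nat set \<Rightarrow> complex" where
  "lam a S = (if finite S then Rt a S - (\<Sum>C\<in>{C. C \<subset> S}. lam a C * R0 a (S - C)) else 0)"
  by pat_completeness auto
termination
  by (relation "measure (card \<circ> snd)") (auto intro: psubset_card_mono)

declare lam.simps [simp del]

lemma Rt_lam:
  assumes "finite S"
  shows "Rt a S = (\<Sum>C\<in>Pow S. lam a C * R0 a (S - C))"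
proof -
  have "Pow S = insert S {C. C \<subset> S}" by auto
  moreover have "finite {C. C \<subset> S}" using assms by (simp add: finite_subset[of _ "Pow S"] subset_iff psubset_eq Collect_mono_iff)
  ultimately have "(\<Sum>C\<in>Pow S. lam a C * R0 a (S - C)) = lam a S + (\<Sum>C\<in>{C. C \<subset> S}. lam a C * R0 a (S - C))"
    by simp
  then show ?thesis using lam.simps[of a S] assms by simp
qed

lemma lam_zero:
  assumes "finite S" "\<bar>exc S\<bar> \<noteq> 1"
  shows "lam a S = 0"
  using assms
proof (induction "card S" arbitrary: S rule: less_induct)
  case less
  have "lam a C * R0 a (S - C) = 0" if "C \<subset> S" for C
  proof (cases "exc (S - C) = 0")
    case True
    then have "exc C = exc S" using exc_Diff[OF less.prems(1), of C] that by auto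
    then show ?thesis using less that psubset_card_mono finite_subset by (metis mult_zero_left psubset_imp_subset)
  qed (simp add: R0_def)
  then have "(\<Sum>C\<in>{C. C \<subset> S}. lam a C * R0 a (S - C)) = 0"
    by (intro sum.neutral ballI) simp
  then show ?case using less.prems by (subst lam.simps) (simp add: Rt_def)
qed

text \<open>A single variable sent to infinity contributes the factor 1, so the star map leaves just
  the \<open>lam\<close> of the remaining variables.\<close>

lemma lam_singleton: "lam a {x} = 1"
proof -
  have "{C. C \<subset> {x}} = {{}}" by auto
  then show ?thesis by (subst lam.simps) (simp add: lam_zero Rt_def exc_insert sg_def Rp_insert)
qed

lemma exc_image:
  assumes "finite S" "inj_on \<phi> S" "\<And>i. i \<in> S \<Longrightarrow> sg (\<phi> i) = c * sg i"
  shows "exc (\<phi> ` S) = c * exc S"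
  using assms unfolding exc_def by (simp add: sum.reindex sum_distrib_left)

lemma Rp_image:
  assumes "finite S" "inj_on \<phi> S" "\<And>i j. i \<in> S \<Longrightarrow> j \<in> S \<Longrightarrow> even (\<phi> i) = even (\<phi> j) \<longleftrightarrow> even i = even j"
  shows "Rp a (\<phi> ` S) = Rp (a \<circ> \<phi>) S"
  unfolding Rp_def
  by (subst pair_prod_image[OF assms(1,2) kf_sq_commute], rule pair_prod_cong) (use assms(3) in \<open>auto simp: kf_def\<close>)

text \<open>The sign \<open>c\<close> may be -1 because the second block is relabelled by j to 2 g1
  + 1 + j, which exchanges the parities. \<open>Rp\<close> sees only whether parities agree, and
  \<open>Rt\<close> and \<open>R0\<close> see the excess only up to sign.\<close>

lemma lam_image:
  assumes "finite S" "inj_on \<phi> S" "\<And>i. i \<in> S \<Longrightarrow> sg (\<phi> i) = c * sg i" "\<bar>c\<bar> = 1"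
  shows "lam a (\<phi> ` S) = lam (a \<circ> \<phi>) S"
  using assms(1-3)
proof (induction "card S" arbitrary: S rule: less_induct)
  case less
  have par: "even (\<phi> i) = even (\<phi> j) \<longleftrightarrow> even i = even j" if "i \<in> S" "j \<in> S" for i j
    using less.prems(3)[OF that(1)] less.prems(3)[OF that(2)] assms(4)
    by (auto simp: sg_def split: if_splits)
  have sub: "exc (\<phi> ` T) = c * exc T" "Rp a (\<phi> ` T) = Rp (a \<circ> \<phi>) T" if "T \<subseteq> S" for T
  proof -
    have fT: "finite T" and iT: "inj_on \<phi> T"
      using that less.prems finite_subset inj_on_subset by blast+
    show "exc (\<phi> ` T) = c * exc T" by (rule exc_image[OF fT iT]) (use that less.prems(3) in auto)
    show "Rp a (\<phi> ` T) = Rp (a \<circ> \<phi>) T" by (rule Rp_image[OF fT iT]) (use that par in auto)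
  qed
  have psub: "{C. C \<subset> \<phi> ` S} = (`) \<phi> ` {C. C \<subset> S}"
  proof (intro equalityI subsetI)
    fix C assume "C \<in> {C. C \<subset> \<phi> ` S}"
    then have C: "C \<subset> \<phi> ` S" by simp
    then obtain D where D: "D \<subseteq> S" "C = \<phi> ` D" by (meson psubset_imp_subset subset_imageE)
    then show "C \<in> (`) \<phi> ` {C. C \<subset> S}" using C by blast
  next
    fix C assume "C \<in> (`) \<phi> ` {C. C \<subset> S}"
    then obtain D where D: "D \<subset> S" "C = \<phi> ` D" by auto
    then have "\<phi> ` D \<noteq> \<phi> ` S" using inj_on_image_eq_iff[OF less.prems(2), of D S] by auto
    then show "C \<in> {C. C \<subset> \<phi> ` S}" using D by auto
  qed
  have inj: "inj_on ((`) \<phi>) {C. C \<subset> S}"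
    using less.prems(2) by (auto intro!: inj_onI simp: inj_on_image_eq_iff psubset_imp_subset)
  have "lam a (\<phi> ` S) = Rt a (\<phi> ` S) - (\<Sum>C\<in>{C. C \<subset> S}. lam a (\<phi> ` C) * R0 a (\<phi> ` S - \<phi> ` C))"
    using less.prems(1) by (subst lam.simps) (simp add: psub sum.reindex[OF inj])
  also have "Rt a (\<phi> ` S) = Rt (a \<circ> \<phi>) S"
    using sub[of S] assms(4) by (simp add: Rt_def abs_mult)
  also have "(\<Sum>C\<in>{C. C \<subset> S}. lam a (\<phi> ` C) * R0 a (\<phi> ` S - \<phi> ` C))
      = (\<Sum>C\<in>{C. C \<subset> S}. lam (a \<circ> \<phi>) C * R0 (a \<circ> \<phi>) (S - C))"
  proof (intro sum.cong refl)
    fix C assume "C \<in> {C. C \<subset> S}"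
    then have C: "C \<subset> S" by simp
    have 1: "\<phi> ` S - \<phi> ` C = \<phi> ` (S - C)"
      using C less.prems(2) by (metis inj_on_image_set_diff order_refl psubset_imp_subset Diff_subset)
    have 2: "lam a (\<phi> ` C) = lam (a \<circ> \<phi>) C"
    proof (rule less.hyps)
      show "card C < card S" using C less.prems(1) by (rule psubset_card_mono[rotated])
      show "finite C" using C less.prems(1) finite_subset by blast
      show "inj_on \<phi> C" using C less.prems(2) inj_on_subset by blast
    qed (use C less.prems(3) in auto)
    show "lam a (\<phi> ` C) * R0 a (\<phi> ` S - \<phi> ` C) = lam (a \<circ> \<phi>) C * R0 (a \<circ> \<phi>) (S - C)"
      unfolding 1 2 R0_def using sub[of "S - C"] assms(4) by auto
  qed
  finally show ?case using less.prems(1) lam.simps[of "a \<circ> \<phi>" S] by (simp add: comp_def)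
qed

lemma lam_cong:
  assumes "\<And>i. i \<in> S \<Longrightarrow> a i = b i" "finite S"
  shows "lam a S = lam b S"
  using assms
proof (induction "card S" arbitrary: S rule: less_induct)
  case less
  have R: "Rp a T = Rp b T" if "T \<subseteq> S" for T
    unfolding Rp_def using that less.prems by (intro pair_prod_cong) (auto simp: kf_def subset_iff)
  have "(\<Sum>C\<in>{C. C \<subset> S}. lam a C * R0 a (S - C)) = (\<Sum>C\<in>{C. C \<subset> S}. lam b C * R0 b (S - C))"
  proof (intro sum.cong refl)
    fix C assume "C \<in> {C. C \<subset> S}"
    then have C: "C \<subset> S" by simp
    have "lam a C = lam b C"
      using C less.prems psubset_card_mono finite_subset by (intro less.hyps) blast+
    then show "lam a C * R0 a (S - C) = lam b C * R0 b (S - C)"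
      using R[of "S - C"] by (simp add: R0_def)
  qed
  then show ?case using less.prems R[of S] lam.simps[of a S] lam.simps[of b S] by (simp add: Rt_def)
qed

text \<open>In the expansion \<open>Rt_lam\<close> either p lies in the \<open>lam\<close> block, or
  it lies in the rest; in the second case \<open>R0_kap_rec\<close> extracts the cycle through p,
  and the remaining sum over \<open>lam\<close> blocks is again an \<open>Rt\<close>. This is the
  identity to which the recursion for \<open>R0\<close> degenerates.\<close>

lemma Rt_kap_lam:
  assumes "finite S" "inj_on a S" "p \<in> S"
  shows "Rt a S = (\<Sum>C | p \<in> C \<and> C \<subseteq> S. kap a p C * Rt a (S - C)) + (\<Sum>C | p \<in> C \<and> C \<subseteq> S. lam a C * R0 a (S - C))"
proof -
  have fin: "finite D" if "D \<subseteq> S" for D using that assms(1) finite_subset by blast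
  have "Rt a S = (\<Sum>C\<in>Pow (S - {p}). lam a C * R0 a (S - C)) + (\<Sum>C | p \<in> C \<and> C \<subseteq> S. lam a C * R0 a (S - C))"
    unfolding Rt_lam[OF assms(1)] using assms(1)
    by (subst sum.union_disjoint[symmetric]) (auto intro!: sum.cong)
  also have "(\<Sum>C\<in>Pow (S - {p}). lam a C * R0 a (S - C))
      = (\<Sum>C\<in>Pow (S - {p}). \<Sum>D | p \<in> D \<and> D \<subseteq> S - C. lam a C * (kap a p D * R0 a (S - C - D)))"
  proof (intro sum.cong refl)
    fix C assume C: "C \<in> Pow (S - {p})"
    have "R0 a (S - C) = (\<Sum>D | p \<in> D \<and> D \<subseteq> S - C. kap a p D * R0 a (S - C - D))"
      using C assms by (intro R0_kap_rec) (auto simp: inj_on_def)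
    then show "lam a C * R0 a (S - C) = (\<Sum>D | p \<in> D \<and> D \<subseteq> S - C. lam a C * (kap a p D * R0 a (S - C - D)))"
      by (simp add: sum_distrib_left)
  qed
  also have "\<dots> = (\<Sum>(C, D)\<in>Sigma (Pow (S - {p})) (\<lambda>C. {D. p \<in> D \<and> D \<subseteq> S - C}). lam a C * (kap a p D * R0 a (S - C - D)))"
    using assms(1) by (subst sum.Sigma) auto
  also have "\<dots> = (\<Sum>(D, C)\<in>Sigma {D. p \<in> D \<and> D \<subseteq> S} (\<lambda>D. Pow (S - D)). kap a p D * (lam a C * R0 a (S - D - C)))"
    by (rule sum.reindex_bij_witness[of _ "\<lambda>(C, D). (D, C)" "\<lambda>(C, D). (D, C)"])
       (auto simp: Diff_Diff_Int mult_ac intro!: arg_cong[of _ _ "R0 a"])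
  also have "\<dots> = (\<Sum>D | p \<in> D \<and> D \<subseteq> S. kap a p D * Rt a (S - D))"
    using assms(1) by (subst sum.Sigma[symmetric]) (auto simp: Rt_lam sum_distrib_left)
  finally show ?thesis .
qed

section \<open>Orders of growth as a block of variables moves to infinity\<close>

definition shift :: "(nat \<Rightarrow> complex) \<Rightarrow> nat set \<Rightarrow> real \<Rightarrow> nat \<Rightarrow> complex" where
  "shift a T t i = a i + (if i \<in> T then of_real t else 0)"

text \<open>Mere existence of a limit suffices wherever this is used, because there the accompanying
  factor tends to 0.\<close>

definition has_limit :: "(real \<Rightarrow> complex) \<Rightarrow> bool" where
  "has_limit f \<longleftrightarrow> (\<exists>L. (f \<longlongrightarrow> L) at_top)"

lemma has_limit_mult: "has_limit f \<Longrightarrow> has_limit f' \<Longrightarrow> has_limit (\<lambda>t. f t * f' t)"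
  unfolding has_limit_def by (blast intro: tendsto_mult)

lemma has_limit_sum: "(\<And>x. x \<in> A \<Longrightarrow> has_limit (f x)) \<Longrightarrow> has_limit (\<lambda>t. \<Sum>x\<in>A. f x t)"
  unfolding has_limit_def using tendsto_sum[of A f _ at_top] by metis

lemma of_real_filterlim_infinity: "filterlim (\<lambda>t. complex_of_real t) at_infinity at_top"
  by (rule filterlim_of_real_at_infinity)

lemma tendsto_divide_linear: "((\<lambda>t. complex_of_real t / (c + of_real t)) \<longlongrightarrow> 1) at_top"
proof -
  have "((\<lambda>t. 1 / (c / complex_of_real t + 1)) \<longlongrightarrow> 1 / (0 + 1)) at_top"
    by (intro tendsto_intros tendsto_divide_0[OF tendsto_const of_real_filterlim_infinity]) simp
  moreover have "\<forall>\<^sub>F t in at_top. 1 / (c / complex_of_real t + 1) = complex_of_real t / (c + of_real t)"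
    using eventually_gt_at_top[of 0] by eventually_elim (simp add: field_simps)
  ultimately show ?thesis by (simp add: tendsto_cong)
qed

lemma tendsto_inverse_linear: "((\<lambda>t. 1 / (c + complex_of_real t)) \<longlongrightarrow> 0) at_top"
  by (intro tendsto_divide_0[OF tendsto_const] tendsto_add_filterlim_at_infinity[OF tendsto_const of_real_filterlim_infinity])

lemma has_limit_wt: "has_limit (\<lambda>t. wt (shift a T t) u v)"
proof (cases "(u \<in> T) = (v \<in> T)")
  case True
  then have "wt (shift a T t) u v = wt a u v" for t by (auto simp: wt_def shift_def)
  then show ?thesis by (auto simp: has_limit_def)
next
  case False
  have 1: "wt (shift a T t) u v = (if even u = even v then 0 else if u \<in> T then 1 / (a u - a v + of_real t) else - (1 / (a v - a u + of_real t)))" for t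
    using False by (auto simp: wt_def shift_def minus_divide_right algebra_simps)
  show ?thesis unfolding has_limit_def 1
    by (cases "even u = even v"; cases "u \<in> T")
      (auto intro: tendsto_inverse_linear tendsto_minus[OF tendsto_inverse_linear])
qed

lemma has_limit_wt_cross:
  assumes "(u \<in> T) \<noteq> (v \<in> T)"
  shows "has_limit (\<lambda>t. of_real t * wt (shift a T t) u v)"
proof -
  have 1: "of_real t * wt (shift a T t) u v = (if even u = even v then 0 else if u \<in> T then of_real t / (a u - a v + of_real t) else - (of_real t / (a v - a u + of_real t)))" for t
    using assms by (auto simp: wt_def shift_def minus_divide_right algebra_simps)
  show ?thesis unfolding has_limit_def 1
    by (cases "even u = even v"; cases "u \<in> T")
      (auto intro: tendsto_divide_linear tendsto_minus[OF tendsto_divide_linear])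
qed

lemma has_limit_path_sum:
  "finite A \<Longrightarrow> has_limit (\<lambda>t. path_sum (wt (shift a T t)) p A q)"
proof (induction "card A" arbitrary: A p)
  case 0
  then show ?case by (simp add: has_limit_wt)
next
  case (Suc n)
  then have "A \<noteq> {}" by auto
  with Suc show ?case
    by (auto simp: path_sum_rec intro!: has_limit_sum has_limit_mult has_limit_wt Suc.hyps(1))
qed

lemma has_limit_path_sum_cross:
  assumes "finite A" "(p \<in> T) \<noteq> (q \<in> T)"
  shows "has_limit (\<lambda>t. of_real t * path_sum (wt (shift a T t)) p A q)"
  using assms
proof (induction "card A" arbitrary: A p)
  case 0
  then show ?case by (simp add: has_limit_wt_cross)
next
  case (Suc n)
  then have ne: "A \<noteq> {}" by auto
  have "has_limit (\<lambda>t. of_real t * (wt (shift a T t) p x * path_sum (wt (shift a T t)) x (A - {x}) q))"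
    if x: "x \<in> A" for x
  proof (cases "(x \<in> T) = (p \<in> T)")
    case True
    then have "has_limit (\<lambda>t. wt (shift a T t) p x * (of_real t * path_sum (wt (shift a T t)) x (A - {x}) q))"
      using Suc x by (intro has_limit_mult has_limit_wt Suc.hyps(1)) auto
    then show ?thesis by (simp add: mult_ac)
  next
    case False
    then have "has_limit (\<lambda>t. (of_real t * wt (shift a T t) p x) * path_sum (wt (shift a T t)) x (A - {x}) q)"
      using Suc.prems(1) by (intro has_limit_mult has_limit_wt_cross has_limit_path_sum) auto
    then show ?thesis by (simp add: mult_ac)
  qed
  then show ?case using Suc.prems(1) ne
    by (simp add: path_sum_rec sum_distrib_left has_limit_sum)
qed

text \<open>A path that visits the other side and returns crosses between the sides at least twice,
  and each crossing edge is of order 1/t. The induction splits off the first step, which either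
  stays on the side of p or is itself a crossing.\<close>

lemma has_limit_path_sum_excursion:
  assumes "finite A" "(p \<in> T) = (q \<in> T)" "\<exists>x\<in>A. (x \<in> T) \<noteq> (p \<in> T)"
  shows "has_limit (\<lambda>t. (of_real t)\<^sup>2 * path_sum (wt (shift a T t)) p A q)"
  using assms
proof (induction "card A" arbitrary: A p)
  case (Suc n)
  then have ne: "A \<noteq> {}" by auto
  have "has_limit (\<lambda>t. (of_real t)\<^sup>2 * (wt (shift a T t) p x * path_sum (wt (shift a T t)) x (A - {x}) q))"
    if x: "x \<in> A" for x
  proof (cases "(x \<in> T) = (p \<in> T)")
    case True
    then have "has_limit (\<lambda>t. wt (shift a T t) p x * ((of_real t)\<^sup>2 * path_sum (wt (shift a T t)) x (A - {x}) q))"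
      using Suc x by (intro has_limit_mult has_limit_wt Suc.hyps(1)) auto
    then show ?thesis by (simp add: mult_ac)
  next
    case False
    then have "has_limit (\<lambda>t. (of_real t * wt (shift a T t) p x) * (of_real t * path_sum (wt (shift a T t)) x (A - {x}) q))"
      using Suc.prems by (intro has_limit_mult has_limit_wt_cross has_limit_path_sum_cross) auto
    then show ?thesis by (simp add: mult_ac power2_eq_square)
  qed
  then show ?case using Suc.prems(1) ne
    by (simp add: path_sum_rec sum_distrib_left has_limit_sum)
qed auto

lemma has_limit_kap:
  assumes "finite C" "p \<in> C" "p \<notin> T" "C \<inter> T \<noteq> {}"
  shows "has_limit (\<lambda>t. (of_real t)\<^sup>2 * kap (shift a T t) p C)"
proof -
  have "has_limit (\<lambda>t. (of_real t)\<^sup>2 * path_sum (wt (shift a T t)) p (C - {p}) p)"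
    using assms by (intro has_limit_path_sum_excursion) auto
  then show ?thesis unfolding has_limit_def kap_def using tendsto_minus by fastforce
qed

lemma kap_tendsto_0:
  assumes "finite C" "p \<in> C" "p \<notin> T" "C \<inter> T \<noteq> {}"
  shows "((\<lambda>t. kap (shift a T t) p C) \<longlongrightarrow> 0) at_top"
proof -
  obtain L where L: "((\<lambda>t. (of_real t)\<^sup>2 * kap (shift a T t) p C) \<longlongrightarrow> L) at_top"
    using has_limit_kap[OF assms] by (auto simp: has_limit_def)
  have "((\<lambda>t. (1 / complex_of_real t)\<^sup>2) \<longlongrightarrow> 0\<^sup>2) at_top"
    using tendsto_inverse_linear[of 0] by (intro tendsto_power) simp
  from tendsto_mult[OF this L] have
    "((\<lambda>t. (1 / complex_of_real t)\<^sup>2 * ((of_real t)\<^sup>2 * kap (shift a T t) p C)) \<longlongrightarrow> 0) at_top" by simp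
  moreover have "\<forall>\<^sub>F t in at_top. (1 / complex_of_real t)\<^sup>2 * ((of_real t)\<^sup>2 * kap (shift a T t) p C) = kap (shift a T t) p C"
    using eventually_gt_at_top[of 0] by eventually_elim (simp add: power_divide)
  ultimately show ?thesis by (simp add: tendsto_cong)
qed

lemma kf_shift_tendsto:
  assumes "i \<notin> T" "j \<in> T"
  shows "((\<lambda>t. (kf (shift a T t) i j)\<^sup>2 * complex_of_real t powi (- 2 * sg i * sg j)) \<longlongrightarrow> 1) at_top"
proof -
  define c where "c = a j - a i"
  have e: "shift a T t i - shift a T t j = - (c + of_real t)" for t
    using assms by (simp add: shift_def c_def)
  have lim: "((\<lambda>t. (complex_of_real t / (c + of_real t))\<^sup>2) \<longlongrightarrow> 1) at_top"
    using tendsto_power[OF tendsto_divide_linear, of c 2] by simp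
  have nz: "\<forall>\<^sub>F t in at_top. c + complex_of_real t \<noteq> 0"
    using eventually_gt_at_top[of "norm c"]
    by eventually_elim (metis add_eq_0_iff norm_minus_cancel norm_of_real abs_ge_self not_less)
  show ?thesis
  proof (cases "even i = even j")
    case True
    then have s: "- 2 * sg i * sg j = - 2" by (auto simp: sg_def)
    have "((\<lambda>t. inverse ((complex_of_real t / (c + of_real t))\<^sup>2)) \<longlongrightarrow> inverse 1) at_top"
      by (intro tendsto_inverse lim) simp
    moreover have "\<forall>\<^sub>F t in at_top. inverse ((complex_of_real t / (c + of_real t))\<^sup>2)
        = (kf (shift a T t) i j)\<^sup>2 * complex_of_real t powi (- 2 * sg i * sg j)"
      unfolding s using nz by eventually_elim (simp add: kf_def True e power_int_minus field_simps power2_eq_square)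
    ultimately show ?thesis by (simp add: tendsto_cong)
  next
    case False
    then have s: "- 2 * sg i * sg j = 2" by (auto simp: sg_def)
    have "(kf (shift a T t) i j)\<^sup>2 * complex_of_real t powi (- 2 * sg i * sg j) = (complex_of_real t / (c + of_real t))\<^sup>2" for t
      unfolding s using False by (simp add: kf_def e field_simps power2_eq_square)
    then show ?thesis using lim by simp
  qed
qed

lemma prod_power_int: "finite A \<Longrightarrow> (x::'a::field) \<noteq> 0 \<Longrightarrow> (\<Prod>i\<in>A. x powi f i) = x powi (\<Sum>i\<in>A. f i)"
  by (induction A rule: finite_induct) (auto simp: power_int_add)

text \<open>A pair i, j across the blocks contributes order t^(2 sg i sg j), and these exponents add
  up to twice the product of the two excesses. Integer powers are used because the total may have
  either sign.\<close>

lemma Rp_shift_tendsto: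
  assumes "finite S1" "finite S2" "S1 \<inter> T = {}" "S2 \<subseteq> T"
  shows "((\<lambda>t. Rp (shift a T t) (S1 \<union> S2) * complex_of_real t powi (- 2 * exc S1 * exc S2)) \<longlongrightarrow> Rp a S1 * Rp a S2) at_top"
proof -
  have R1: "Rp (shift a T t) S1 = Rp a S1" for t
    unfolding Rp_def using assms(3) by (intro pair_prod_cong) (auto simp: kf_def shift_def disjoint_iff)
  have R2: "Rp (shift a T t) S2 = Rp a S2" for t
    unfolding Rp_def using assms(4) by (intro pair_prod_cong) (auto simp: kf_def shift_def subset_iff)
  have R: "Rp (shift a T t) (S1 \<union> S2) = Rp a S1 * Rp a S2 * (\<Prod>i\<in>S1. \<Prod>j\<in>S2. (kf (shift a T t) i j)\<^sup>2)" for t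
  proof -
    have "Rp (shift a T t) (S1 \<union> S2) = Rp (shift a T t) S1 * Rp (shift a T t) S2 * (\<Prod>i\<in>S1. \<Prod>j\<in>S2. (kf (shift a T t) i j)\<^sup>2)"
      unfolding Rp_def using assms by (intro pair_prod_Un kf_sq_commute) auto
    then show ?thesis by (simp only: R1 R2)
  qed
  have "((\<lambda>t. Rp a S1 * Rp a S2 * (\<Prod>i\<in>S1. \<Prod>j\<in>S2. (kf (shift a T t) i j)\<^sup>2 * complex_of_real t powi (- 2 * sg i * sg j)))
      \<longlongrightarrow> Rp a S1 * Rp a S2 * (\<Prod>i\<in>S1. \<Prod>j\<in>S2. 1)) at_top"
    using assms by (intro tendsto_mult tendsto_const tendsto_prod kf_shift_tendsto) auto
  moreover have "\<forall>\<^sub>F t in at_top. Rp a S1 * Rp a S2 * (\<Prod>i\<in>S1. \<Prod>j\<in>S2. (kf (shift a T t) i j)\<^sup>2 * complex_of_real t powi (- 2 * sg i * sg j))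
    = Rp (shift a T t) (S1 \<union> S2) * complex_of_real t powi (- 2 * exc S1 * exc S2)"
    using eventually_gt_at_top[of 0]
  proof eventually_elim
    case (elim t)
    have "(\<Prod>i\<in>S1. \<Prod>j\<in>S2. complex_of_real t powi (- 2 * sg i * sg j)) = complex_of_real t powi (\<Sum>i\<in>S1. \<Sum>j\<in>S2. - 2 * sg i * sg j)"
      using elim assms(1,2) by (simp add: prod_power_int)
    also have "(\<Sum>i\<in>S1. \<Sum>j\<in>S2. - 2 * sg i * sg j) = - 2 * exc S1 * exc S2"
      by (simp add: exc_def sum_distrib_left sum_distrib_right sum_product sum_negf mult_ac)
    finally show ?case unfolding R prod.distrib by (simp add: mult_ac)
  qed
  ultimately show ?thesis by (simp add: tendsto_cong)
qed

text \<open>In a balanced union the excesses of the parts are e and -e, so the cross factor has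
  order t^(-2 e^2): it either tends to 1 or forces the limit 0.\<close>

lemma R0_shift_tendsto:
  assumes "finite S1" "finite S2" "S1 \<inter> T = {}" "S2 \<subseteq> T"
  shows "((\<lambda>t. R0 (shift a T t) (S1 \<union> S2)) \<longlongrightarrow> R0 a S1 * R0 a S2) at_top"
proof (cases "exc (S1 \<union> S2) = 0")
  case False
  then show ?thesis using assms exc_Un[of S1 S2] by (fastforce simp: R0_def)
next
  case True
  then have e: "exc S2 = - exc S1" using assms exc_Un[of S1 S2] by fastforce
  note lim = Rp_shift_tendsto[OF assms, of a]
  show ?thesis
  proof (cases "exc S1 = 0")
    case z: True
    then show ?thesis using lim e True by (simp add: R0_def)
  next
    case nz: False
    define n where "n = nat (2 * (exc S1)\<^sup>2)"
    have "(exc S1)\<^sup>2 > 0" using nz by simp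
    then have n: "- 2 * exc S1 * exc S2 = int n" "n \<noteq> 0" using e by (auto simp: n_def power2_eq_square)
    have "((\<lambda>t. (1 / complex_of_real t) ^ n) \<longlongrightarrow> 0 ^ n) at_top"
      using tendsto_inverse_linear[of 0] by (intro tendsto_power) simp
    from tendsto_mult[OF lim this] have
      "((\<lambda>t. Rp (shift a T t) (S1 \<union> S2) * complex_of_real t powi (- 2 * exc S1 * exc S2) * (1 / complex_of_real t) ^ n) \<longlongrightarrow> 0) at_top"
      using n(2) by (simp add: power_0_left)
    moreover have "\<forall>\<^sub>F t in at_top. Rp (shift a T t) (S1 \<union> S2) * complex_of_real t powi (- 2 * exc S1 * exc S2) * (1 / complex_of_real t) ^ n
      = R0 (shift a T t) (S1 \<union> S2)"
      using eventually_gt_at_top[of 0] unfolding n(1)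
      by eventually_elim (simp add: power_one_over R0_def True)
    ultimately have "((\<lambda>t. R0 (shift a T t) (S1 \<union> S2)) \<longlongrightarrow> 0) at_top" by (simp add: tendsto_cong)
    then show ?thesis using nz by (simp add: R0_def)
  qed
qed

lemma R0_shift_tendsto_sq:
  assumes "finite S1" "finite S2" "S1 \<inter> T = {}" "S2 \<subseteq> T" "\<bar>exc S1\<bar> = 1" "exc S2 = - exc S1"
  shows "((\<lambda>t. (of_real t)\<^sup>2 * R0 (shift a T t) (S1 \<union> S2)) \<longlongrightarrow> Rp a S1 * Rp a S2) at_top"
proof -
  have "- 2 * exc S1 * exc S2 = 2" using assms(5,6) by (auto simp: abs_if split: if_splits)
  moreover have "S1 \<inter> S2 = {}" using assms by auto
  moreover have "exc (S1 \<union> S2) = 0" using assms \<open>S1 \<inter> S2 = {}\<close> exc_Un[of S1 S2] by simp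
  ultimately show ?thesis using Rp_shift_tendsto[OF assms(1-4), of a] by (simp only: R0_def if_True) (simp add: mult.commute)
qed

lemma eventually_inj_on_shift:
  assumes "finite S1" "finite S2" "S1 \<inter> T = {}" "S2 \<subseteq> T" "inj_on a S1" "inj_on a S2"
  shows "\<forall>\<^sub>F t in at_top. inj_on (shift a T t) (S1 \<union> S2)"
proof -
  have "\<forall>\<^sub>F t in at_top. \<forall>i\<in>S1. \<forall>j\<in>S2. shift a T t i \<noteq> shift a T t j"
  proof (intro eventually_ball_finite ballI assms(1,2))
    fix i j assume ij: "i \<in> S1" "j \<in> S2"
    show "\<forall>\<^sub>F t in at_top. shift a T t i \<noteq> shift a T t j"
      using eventually_gt_at_top[of "norm (a i - a j)"]
    proof eventually_elim
      case (elim t)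
      show ?case
      proof
        assume "shift a T t i = shift a T t j"
        then have "a i - a j = of_real t" using ij assms(3,4) by (auto simp: shift_def split: if_splits)
        then show False using elim by simp
      qed
    qed
  qed
  then show ?thesis
  proof eventually_elim
    case (elim t)
    show ?case
    proof (rule inj_onI)
      fix i j assume ij: "i \<in> S1 \<union> S2" "j \<in> S1 \<union> S2" "shift a T t i = shift a T t j"
      have "i \<in> T \<longleftrightarrow> j \<in> T" using elim ij assms(3,4) by fastforce
      moreover have "a i = a j" using ij(3) \<open>i \<in> T \<longleftrightarrow> j \<in> T\<close> by (auto simp: shift_def split: if_splits)
      ultimately show "i = j" using ij assms(3-6) by (auto simp: inj_on_def)
    qed
  qed
qed

text \<open>Solve \<open>R0_kap_rec\<close> for the term C = S, multiply by t^2, and pass to the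
  limit in all other terms, using induction for those C that meet both blocks in excess 1 and -1.
  The expected limits \<open>l C\<close> over all C sum to the limit of t^2 \<open>R0\<close> by
  \<open>Rt_kap_lam\<close>, so what remains for C = S is \<open>l S\<close>.\<close>

theorem kap_shift_tendsto:
  assumes "finite S1" "finite S2" "S1 \<inter> T = {}" "S2 \<subseteq> T" "inj_on a S1" "inj_on a S2"
    and "\<bar>exc S1\<bar> = 1" "exc S2 = - exc S1" "p \<in> S1"
  shows "((\<lambda>t. (of_real t)\<^sup>2 * kap (shift a T t) p (S1 \<union> S2)) \<longlongrightarrow> lam a S1 * lam a S2) at_top"
  using assms
proof (induction "card (S1 \<union> S2)" arbitrary: S1 S2 rule: less_induct)
  case less
  note prems = less.prems
  define S where "S = S1 \<union> S2"
  have finS: "finite S" and pS: "p \<in> S" and pT: "p \<notin> T" and disj: "S1 \<inter> S2 = {}"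
    using prems by (auto simp: S_def)
  define Cs where "Cs = {C. p \<in> C \<and> C \<subseteq> S}"
  have finCs: "finite Cs" unfolding Cs_def using finS by auto
  \<comment> \<open>The first summand comes from cycles inside the fixed block, with t^2 absorbed by
    the remainder; the second from cycles meeting both blocks, with t^2 absorbed by the
    cycle.\<close>
  define l where "l C = kap a p (C \<inter> S1) * Rt a (S1 - C) * (if C \<inter> S2 = {} then Rp a S2 else 0)
      + lam a (C \<inter> S1) * lam a (C \<inter> S2) * R0 a (S1 - C) * R0 a (S2 - C)" for C
  have fin: "finite D" if "D \<subseteq> S" for D using that finS finite_subset by blast
  have subs: "S1 \<subseteq> S" "S2 \<subseteq> S" by (auto simp: S_def)
  have lim: "((\<lambda>t. (of_real t)\<^sup>2 * (kap (shift a T t) p C * R0 (shift a T t) (S - C))) \<longlongrightarrow> l C) at_top"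
    if C: "C \<in> Cs - {S}" for C
  proof -
    have CS: "C \<subseteq> S" "p \<in> C" "C \<noteq> S" using C by (auto simp: Cs_def)
    define C1 C2 where "C1 = C \<inter> S1" and "C2 = C \<inter> S2"
    have CC: "C = C1 \<union> C2" "C1 \<inter> C2 = {}" "p \<in> C1" "C1 \<subseteq> S1" "C2 \<subseteq> S2"
      using CS disj prems(9) by (auto simp: C1_def C2_def S_def)
    have SC: "S - C = (S1 - C) \<union> (S2 - C)" by (auto simp: S_def)
    have side: "finite (S1 - C)" "finite (S2 - C)" "(S1 - C) \<inter> T = {}" "S2 - C \<subseteq> T"
      "finite C1" "finite C2" "C1 \<inter> T = {}" "C2 \<subseteq> T" "finite C"
      using prems CC fin subs CS(1) by (auto intro: finite_subset)
    have eC: "exc C = exc C1 + exc C2" using CC side by (simp add: exc_Un)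
    have e1: "exc (S1 - C) = exc S1 - exc C1"
      using exc_Diff[of S1 C1] prems(1) CC(4) by (simp add: C1_def Diff_Int_distrib2 Diff_Int)
    have e2: "exc (S2 - C) = exc S2 - exc C2"
      using exc_Diff[of S2 C2] prems(2) CC(5) by (simp add: C2_def Diff_Int_distrib2 Diff_Int)
    have R0lim: "((\<lambda>t. R0 (shift a T t) (S - C)) \<longlongrightarrow> R0 a (S1 - C) * R0 a (S2 - C)) at_top"
      unfolding SC using side by (intro R0_shift_tendsto)
    show ?thesis
    proof (cases "exc C = 0")
      case False
      have "kap (shift a T t) p C = 0" for t using kap_unbalanced[OF side(9) CS(2) False] .
      moreover have "l C = 0"
      proof -
        have "kap a p C1 = 0 \<or> C2 \<noteq> {}"
          using kap_unbalanced[OF side(5) CC(3)] False eC by (cases "C2 = {}") auto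
        moreover have "lam a C1 * lam a C2 * R0 a (S1 - C) * R0 a (S2 - C) = 0"
          using e1 e2 eC False prems(8) by (auto simp: R0_def)
        ultimately show ?thesis by (auto simp: l_def C1_def C2_def)
      qed
      ultimately show ?thesis by simp
    next
      case bal: True
      show ?thesis
      proof (cases "C2 = {}")
        case True
        \<comment> \<open>The cycle stays in the fixed block, so its weight is constant in t, while
          the remainder splits into parts of excess 1 and -1 and decays like t^-2.\<close>
        have C1C: "C = C1" using CC True by simp
        have k: "kap (shift a T t) p C = kap a p C1" for t
          unfolding kap_def C1C
          by (intro arg_cong[of _ _ uminus] path_sum_cong) (use CC side in \<open>auto simp: wt_def shift_def\<close>)
        have l: "l C = kap a p C1 * (Rp a (S1 - C) * Rp a S2)"
        proof -
          have "\<bar>exc (S1 - C)\<bar> = 1" using e1 bal eC True prems(7) by simp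
          moreover have "lam a {} = 0" by (simp add: lam_zero)
          ultimately show ?thesis unfolding l_def using True by (simp add: C1_def C2_def Rt_def)
        qed
        have "S2 - C = S2" using True by (auto simp: C2_def)
        moreover have "((\<lambda>t. kap a p C1 * ((of_real t)\<^sup>2 * R0 (shift a T t) ((S1 - C) \<union> (S2 - C)))) \<longlongrightarrow> kap a p C1 * (Rp a (S1 - C) * Rp a (S2 - C))) at_top"
          using side e1 e2 bal eC True prems(7,8) by (intro tendsto_mult tendsto_const R0_shift_tendsto_sq) auto
        ultimately show ?thesis unfolding l k SC by (simp add: mult_ac)
      next
        case ne: False
        have CT: "C \<inter> T \<noteq> {}" using ne CC side by auto
        have l: "l C = lam a C1 * lam a C2 * (R0 a (S1 - C) * R0 a (S2 - C))"
          using ne by (simp add: l_def C1_def C2_def)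
        \<comment> \<open>If \<open>exc C1 = 0\<close>, the remainder already absorbs t^2 and the
          cycle weight tends to 0. If \<open>exc C1 = exc S1\<close>, both parts of the remainder
          are balanced and induction applies to C. Otherwise t^2 times the cycle weight has a limit
          and the remainder tends to 0.\<close>
        consider (zero) "exc C1 = 0" | (eq) "exc C1 = exc S1" | (other) "exc C1 \<noteq> 0" "exc C1 \<noteq> exc S1" by blast
        then show ?thesis
        proof cases
          case zero
          have "((\<lambda>t. kap (shift a T t) p C * ((of_real t)\<^sup>2 * R0 (shift a T t) ((S1 - C) \<union> (S2 - C)))) \<longlongrightarrow> 0 * (Rp a (S1 - C) * Rp a (S2 - C))) at_top"
            using side e1 e2 bal eC zero prems(7,8) CS pT CT
            by (intro tendsto_mult kap_tendsto_0 R0_shift_tendsto_sq) auto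
          moreover have "lam a C1 = 0" using zero side by (simp add: lam_zero)
          ultimately show ?thesis unfolding l SC by (simp add: mult_ac)
        next
          case eq
          have "((\<lambda>t. (of_real t)\<^sup>2 * kap (shift a T t) p (C1 \<union> C2)) \<longlongrightarrow> lam a C1 * lam a C2) at_top"
          proof (rule less.hyps)
            show "card (C1 \<union> C2) < card (S1 \<union> S2)"
              unfolding CC(1)[symmetric] S_def[symmetric] using CS finS by (intro psubset_card_mono) auto
            show "inj_on a C1" "inj_on a C2" using prems(5,6) CC(4,5) inj_on_subset by blast+
            show "exc C2 = - exc C1" using bal eC by simp
          qed (use side CC eq prems in auto)
          from tendsto_mult[OF this R0lim] show ?thesis unfolding l CC(1)[symmetric] by (simp add: mult_ac)
        next
          case other
          obtain L where L: "((\<lambda>t. (of_real t)\<^sup>2 * kap (shift a T t) p C) \<longlongrightarrow> L) at_top"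
            using has_limit_kap[OF side(9) CS(2) pT CT] unfolding has_limit_def by blast
          have "R0 a (S1 - C) = 0" using other e1 by (simp add: R0_def)
          then show ?thesis using tendsto_mult[OF L R0lim] unfolding l by (simp add: mult_ac)
        qed
      qed
    qed
  qed
  have lS: "l S = lam a S1 * lam a S2"
  proof -
    have eqs: "S \<inter> S1 = S1" "S \<inter> S2 = S2" "S1 - S = {}" "S2 - S = {}" by (auto simp: S_def)
    show ?thesis unfolding l_def eqs by (simp add: Rt_def)
  qed
  have suml: "(\<Sum>C\<in>Cs. l C) = Rp a S1 * Rp a S2"
  proof -
    define D1 where "D1 = {C. p \<in> C \<and> C \<subseteq> S1}"
    have fD1: "finite D1" using prems(1) by (auto simp: D1_def)
    have "(\<Sum>C\<in>Cs. l C) = (\<Sum>(C1, C2)\<in>D1 \<times> Pow S2. l (C1 \<union> C2))"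
      by (rule sum.reindex_bij_witness[of _ "\<lambda>(C1, C2). C1 \<union> C2" "\<lambda>C. (C \<inter> S1, C \<inter> S2)"])
         (use disj prems(9) in \<open>auto simp: Cs_def S_def D1_def Int_Un_distrib2 intro!: arg_cong[of _ _ l]\<close>)
    also have "\<dots> = (\<Sum>(C1, C2)\<in>D1 \<times> Pow S2. kap a p C1 * Rt a (S1 - C1) * (if C2 = {} then Rp a S2 else 0)
      + lam a C1 * R0 a (S1 - C1) * (lam a C2 * R0 a (S2 - C2)))"
    proof (intro sum.cong refl, clarify)
      fix C1 C2 assume "C1 \<in> D1" "C2 \<subseteq> S2"
      then have "(C1 \<union> C2) \<inter> S1 = C1" "(C1 \<union> C2) \<inter> S2 = C2" "S1 - (C1 \<union> C2) = S1 - C1" "S2 - (C1 \<union> C2) = S2 - C2"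
        using disj by (auto simp: D1_def)
      then show "l (C1 \<union> C2) = kap a p C1 * Rt a (S1 - C1) * (if C2 = {} then Rp a S2 else 0)
        + lam a C1 * R0 a (S1 - C1) * (lam a C2 * R0 a (S2 - C2))"
        unfolding l_def by (simp add: mult_ac)
    qed
    also have "\<dots> = (\<Sum>C1\<in>D1. \<Sum>C2\<in>Pow S2. kap a p C1 * Rt a (S1 - C1) * (if C2 = {} then Rp a S2 else 0))
      + (\<Sum>C1\<in>D1. \<Sum>C2\<in>Pow S2. lam a C1 * R0 a (S1 - C1) * (lam a C2 * R0 a (S2 - C2)))"
      by (simp only: sum.cartesian_product[symmetric] sum.distrib)
    also have "\<dots> = (\<Sum>C1\<in>D1. kap a p C1 * Rt a (S1 - C1)) * Rp a S2 + (\<Sum>C1\<in>D1. lam a C1 * R0 a (S1 - C1)) * Rt a S2"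
    proof -
      have "(\<Sum>C2\<in>Pow S2. x * (if C2 = {} then Rp a S2 else 0)) = x * Rp a S2" for x
        using prems(2) by (simp add: sum_distrib_left[symmetric])
      moreover have "(\<Sum>C2\<in>Pow S2. x * (lam a C2 * R0 a (S2 - C2))) = x * Rt a S2" for x
        using prems(2) by (simp add: sum_distrib_left[symmetric] Rt_lam)
      ultimately show ?thesis by (simp only: sum_distrib_right)
    qed
    also have "Rt a S2 = Rp a S2" using prems(7,8) by (simp add: Rt_def)
    also have "(\<Sum>C1\<in>D1. kap a p C1 * Rt a (S1 - C1)) * Rp a S2 + (\<Sum>C1\<in>D1. lam a C1 * R0 a (S1 - C1)) * Rp a S2 = Rt a S1 * Rp a S2"
      unfolding distrib_right[symmetric] D1_def Rt_kap_lam[OF prems(1,5,9)] ..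
    also have "Rt a S1 = Rp a S1" using prems(7) by (simp add: Rt_def)
    finally show ?thesis .
  qed
  have SC: "S \<in> Cs" using pS by (auto simp: Cs_def)
  have "((\<lambda>t. (of_real t)\<^sup>2 * R0 (shift a T t) S - (\<Sum>C\<in>Cs - {S}. (of_real t)\<^sup>2 * (kap (shift a T t) p C * R0 (shift a T t) (S - C))))
     \<longlongrightarrow> Rp a S1 * Rp a S2 - (\<Sum>C\<in>Cs - {S}. l C)) at_top"
    unfolding S_def by (intro tendsto_diff R0_shift_tendsto_sq prems tendsto_sum lim[unfolded S_def])
  moreover have "Rp a S1 * Rp a S2 - (\<Sum>C\<in>Cs - {S}. l C) = lam a S1 * lam a S2"
    using suml sum.remove[OF finCs SC, of l] lS by (simp add: diff_eq_eq add.commute)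
  moreover have "\<forall>\<^sub>F t in at_top. (of_real t)\<^sup>2 * R0 (shift a T t) S - (\<Sum>C\<in>Cs - {S}. (of_real t)\<^sup>2 * (kap (shift a T t) p C * R0 (shift a T t) (S - C)))
     = (of_real t)\<^sup>2 * kap (shift a T t) p S"
    using eventually_inj_on_shift[OF prems(1-6)]
  proof eventually_elim
    case (elim t)
    have "R0 (shift a T t) S = (\<Sum>C\<in>Cs. kap (shift a T t) p C * R0 (shift a T t) (S - C))"
      unfolding Cs_def using elim by (intro R0_kap_rec finS pS) (simp add: S_def)
    also have "\<dots> = kap (shift a T t) p S + (\<Sum>C\<in>Cs - {S}. kap (shift a T t) p C * R0 (shift a T t) (S - C))"
      by (subst sum.remove[OF finCs SC]) simp
    finally show ?case by (simp add: sum_distrib_left distrib_left)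
  qed
  ultimately show ?case unfolding S_def by (simp add: tendsto_cong)
qed

subsection \<open>Moebius inversion over subspaces of theta characteristics\<close>

lemma bit_add_self [simp]: "(x::bit) + x = 0"
  by (cases x) simp_all

lemma char_add_self [simp]: "(x::char_array) + x = 0"
  by (rule poly_mapping_eqI) (simp add: lookup_add)

lemma char_minus [simp]: "(x::char_array) - y = x + y"
  by (rule poly_mapping_eqI) (simp add: lookup_add lookup_minus)

lemma char_add_cancel [simp]: "(x::char_array) + (x + y) = y"
  by (simp flip: add.assoc)

lemma mem_char_coset: "z \<in> (+) x ` A \<longleftrightarrow> z + x \<in> (A :: char_array set)"
proof
  assume "z \<in> (+) x ` A"
  then obtain y where "y \<in> A" "z = x + y" by auto
  then show "z + x \<in> A" by (simp add: add.commute[of "x + y"])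
next
  assume "z + x \<in> A"
  moreover have "z = x + (z + x)" by (simp add: add.commute[of z])
  ultimately show "z \<in> (+) x ` A" by blast
qed

lemma char_subspace_iff:
  "char_space.subspace V \<longleftrightarrow> 0 \<in> V \<and> (\<forall>x\<in>V. \<forall>y\<in>V. x + y \<in> V)"
proof -
  have "char_scale c x \<in> V" if "0 \<in> V" "x \<in> V" for c x
    using that by (cases c) simp_all
  then show ?thesis unfolding char_space.subspace_def by blast
qed

lemma card_span_independent:
  assumes "finite b" "char_space.independent b"
  shows "finite (char_space.span b) \<and> card (char_space.span b) = 2 ^ card b"
  using assms
proof (induction b rule: finite_induct)
  case (insert x b)
  have ind: "char_space.independent b" and x: "x \<notin> char_space.span b"
    using insert char_space.independent_insert by auto
  note IH = insert.IH[OF ind]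
  have eq: "char_space.span (insert x b) = char_space.span b \<union> (+) x ` char_space.span b"
  proof -
    have "z \<in> char_space.span (insert x b) \<longleftrightarrow> z \<in> char_space.span b \<or> z + x \<in> char_space.span b" for z
    proof -
      have "(\<exists>k. P k) \<longleftrightarrow> P 0 \<or> P 1" for P :: "bit \<Rightarrow> bool" by (metis bit.exhaust)
      then show ?thesis unfolding char_space.span_insert by simp
    qed
    then show ?thesis by (intro set_eqI) (simp only: Un_iff mem_char_coset)
  qed
  have disj: "char_space.span b \<inter> (+) x ` char_space.span b = {}"
  proof safe
    fix y assume y: "y \<in> char_space.span b" "x + y \<in> char_space.span b"
    then have "(x + y) + y \<in> char_space.span b" using char_space.span_add by blast
    then show "x + y \<in> {}" using x by (simp add: add.assoc)
  qed
  have "card ((+) x ` char_space.span b) = card (char_space.span b)"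
    by (intro card_image) (simp add: inj_on_def)
  then show ?case unfolding eq using IH disj insert.hyps by (simp add: card_Un_disjoint)
qed simp

lemma card_subspace:
  assumes "char_space.subspace V" "finite V"
  shows "card V = 2 ^ char_space.dim V"
proof -
  obtain b where b: "b \<subseteq> V" "char_space.independent b" "V \<subseteq> char_space.span b" "card b = char_space.dim V"
    using char_space.basis_exists by blast
  moreover have "char_space.span b = V" using b assms(1) by (metis char_space.span_mono char_space.span_eq_iff subset_antisym)
  ultimately show ?thesis using card_span_independent[of b] assms(2) finite_subset by metis
qed

definition subs :: "char_array set \<Rightarrow> char_array set set" where
  "subs Z = {V. char_space.subspace V \<and> V \<subseteq> Z}"

text \<open>The Moebius function from {0} to V in the lattice of subspaces of an F_2-space; these
  are the coefficients in K.\<close>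

definition mu :: "char_array set \<Rightarrow> complex" where
  "mu V = (- 1) ^ char_space.dim V * 2 ^ (char_space.dim V * (char_space.dim V - 1) div 2)"

lemma finite_subs [simp]: "finite Z \<Longrightarrow> finite (subs Z)"
  unfolding subs_def by (rule finite_subset[of _ "Pow Z"]) auto

lemma subs_zero [simp]: "subs {0} = {{0}}"
  by (auto simp: subs_def char_subspace_iff)

lemma mu_zero [simp]: "mu {0} = 1"
proof -
  have "(2::nat) ^ char_space.dim {0} = 2 ^ 0" using card_subspace[of "{0}"] by simp
  then have "char_space.dim {0} = 0" by (simp only: power_inject_exp)
  then show ?thesis by (simp add: mu_def)
qed

lemma mu_extend:
  assumes "char_space.subspace U" "char_space.subspace V" "finite V" "finite U" "card V = 2 * card U"
  shows "mu V = - (of_nat (card U) * mu U)"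
proof -
  define d where "d = char_space.dim U"
  have "(2::nat) ^ char_space.dim V = 2 ^ Suc d"
    using card_subspace assms by (simp add: d_def)
  then have dV: "char_space.dim V = Suc d" by (simp add: power_inject_exp del: power_Suc)
  have "Suc d * d div 2 = d + d * (d - 1) div 2"
  proof -
    have "Suc d * d = d * 2 + d * (d - 1)" by (cases d) (auto simp: algebra_simps)
    then show ?thesis by simp
  qed
  then have e: "Suc d * (Suc d - 1) div 2 = d + d * (d - 1) div 2" by simp
  have c: "card U = 2 ^ d" using card_subspace[OF assms(1,4)] by (simp add: d_def)
  show ?thesis unfolding mu_def dV e c d_def[symmetric] by (simp add: power_add)
qed

text \<open>\<open>H\<close> has index 2 in \<open>Z\<close>, so the sum of two elements outside
  \<open>H\<close> lies in \<open>H\<close>. Hence a subspace containing w is recovered from its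
  trace U on \<open>H\<close> as the union of U and w + U.\<close>

lemma coset_extension:
  assumes H: "char_space.subspace H" "finite H" and Z: "Z = H \<union> (+) x ` H" and x: "x \<notin> H" and w: "w \<in> Z - H"
  shows "bij_betw (\<lambda>V. V \<inter> H) {V \<in> subs Z. w \<in> V} (subs H)"
    and "\<And>V. V \<in> subs Z \<Longrightarrow> w \<in> V \<Longrightarrow> V = (V \<inter> H) \<union> (+) w ` (V \<inter> H)"
proof -
  have wx: "w + x \<in> H" using w Z by (auto simp: add_ac)
  have sH: "y + z \<in> H" if "y \<in> H" "z \<in> H" for y z using that H by (simp add: char_subspace_iff)
  have coset: "v + w \<in> H" if "v \<in> Z" "v \<notin> H" for v
  proof -
    have "v + x \<in> H" using that Z by (auto simp: add_ac)
    then have "(v + x) + (w + x) \<in> H" using wx sH by blast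
    then show ?thesis by (simp add: add_ac)
  qed
  show ext: "V = (V \<inter> H) \<union> (+) w ` (V \<inter> H)" if V: "V \<in> subs Z" "w \<in> V" for V
  proof (intro equalityI subsetI)
    fix v assume v: "v \<in> V"
    show "v \<in> (V \<inter> H) \<union> (+) w ` (V \<inter> H)"
    proof (cases "v \<in> H")
      case False
      have "v + w \<in> V \<inter> H" using coset[of v] False v V by (auto simp: subs_def char_subspace_iff)
      moreover have "v = w + (v + w)" by (simp add: add.commute)
      ultimately show ?thesis by blast
    qed (use v in auto)
  next
    fix v assume "v \<in> (V \<inter> H) \<union> (+) w ` (V \<inter> H)"
    then show "v \<in> V" using V by (auto simp: subs_def char_subspace_iff)
  qed
  show "bij_betw (\<lambda>V. V \<inter> H) {V \<in> subs Z. w \<in> V} (subs H)"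
  proof (rule bij_betw_byWitness[where f' = "\<lambda>U. U \<union> (+) w ` U"])
    show "\<forall>V\<in>{V \<in> subs Z. w \<in> V}. (V \<inter> H) \<union> (+) w ` (V \<inter> H) = V" using ext by auto
    show "\<forall>U\<in>subs H. (U \<union> (+) w ` U) \<inter> H = U"
    proof (intro ballI equalityI subsetI)
      fix U v assume U: "U \<in> subs H" and v: "v \<in> (U \<union> (+) w ` U) \<inter> H"
      show "v \<in> U"
      proof (rule ccontr)
        assume "v \<notin> U"
        then obtain u where u: "u \<in> U" "v = w + u" using v by auto
        then have "v + u \<in> H" using v U sH by (auto simp: subs_def)
        then show False using u w by (simp add: add_ac)
      qed
    qed (auto simp: subs_def)
    show "(\<lambda>V. V \<inter> H) ` {V \<in> subs Z. w \<in> V} \<subseteq> subs H"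
      using H by (auto simp: subs_def char_subspace_iff)
    show "(\<lambda>U. U \<union> (+) w ` U) ` subs H \<subseteq> {V \<in> subs Z. w \<in> V}"
    proof (intro image_subsetI CollectI conjI)
      fix U assume U: "U \<in> subs H"
      have "w + u \<in> Z" if "u \<in> H" for u
      proof -
        have "(w + x) + u \<in> H" using that wx sH by blast
        then have "x + ((w + x) + u) \<in> Z" using Z by blast
        then show ?thesis by (simp add: add_ac)
      qed
      then show "U \<union> (+) w ` U \<in> subs Z"
        using U Z by (auto simp: subs_def char_subspace_iff add_ac)
      have "0 \<in> U" using U by (auto simp: subs_def char_subspace_iff)
      then show "w \<in> U \<union> (+) w ` U" by (metis add.right_neutral imageI UnI2)
    qed
  qed
qed

text \<open>Choose a hyperplane \<open>H\<close> of \<open>Z\<close> and count pairs (V, w) with w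
  in V - H. A subspace V outside \<open>H\<close> has as many such w as elements of V \<inter> H,
  which is up to sign the factor from \<open>mu (V \<inter> H)\<close> to \<open>mu V\<close>; and
  for each w the V correspond to all subspaces of \<open>H\<close>. So the sum for \<open>Z\<close>
  is (1 - card H) times that for \<open>H\<close>, which vanishes by induction, or because card H =
  1.\<close>

theorem sum_mu:
  assumes "char_space.subspace Z" "finite Z"
  shows "(\<Sum>V\<in>subs Z. mu V) = (if Z = {0} then 1 else 0)"
  using assms
proof (induction "card Z" arbitrary: Z rule: less_induct)
  case less
  show ?case
  proof (cases "Z = {0}")
    case False
    obtain b where b: "b \<subseteq> Z" "char_space.independent b" "Z \<subseteq> char_space.span b"
      using char_space.basis_exists[of Z] by metis
    have spb: "char_space.span b = Z" using b less.prems(1) by (metis char_space.span_mono char_space.span_eq_iff subset_antisym)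
    have "b \<noteq> {}" using spb False by auto
    then obtain x where x: "x \<in> b" by auto
    define H where "H = char_space.span (b - {x})"
    have H: "char_space.subspace H" "finite H"
      using less.prems(2) spb char_space.span_mono[of "b - {x}" b] finite_subset by (auto simp: H_def)
    have xH: "x \<notin> H" using b(2) x unfolding H_def char_space.dependent_def by auto
    have Z: "Z = H \<union> (+) x ` H"
    proof -
      have "z \<in> Z \<longleftrightarrow> z \<in> H \<or> z + x \<in> H" for z
      proof -
        have "(\<exists>k. P k) \<longleftrightarrow> P 0 \<or> P 1" for P :: "bit \<Rightarrow> bool" by (metis bit.exhaust)
        then show ?thesis using char_space.span_insert[of x "b - {x}"] x spb by (simp add: H_def insert_absorb)
      qed
      then show ?thesis by (intro set_eqI) (simp only: Un_iff mem_char_coset)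
    qed
    have H0: "0 \<in> H" using H by (simp add: char_subspace_iff)
    have sH: "y + z \<in> H" if "y \<in> H" "z \<in> H" for y z using that H by (simp add: char_subspace_iff)
    have WH: "Z - H = (+) x ` H"
    proof (intro equalityI subsetI)
      fix v assume v: "v \<in> (+) x ` H"
      then obtain u where u: "u \<in> H" "v = x + u" by auto
      have "v \<notin> H"
      proof
        assume "v \<in> H"
        then have "v + u \<in> H" using sH u by blast
        then show False using u xH by (simp add: add_ac)
      qed
      then show "v \<in> Z - H" using Z v by auto
    qed (use Z in auto)
    have cWH: "card (Z - H) = card H" unfolding WH by (intro card_image) (simp add: inj_on_def)
    define X where "X = {V \<in> subs Z. \<not> V \<subseteq> H}"
    have V_facts: "card V = 2 * card (V \<inter> H) \<and> card (V - H) = card (V \<inter> H) \<and> card (V \<inter> H) \<noteq> 0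
        \<and> char_space.subspace (V \<inter> H) \<and> mu V = - (of_nat (card (V \<inter> H)) * mu (V \<inter> H))"
      if V: "V \<in> subs Z" "w \<in> V" "w \<notin> H" for V w
    proof -
      have w: "w \<in> Z - H" using V by (auto simp: subs_def)
      have fV: "finite V" using V less.prems(2) finite_subset by (auto simp: subs_def)
      have sub: "char_space.subspace (V \<inter> H)" "char_space.subspace V"
        using V H by (auto simp: subs_def char_subspace_iff)
      have e: "V = (V \<inter> H) \<union> (+) w ` (V \<inter> H)" by (rule coset_extension(2)[OF H Z xH w V(1,2)])
      have disj: "(+) w ` (V \<inter> H) \<inter> H = {}"
      proof safe
        fix u assume "u \<in> V" "u \<in> H" "w + u \<in> H"
        then have "(w + u) + u \<in> H" using sH by blast
        then show "w + u \<in> {}" using w by (simp add: add.assoc)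
      qed
      then have VH: "V - H = (+) w ` (V \<inter> H)" using e by auto
      have c1: "card (V - H) = card (V \<inter> H)" unfolding VH by (intro card_image) (simp add: inj_on_def)
      have c2: "card V = 2 * card (V \<inter> H)" using card_Int_Diff[OF fV, of H] c1 by simp
      have "0 \<in> V \<inter> H" using sub by (simp add: char_subspace_iff)
      then have "card (V \<inter> H) \<noteq> 0" using fV by (auto simp: card_eq_0_iff)
      with c1 c2 sub show ?thesis using mu_extend[OF sub fV _ c2] fV by blast
    qed
    \<comment> \<open>Spreading \<open>mu V\<close> evenly over the elements of V - H makes the
      summand depend only on the trace V \<inter> H.\<close>
    have "(\<Sum>V\<in>X. mu V) = (\<Sum>V\<in>X. \<Sum>w\<in>V - H. - mu (V \<inter> H))"
    proof (intro sum.cong refl)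
      fix V assume "V \<in> X"
      then obtain w where "V \<in> subs Z" "w \<in> V" "w \<notin> H" by (auto simp: X_def)
      from V_facts[OF this] show "mu V = (\<Sum>w\<in>V - H. - mu (V \<inter> H))" by simp
    qed
    also have "\<dots> = (\<Sum>(V, w)\<in>Sigma X (\<lambda>V. V - H). - mu (V \<inter> H))"
      using less.prems(2) by (subst sum.Sigma) (auto simp: X_def subs_def intro: finite_subset)
    also have "\<dots> = (\<Sum>(w, V)\<in>Sigma (Z - H) (\<lambda>w. {V \<in> subs Z. w \<in> V}). - mu (V \<inter> H))"
      by (rule sum.reindex_bij_witness[of _ "\<lambda>(w, V). (V, w)" "\<lambda>(V, w). (w, V)"])
         (auto simp: X_def subs_def)
    also have "\<dots> = (\<Sum>w\<in>Z - H. \<Sum>V\<in>{V \<in> subs Z. w \<in> V}. - mu (V \<inter> H))"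
      using less.prems(2) by (subst sum.Sigma) auto
    also have "\<dots> = (\<Sum>w\<in>Z - H. \<Sum>U\<in>subs H. - mu U)"
    proof (rule sum.cong[OF refl])
      fix w assume w: "w \<in> Z - H"
      show "(\<Sum>V\<in>{V \<in> subs Z. w \<in> V}. - mu (V \<inter> H)) = (\<Sum>U\<in>subs H. - mu U)"
        using sum.reindex_bij_betw[OF coset_extension(1)[OF H Z xH w], of "\<lambda>U. - mu U"] .
    qed
    also have "\<dots> = - of_nat (card H) * (\<Sum>U\<in>subs H. mu U)" by (simp add: cWH sum_negf)
    finally have X: "(\<Sum>V\<in>X. mu V) = - of_nat (card H) * (\<Sum>U\<in>subs H. mu U)" .
    have "subs Z = subs H \<union> X" "subs H \<inter> X = {}" using Z by (auto simp: subs_def X_def)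
    moreover have "finite X" using less.prems(2) by (simp add: X_def)
    ultimately have "(\<Sum>V\<in>subs Z. mu V) = (\<Sum>V\<in>subs H. mu V) + (\<Sum>V\<in>X. mu V)"
      using H(2) by (simp add: sum.union_disjoint)
    also have "\<dots> = (1 - of_nat (card H)) * (\<Sum>U\<in>subs H. mu U)" unfolding X by (simp add: algebra_simps)
    also have "\<dots> = 0"
    proof (cases "H = {0}")
      case False
      have "card H < card Z"
        using Z xH H0 less.prems(2) by (intro psubset_card_mono) (auto intro!: image_eqI[of x _ 0])
      then show ?thesis using less.hyps[OF _ H] False by simp
    qed simp
    finally show ?thesis using False by simp
  qed simp
qed

section \<open>Characteristics as even subsets of the index set\<close>

declare add_bit_eq_xor [simp del]

text \<open>The symplectic pairing of \<open>\<zeta>\<close> with \<open>\<eta>\<^sub>i\<close>; as a function of \<open>i\<close> it is the indicator of the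
  even set \<open>S\<close> with \<open>\<zeta> = \<eta>\<^sub>S\<close> that does not contain \<open>2g + 2\<close>.\<close>

definition cf :: "nat \<Rightarrow> char_array \<Rightarrow> nat \<Rightarrow> bit" where
  "cf g \<zeta> i = (if i = 2 * g + 2 then 0
     else (\<Sum>l\<in>{1..i div 2}. Poly_Mapping.lookup \<zeta> (1, l)) + Poly_Mapping.lookup \<zeta> (2, (i + 1) div 2))"

lemma cf_add: "cf g (\<zeta> + \<xi>) i = cf g \<zeta> i + cf g \<xi> i"
  by (simp add: cf_def lookup_add sum.distrib)

lemma cf_zero [simp]: "cf g 0 i = 0"
  by (simp add: cf_def)

lemma cf_sum: "cf g (\<Sum>x\<in>A. f x) i = (\<Sum>x\<in>A. cf g (f x) i)"
  by (induction A rule: infinite_finite_induct) (auto simp: cf_add)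

lemma chars_lookup: "\<zeta> \<in> chars g \<Longrightarrow> p \<notin> {1, 2} \<times> {1..g} \<Longrightarrow> Poly_Mapping.lookup \<zeta> p = 0"
  unfolding chars_def using in_keys_iff[of p \<zeta>] by blast

lemma chars_subspace: "char_space.subspace (chars g)"
proof -
  have "\<zeta> + \<xi> \<in> chars g" if "\<zeta> \<in> chars g" "\<xi> \<in> chars g" for \<zeta> \<xi>
    using that keys_add[of \<zeta> \<xi>] unfolding chars_def by blast
  then show ?thesis by (auto simp: char_subspace_iff) (auto simp: chars_def)
qed

lemma finite_chars: "finite (chars g)"
proof -
  have "inj_on Poly_Mapping.keys (chars g)"
  proof (rule inj_onI)
    fix \<zeta> \<xi> :: char_array assume k: "Poly_Mapping.keys \<zeta> = Poly_Mapping.keys \<xi>"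
    show "\<zeta> = \<xi>"
    proof (rule poly_mapping_eqI)
      fix p
      have "(Poly_Mapping.lookup \<zeta> p = 0) = (Poly_Mapping.lookup \<xi> p = 0)" using k by (metis in_keys_iff)
      then show "Poly_Mapping.lookup \<zeta> p = Poly_Mapping.lookup \<xi> p"
        by (cases "Poly_Mapping.lookup \<zeta> p"; cases "Poly_Mapping.lookup \<xi> p") simp_all
    qed
  qed
  moreover have "Poly_Mapping.keys ` chars g \<subseteq> Pow ({1, 2} \<times> {1..g})" by (auto simp: chars_def)
  ultimately show ?thesis by (meson finite_Pow_iff finite_SigmaI finite_atLeastAtMost finite.emptyI
        finite.insertI finite_imageD finite_subset)
qed

text \<open>The entries can be read back: \<open>cf\<close> at 2m+1 and 2m+2 differ by the top entry
  m+1, and once the top row vanishes, \<open>cf\<close> at 2k is the bottom entry k.\<close>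

lemma cf_eq_zero_imp:
  assumes \<zeta>: "\<zeta> \<in> chars g" and z: "\<And>i. i \<in> {1..2 * g + 1} \<Longrightarrow> cf g \<zeta> i = 0"
  shows "\<zeta> = 0"
proof -
  have top: "Poly_Mapping.lookup \<zeta> (1, k) = 0" if k: "k \<in> {1..g}" for k
  proof -
    obtain m where m: "k = Suc m" using k by (cases k) auto
    have e: "cf g \<zeta> (2 * m + 2) = 0" "cf g \<zeta> (2 * m + 1) = 0" using k m by (auto intro!: z)
    have "cf g \<zeta> (2 * m + 2) = Poly_Mapping.lookup \<zeta> (1, k) + cf g \<zeta> (2 * m + 1)"
      using k m by (simp add: cf_def add_ac)
    then show ?thesis using e by simp
  qed
  have bot: "Poly_Mapping.lookup \<zeta> (2, k) = 0" if k: "k \<in> {1..g}" for k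
  proof -
    have "cf g \<zeta> (2 * k) = 0" using k by (auto intro!: z)
    moreover have "(\<Sum>l\<in>{1..k}. Poly_Mapping.lookup \<zeta> (1, l)) = 0" using k top by (intro sum.neutral) auto
    ultimately show ?thesis using k by (simp add: cf_def)
  qed
  show ?thesis
  proof (rule poly_mapping_eqI)
    fix p
    show "Poly_Mapping.lookup \<zeta> p = Poly_Mapping.lookup 0 p"
      using chars_lookup[OF \<zeta>, of p] top bot by (cases "p \<in> {1, 2} \<times> {1..g}") auto
  qed
qed

lemma lookup_eta:
  assumes "k \<in> Bset g"
  shows "Poly_Mapping.lookup (eta g k) (r, l) =
    (if r = 1 \<and> k \<le> 2 * g \<and> l = (k + 1) div 2 \<or> r = 2 \<and> k \<noteq> 2 * g + 2 \<and> 1 \<le> l \<and> l \<le> k div 2 then 1 else 0)"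
proof -
  have s: "Poly_Mapping.lookup (\<Sum>l\<in>{1..n}. Poly_Mapping.single (2::nat, l) (1::bit)) (r, l)
      = (if r = 2 \<and> 1 \<le> l \<and> l \<le> n then 1 else 0)" for n
  proof -
    have "Poly_Mapping.lookup (\<Sum>l\<in>{1..n}. Poly_Mapping.single (2::nat, l) (1::bit)) (r, l)
      = (\<Sum>m\<in>{1..n}. if m = l then (if r = 2 then 1 else 0) else 0)"
      unfolding lookup_sum by (intro sum.cong) (auto simp: lookup_single when_def)
    then show ?thesis by simp
  qed
  consider "k = 2 * g + 2" | "k = 2 * g + 1" | "k \<le> 2 * g" "odd k" | "k \<le> 2 * g" "even k"
    using assms by (force simp: Bset_def)
  then show ?thesis
  proof cases
    case 3
    then have "(k + 1) div 2 - 1 = k div 2" by (auto elim: oddE)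
    then show ?thesis using 3 s[of "k div 2"] by (auto simp: eta_def Let_def lookup_add lookup_single when_def)
  next
    case 4
    then have "(k + 1) div 2 = k div 2" by auto
    then show ?thesis using 4 s[of "k div 2"] by (auto simp: eta_def Let_def lookup_add lookup_single when_def)
  qed (use s[of g] in \<open>auto simp: eta_def\<close>)
qed

lemma eta_in_chars: "k \<in> Bset g \<Longrightarrow> eta g k \<in> chars g"
  unfolding chars_def
  by (auto simp: in_keys_iff lookup_eta Bset_def subset_iff split: if_splits)

lemma eta_set_in_chars: "S \<subseteq> Bset g \<Longrightarrow> eta_set g S \<in> chars g"
  unfolding eta_set_def using chars_subspace eta_in_chars by (intro char_space.subspace_sum) auto

text \<open>Up to index 2g+1 any two distinct eta_i pair to 1 (an azygetic system) and each pairs to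
  0 with itself. This is what turns the pairing with eta_S into an indicator function.\<close>

lemma cf_eta:
  assumes "i \<in> Bset g" "j \<in> Bset g"
  shows "cf g (eta g i) j = (if i = 2 * g + 2 \<or> j = 2 * g + 2 \<or> i = j then 0 else 1)"
proof (cases "i = 2 * g + 2 \<or> j = 2 * g + 2")
  case True
  then show ?thesis by (auto simp: cf_def eta_def)
next
  case False
  then have ij: "i \<le> 2 * g + 1" "j \<le> 2 * g + 1" "i \<ge> 1" "j \<ge> 1" using assms by (auto simp: Bset_def)
  have "(\<Sum>l\<in>{1..j div 2}. Poly_Mapping.lookup (eta g i) (1, l))
     = (\<Sum>l\<in>{1..j div 2}. if l = (i + 1) div 2 then (if i \<le> 2 * g then 1 else 0) else 0)"
    using assms by (intro sum.cong) (auto simp: lookup_eta)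
  also have "\<dots> = (if i \<le> 2 * g \<and> (i + 1) div 2 \<le> j div 2 then 1 else 0)"
    using ij by auto
  finally have "cf g (eta g i) j = (if i \<le> 2 * g \<and> (i + 1) div 2 \<le> j div 2 then 1 else 0)
      + (if (j + 1) div 2 \<le> i div 2 then 1 else 0)"
    using False ij lookup_eta[OF assms(1), of 2 "(j + 1) div 2"] by (auto simp: cf_def)
  moreover consider "i < j" | "j < i" | "i = j" by linarith
  then have "(if i \<le> 2 * g \<and> (i + 1) div 2 \<le> j div 2 then 1 else 0)
      + (if (j + 1) div 2 \<le> i div 2 then 1 else 0) = (if i = j then 0 else 1 :: bit)"
  proof cases
    case 1
    then have "(i + 1) div 2 \<le> j div 2" "\<not> (j + 1) div 2 \<le> i div 2" "i \<le> 2 * g" using ij by presburger+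
    then show ?thesis using 1 by simp
  next
    case 2
    then have "\<not> (i + 1) div 2 \<le> j div 2" "(j + 1) div 2 \<le> i div 2" by presburger+
    then show ?thesis using 2 by simp
  next
    case 3
    then have "(i + 1) div 2 \<le> j div 2 \<Longrightarrow> i \<le> 2 * g" using ij by presburger
    then show ?thesis using 3 by auto
  qed
  ultimately show ?thesis using False by simp
qed

text \<open>Away from j = 2g+2, every element of \<open>S\<close> other than j and 2g+2 contributes
  1. Since \<open>S\<close> has even size, the parity of their number is that of the omitted
  elements.\<close>

lemma cf_eta_set:
  assumes "S \<subseteq> Bset g" "even (card S)" "j \<in> Bset g"
  shows "cf g (eta_set g S) j = of_bool (j \<in> S) + of_bool (2 * g + 2 \<in> S)"
proof (cases "j = 2 * g + 2")
  case True
  then show ?thesis by (simp add: cf_def)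
next
  case False
  have fin: "finite S" using assms(1) finite_subset by (auto simp: Bset_def)
  have "cf g (eta_set g S) j = (\<Sum>i\<in>S. if i \<in> {2 * g + 2, j} then 0 else 1)"
    unfolding eta_set_def cf_sum using assms False by (intro sum.cong) (auto simp: cf_eta subset_iff)
  also have "\<dots> = (\<Sum>i\<in>S - {2 * g + 2, j}. 1)"
    using fin by (intro sum.mono_neutral_cong_right) auto
  also have "\<dots> = of_nat (card (S - {2 * g + 2, j}))" by simp
  also have "card (S - {2 * g + 2, j}) = card S - card (S \<inter> {2 * g + 2, j})"
    using card_Diff_subset_Int[of S "{2 * g + 2, j}"] by simp
  finally have e: "cf g (eta_set g S) j = of_nat (card S - card (S \<inter> {2 * g + 2, j}))" .
  have le: "card (S \<inter> {2 * g + 2, j}) \<le> card S" using fin by (intro card_mono) auto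
  have o: "(of_nat n :: bit) = of_bool (odd n)" for n by (induction n) auto
  have c: "card (S \<inter> {2 * g + 2, j}) = of_bool (j \<in> S) + of_bool (2 * g + 2 \<in> S)"
    using False by (cases "j \<in> S"; cases "2 * g + 2 \<in> S") auto
  show ?thesis unfolding e o using le assms(2) unfolding c
    by (cases "j \<in> S"; cases "2 * g + 2 \<in> S") auto
qed

text \<open>The indices 2n+1 and 2n+2 together give the top entry n+1, and the last index 2g+1 gives
  the whole top row once more, so everything cancels. Hence the indicator described by
  \<open>cf\<close> belongs to a set of even size.\<close>

lemma sum_cf_even:
  assumes "\<zeta> \<in> chars g"
  shows "(\<Sum>j\<in>{1..2 * g + 1}. cf g \<zeta> j) = 0"
proof -
  have "(\<Sum>j\<in>{1..2 * n}. cf g \<zeta> j) = (\<Sum>l\<in>{1..n}. Poly_Mapping.lookup \<zeta> (1, l))" if "n \<le> g" for n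
    using that
  proof (induction n)
    case (Suc n)
    have "cf g \<zeta> (2 * n + 1) + cf g \<zeta> (2 * n + 2) = Poly_Mapping.lookup \<zeta> (1, Suc n)"
    proof -
      have "x + b + (x + a + b) = (a::bit)" for x a b by (cases x; cases a; cases b) simp_all
      then show ?thesis using Suc.prems by (simp add: cf_def)
    qed
    moreover have "{1..2 * Suc n} = insert (2 * n + 2) (insert (2 * n + 1) {1..2 * n})" by auto
    ultimately show ?case using Suc by (simp add: add_ac)
  qed simp
  from this[of g] have "(\<Sum>j\<in>{1..2 * g}. cf g \<zeta> j) = (\<Sum>l\<in>{1..g}. Poly_Mapping.lookup \<zeta> (1, l))" by simp
  moreover have "cf g \<zeta> (2 * g + 1) = (\<Sum>l\<in>{1..g}. Poly_Mapping.lookup \<zeta> (1, l))"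
    using chars_lookup[OF assms, of "(2, Suc g)"] by (simp add: cf_def)
  ultimately show ?thesis by simp
qed

lemma cf_eq_imp_eq:
  assumes "\<zeta> \<in> chars g" "\<xi> \<in> chars g" "\<And>i. i \<in> {1..2 * g + 1} \<Longrightarrow> cf g \<zeta> i = cf g \<xi> i"
  shows "\<zeta> = \<xi>"
proof -
  have "\<zeta> + \<xi> = 0"
    using assms chars_subspace by (intro cf_eq_zero_imp[of _ g]) (auto simp: cf_add char_subspace_iff)
  then have "\<zeta> + (\<zeta> + \<xi>) = \<zeta>" by simp
  then show ?thesis by simp
qed

lemma eta_set_surj:
  assumes "\<zeta> \<in> chars g"
  shows "\<exists>S. S \<subseteq> Bset g \<and> even (card S) \<and> eta_set g S = \<zeta>"
proof -
  define S where "S = {j\<in>{1..2 * g + 1}. cf g \<zeta> j = 1}"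
  have "(\<Sum>j\<in>{1..2 * g + 1}. cf g \<zeta> j) = (\<Sum>j\<in>S. 1)"
    unfolding S_def by (intro sum.mono_neutral_cong_right) auto
  then have "(of_nat (card S) :: bit) = 0" using sum_cf_even[OF assms] by simp
  moreover have o: "(of_nat n :: bit) = of_bool (odd n)" for n by (induction n) auto
  ultimately have ev: "even (card S)" by (simp split: if_splits)
  have S: "S \<subseteq> Bset g" by (auto simp: S_def Bset_def)
  have "eta_set g S = \<zeta>"
  proof (rule cf_eq_imp_eq[OF eta_set_in_chars[OF S] assms])
    fix i assume i: "i \<in> {1..2 * g + 1}"
    then have "i \<in> Bset g" by (auto simp: Bset_def)
    moreover have "2 * g + 2 \<notin> S" by (auto simp: S_def)
    ultimately show "cf g (eta_set g S) i = cf g \<zeta> i"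
      using cf_eta_set[OF S ev, of i] i by (cases "cf g \<zeta> i") (auto simp: S_def)
  qed
  then show ?thesis using S ev by blast
qed

lemma cf_separates:
  assumes "S \<subseteq> Bset g" "even (card S)" "i \<in> Bset g" "j \<in> Bset g"
  shows "cf g (eta_set g S) i = cf g (eta_set g S) j \<longleftrightarrow> (i \<in> S \<longleftrightarrow> j \<in> S)"
  using assms by (simp add: cf_eta_set)

lemma cf_constant_imp_zero:
  assumes "\<zeta> \<in> chars g" "\<And>i j. i \<in> Bset g \<Longrightarrow> j \<in> Bset g \<Longrightarrow> cf g \<zeta> i = cf g \<zeta> j"
  shows "\<zeta> = 0"
proof (rule cf_eq_zero_imp[OF assms(1)])
  fix i assume "i \<in> {1..2 * g + 1}"
  then have "cf g \<zeta> i = cf g \<zeta> (2 * g + 2)" by (intro assms(2)) (auto simp: Bset_def)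
  then show "cf g \<zeta> i = 0" by (simp add: cf_def)
qed

section \<open>Index classes of a subspace and the alternating sum over subspaces\<close>

definition same :: "nat \<Rightarrow> char_array set \<Rightarrow> nat \<Rightarrow> nat \<Rightarrow> bool" where
  "same g V i j \<longleftrightarrow> (\<forall>\<zeta>\<in>V. cf g \<zeta> i = cf g \<zeta> j)"

lemma same_refl [simp]: "same g V i i" by (simp add: same_def)
lemma same_sym: "same g V i j \<Longrightarrow> same g V j i" by (simp add: same_def)
lemma same_trans: "same g V i j \<Longrightarrow> same g V j k \<Longrightarrow> same g V i k" by (simp add: same_def)

definition blocks_balanced :: "nat \<Rightarrow> char_array set \<Rightarrow> nat set \<Rightarrow> bool" where
  "blocks_balanced g V A \<longleftrightarrow> (\<forall>i\<in>A. exc {j\<in>A. same g V i j} = 0)"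

text \<open>The quotient of \<open>Q\<^sub>V\<^sup>2\<close> by the discriminant, restricted to the variables in \<open>A\<close>.\<close>

definition TT :: "nat \<Rightarrow> (nat \<Rightarrow> complex) \<Rightarrow> char_array set \<Rightarrow> nat set \<Rightarrow> complex" where
  "TT g a V A = (if blocks_balanced g V A
     then pair_prod (\<lambda>i j. if same g V i j then (kf a i j)\<^sup>2 else 1) A else 0)"

lemma TT_empty [simp]: "TT g a V {} = 1"
  by (simp add: TT_def blocks_balanced_def)

lemma TT_split:
  assumes "finite D" "finite E" "D \<inter> E = {}"
    and s: "\<And>i j. i \<in> D \<Longrightarrow> j \<in> D \<Longrightarrow> same g V i j"
    and n: "\<And>i j. i \<in> D \<Longrightarrow> j \<in> E \<Longrightarrow> \<not> same g V i j"
  shows "TT g a V (D \<union> E) = R0 a D * TT g a V E"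
proof -
  have "{j\<in>D \<union> E. same g V i j} = D" if "i \<in> D" for i using that s n by auto
  moreover have "{j\<in>D \<union> E. same g V i j} = {j\<in>E. same g V i j}" if "i \<in> E" for i
    using that n same_sym by blast
  ultimately have bal: "blocks_balanced g V (D \<union> E) \<longleftrightarrow> exc D = 0 \<and> blocks_balanced g V E"
    unfolding blocks_balanced_def by (cases "D = {}") (auto simp: ball_Un)
  have "pair_prod (\<lambda>i j. if same g V i j then (kf a i j)\<^sup>2 else 1) (D \<union> E)
    = pair_prod (\<lambda>i j. if same g V i j then (kf a i j)\<^sup>2 else 1) D * pair_prod (\<lambda>i j. if same g V i j then (kf a i j)\<^sup>2 else 1) E
      * (\<Prod>i\<in>D. \<Prod>j\<in>E. if same g V i j then (kf a i j)\<^sup>2 else 1)"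
    using assms(1-3) by (intro pair_prod_Un) (auto simp: kf_sq_commute dest: same_sym)
  also have "(\<Prod>i\<in>D. \<Prod>j\<in>E. if same g V i j then (kf a i j)\<^sup>2 else 1) = 1"
    using n by (simp add: prod.neutral)
  also have "pair_prod (\<lambda>i j. if same g V i j then (kf a i j)\<^sup>2 else 1) D = Rp a D"
    unfolding Rp_def using s by (intro pair_prod_cong) simp
  finally show ?thesis using bal by (simp add: TT_def R0_def)
qed

text \<open>Apply \<open>R0_kap_rec\<close> to the class of p and leave the other classes alone;
  this is why only sets C that V does not separate occur.\<close>

lemma TT_rec:
  assumes "finite A" "inj_on a A" "p \<in> A"
  shows "TT g a V A = (\<Sum>C | p \<in> C \<and> C \<subseteq> A \<and> (\<forall>i\<in>C. \<forall>j\<in>C. same g V i j). kap a p C * TT g a V (A - C))"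
proof -
  define \<beta> where "\<beta> = {j\<in>A. same g V p j}"
  have \<beta>: "\<beta> \<subseteq> A" "finite \<beta>" "p \<in> \<beta>" "inj_on a \<beta>" using assms by (auto simp: \<beta>_def inj_on_def)
  have split: "TT g a V (D \<union> (A - \<beta>)) = R0 a D * TT g a V (A - \<beta>)" if "D \<subseteq> \<beta>" for D
  proof (rule TT_split)
    show "finite D" "finite (A - \<beta>)" "D \<inter> (A - \<beta>) = {}"
      using that \<beta> assms(1) finite_subset by auto
    fix i j assume i: "i \<in> D"
    then have pi: "same g V p i" using that by (auto simp: \<beta>_def)
    { assume "j \<in> D"
      then have "same g V p j" using that by (auto simp: \<beta>_def)
      then show "same g V i j" using pi same_sym same_trans by blast }
    { assume "j \<in> A - \<beta>"
      then show "\<not> same g V i j" using pi same_trans by (auto simp: \<beta>_def) }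
  qed
  have Cs: "{C. p \<in> C \<and> C \<subseteq> A \<and> (\<forall>i\<in>C. \<forall>j\<in>C. same g V i j)} = {C. p \<in> C \<and> C \<subseteq> \<beta>}"
    using same_sym same_trans unfolding \<beta>_def by blast
  have "TT g a V A = R0 a \<beta> * TT g a V (A - \<beta>)" using split[of \<beta>] \<beta>(1) by (simp add: Un_absorb1)
  also have "\<dots> = (\<Sum>C | p \<in> C \<and> C \<subseteq> \<beta>. kap a p C * (R0 a (\<beta> - C) * TT g a V (A - \<beta>)))"
    unfolding R0_kap_rec[OF \<beta>(2,4,3)] by (simp add: sum_distrib_right mult.assoc)
  also have "\<dots> = (\<Sum>C | p \<in> C \<and> C \<subseteq> \<beta>. kap a p C * TT g a V (A - C))"
  proof (intro sum.cong refl)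
    fix C assume "C \<in> {C. p \<in> C \<and> C \<subseteq> \<beta>}"
    then have "(\<beta> - C) \<union> (A - \<beta>) = A - C" using \<beta>(1) by auto
    then show "kap a p C * (R0 a (\<beta> - C) * TT g a V (A - \<beta>)) = kap a p C * TT g a V (A - C)"
      using split[of "\<beta> - C"] by auto
  qed
  finally show ?thesis unfolding Cs .
qed

definition Xi :: "nat \<Rightarrow> (nat \<Rightarrow> complex) \<Rightarrow> char_array set \<Rightarrow> nat set \<Rightarrow> complex" where
  "Xi g a Z A = (\<Sum>V\<in>subs Z. mu V * TT g a V A)"

definition const_on :: "nat \<Rightarrow> char_array set \<Rightarrow> nat set \<Rightarrow> char_array set" where
  "const_on g Z C = {\<zeta>\<in>Z. \<forall>i\<in>C. \<forall>j\<in>C. cf g \<zeta> i = cf g \<zeta> j}"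

lemma subspace_const_on: "char_space.subspace Z \<Longrightarrow> char_space.subspace (const_on g Z C)"
proof -
  assume Z: "char_space.subspace Z"
  have "x + y \<in> const_on g Z C" if xy: "x \<in> const_on g Z C" "y \<in> const_on g Z C" for x y
  proof -
    have "cf g (x + y) i = cf g (x + y) j" if "i \<in> C" "j \<in> C" for i j
    proof -
      have "cf g x i = cf g x j" "cf g y i = cf g y j" using xy that unfolding const_on_def by blast+
      then show ?thesis by (simp add: cf_add)
    qed
    then show ?thesis using Z xy unfolding const_on_def char_subspace_iff by blast
  qed
  then show ?thesis using Z by (simp add: char_subspace_iff) (simp add: const_on_def)
qed

text \<open>Exchange the two sums: V does not separate C iff V is a subspace of
  \<open>const_on g Z C\<close>, so the inner sum is again an \<open>Xi\<close>, with smaller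
  \<open>Z\<close> and \<open>A\<close>.\<close>

lemma Xi_rec:
  assumes "finite Z" "finite A" "inj_on a A" "p \<in> A"
  shows "Xi g a Z A = (\<Sum>C | p \<in> C \<and> C \<subseteq> A. kap a p C * Xi g a (const_on g Z C) (A - C))"
proof -
  have sub: "subs (const_on g Z C) = {V \<in> subs Z. \<forall>i\<in>C. \<forall>j\<in>C. same g V i j}" for C
    by (auto simp: subs_def const_on_def same_def)
  have "Xi g a Z A = (\<Sum>V\<in>subs Z. \<Sum>C | p \<in> C \<and> C \<subseteq> A \<and> (\<forall>i\<in>C. \<forall>j\<in>C. same g V i j). mu V * (kap a p C * TT g a V (A - C)))"
    unfolding Xi_def TT_rec[OF assms(2-4)] by (simp add: sum_distrib_left)
  also have "\<dots> = (\<Sum>(V, C)\<in>Sigma (subs Z) (\<lambda>V. {C. p \<in> C \<and> C \<subseteq> A \<and> (\<forall>i\<in>C. \<forall>j\<in>C. same g V i j)}). mu V * (kap a p C * TT g a V (A - C)))"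
    using assms by (subst sum.Sigma) auto
  also have "\<dots> = (\<Sum>(C, V)\<in>Sigma {C. p \<in> C \<and> C \<subseteq> A} (\<lambda>C. subs (const_on g Z C)). kap a p C * (mu V * TT g a V (A - C)))"
    unfolding sub
    by (rule sum.reindex_bij_witness[of _ "\<lambda>(C, V). (V, C)" "\<lambda>(V, C). (C, V)"]) (auto simp: mult_ac)
  also have "\<dots> = (\<Sum>C | p \<in> C \<and> C \<subseteq> A. kap a p C * Xi g a (const_on g Z C) (A - C))"
    unfolding Xi_def sum_distrib_left using assms by (subst sum.Sigma) (auto simp: const_on_def)
  finally show ?thesis .
qed

text \<open>Being constant on \<open>A\<close>, the element \<open>z\<close> survives in every
  \<open>const_on g Z C\<close> with C inside \<open>A\<close>. So the recursion can be run down to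
  empty \<open>A\<close>, where \<open>Xi\<close> is the sum of \<open>mu\<close> over the subspaces
  of a nonzero space.\<close>

lemma Xi_zero:
  assumes "char_space.subspace Z" "finite Z" "finite A" "inj_on a A" "z \<in> Z" "z \<noteq> 0"
    and "\<And>i j. i \<in> A \<Longrightarrow> j \<in> A \<Longrightarrow> cf g z i = cf g z j"
  shows "Xi g a Z A = 0"
  using assms
proof (induction "card A" arbitrary: A Z rule: less_induct)
  case less
  show ?case
  proof (cases "A = {}")
    case True
    have "Z \<noteq> {0}" using less.prems by auto
    then show ?thesis using sum_mu[OF less.prems(1,2)] True by (simp add: Xi_def)
  next
    case False
    then obtain p where p: "p \<in> A" by auto
    have "Xi g a (const_on g Z C) (A - C) = 0" if C: "p \<in> C" "C \<subseteq> A" for C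
    proof (rule less.hyps)
      show "card (A - C) < card A" using C p less.prems(3) by (intro psubset_card_mono) auto
      show "char_space.subspace (const_on g Z C)" by (rule subspace_const_on[OF less.prems(1)])
      show "finite (const_on g Z C)" using less.prems(2) by (simp add: const_on_def)
      show "z \<in> const_on g Z C" unfolding const_on_def using C(2) less.prems(5,7) by blast
      show "inj_on a (A - C)" using less.prems(4) inj_on_diff by blast
      show "cf g z i = cf g z j" if "i \<in> A - C" "j \<in> A - C" for i j
        using that by (intro less.prems(7)) auto
    qed (use less.prems(3,6) in auto)
    then show ?thesis unfolding Xi_rec[OF less.prems(2-4) p] by (intro sum.neutral) auto
  qed
qed

lemma exc_Bset: "exc (Bset g) = 0"
proof (induction g)
  case (Suc g)
  have "Bset (Suc g) = insert (2 * g + 4) (insert (2 * g + 3) (Bset g))" by (auto simp: Bset_def)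
  then show ?case using Suc by (simp add: exc_insert sg_def Bset_def)
next
  case 0
  have "Bset 0 = {1, 2}" by (auto simp: Bset_def)
  then show ?case by (simp add: exc_def sg_def)
qed

lemma even_card_exc_zero: "finite C \<Longrightarrow> exc C = 0 \<Longrightarrow> even (card C)"
proof -
  assume "finite C"
  then have "even (exc C) = even (card C)"
    by (induction C rule: finite_induct) (auto simp: exc_insert sg_def)
  then show "exc C = 0 \<Longrightarrow> even (card C)" by simp
qed

lemma finite_Bset [simp]: "finite (Bset g)" by (simp add: Bset_def)

text \<open>For a balanced proper C, which has even size, eta_C is nonzero, constant on C and
  constant on the complement; \<open>Xi_zero\<close> then removes the term. For C = B_g only the
  zero characteristic is constant on C, and the remaining factor is 1.\<close>

theorem Xi_chars:
  assumes "inj_on a (Bset g)" "p \<in> Bset g"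
  shows "Xi g a (chars g) (Bset g) = kap a p (Bset g)"
proof -
  have "kap a p C * Xi g a (const_on g (chars g) C) (Bset g - C) = 0" if C: "p \<in> C" "C \<subseteq> Bset g" "C \<noteq> Bset g" for C
  proof (cases "exc C = 0")
    case False
    then show ?thesis using kap_unbalanced[of C p a] C finite_subset[OF C(2)] by simp
  next
    case True
    have fC: "finite C" using C(2) finite_Bset by (rule finite_subset)
    have ev: "even (card C)" using even_card_exc_zero[OF fC True] .
    define z where "z = eta_set g C"
    have z: "z \<in> chars g" unfolding z_def by (rule eta_set_in_chars[OF C(2)])
    have sep: "cf g z i = cf g z j \<longleftrightarrow> (i \<in> C \<longleftrightarrow> j \<in> C)" if "i \<in> Bset g" "j \<in> Bset g" for i j
      unfolding z_def using cf_separates[OF C(2) ev that] .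
    obtain q where q: "q \<in> Bset g" "q \<notin> C" using C by auto
    have "cf g z p \<noteq> cf g z q" using sep[of p q] q C by auto
    then have z0: "z \<noteq> 0" by auto
    have "Xi g a (const_on g (chars g) C) (Bset g - C) = 0"
    proof (rule Xi_zero)
      show "char_space.subspace (const_on g (chars g) C)" by (rule subspace_const_on[OF chars_subspace])
      show "finite (const_on g (chars g) C)" using finite_chars by (simp add: const_on_def)
      show "inj_on a (Bset g - C)" using assms(1) inj_on_diff by blast
      show "z \<in> const_on g (chars g) C" using z sep C(2) by (auto simp: const_on_def subset_iff)
      show "z \<noteq> 0" by (rule z0)
    qed (use sep in auto)
    then show ?thesis by simp
  qed
  then have "Xi g a (chars g) (Bset g) = (\<Sum>C\<in>{Bset g}. kap a p C * Xi g a (const_on g (chars g) C) (Bset g - C))"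
    unfolding Xi_rec[OF finite_chars finite_Bset assms]
    using assms(2) by (intro sum.mono_neutral_right) auto
  moreover have "const_on g (chars g) (Bset g) = {0}"
  proof (intro equalityI subsetI)
    fix \<zeta> assume "\<zeta> \<in> const_on g (chars g) (Bset g)"
    then have "\<zeta> \<in> chars g" "\<And>i j. i \<in> Bset g \<Longrightarrow> j \<in> Bset g \<Longrightarrow> cf g \<zeta> i = cf g \<zeta> j"
      unfolding const_on_def by blast+
    then show "\<zeta> \<in> {0}" using cf_constant_imp_zero by blast
  qed (use chars_subspace in \<open>auto simp: const_on_def char_subspace_iff\<close>)
  ultimately show ?thesis by (simp add: Xi_def)
qed

section \<open>Balanced classes versus balanced characteristics, and the dimension bound\<close>

lemma card_level_sets:
  fixes L :: "char_array \<Rightarrow> bit"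
  assumes V: "char_space.subspace V" and add: "\<And>x y. L (x + y) = L x + L y" and z: "z \<in> V" "L z = 1"
  shows "card {x\<in>V. L x = 0} = card {x\<in>V. L x = 1}"
  by (rule bij_betw_same_card[of "(+) z"], rule bij_betw_byWitness[where f' = "(+) z"])
     (use assms in \<open>auto simp: char_subspace_iff\<close>)

lemma card_half:
  assumes V: "char_space.subspace V" "finite V" and ns: "\<not> same g V i j"
  shows "2 * card {\<zeta>\<in>V. cf g \<zeta> i = cf g \<zeta> j} = card V" "2 * card {\<zeta>\<in>V. cf g \<zeta> i \<noteq> cf g \<zeta> j} = card V"
proof -
  define L where "L \<zeta> = cf g \<zeta> i + cf g \<zeta> j" for \<zeta>
  have L0: "L \<zeta> = 0 \<longleftrightarrow> cf g \<zeta> i = cf g \<zeta> j" for \<zeta>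
    unfolding L_def by (cases "cf g \<zeta> i"; cases "cf g \<zeta> j") simp_all
  obtain z where z: "z \<in> V" "L z = 1" using ns L0 unfolding same_def by (metis bit_not_zero_iff)
  have add: "L (x + y) = L x + L y" for x y by (simp add: L_def cf_add add_ac)
  note c = card_level_sets[OF V(1) add z]
  have e1: "{\<zeta>\<in>V. L \<zeta> = 0} = {\<zeta>\<in>V. cf g \<zeta> i = cf g \<zeta> j}" using L0 by simp
  have e2: "{\<zeta>\<in>V. L \<zeta> = 1} = {\<zeta>\<in>V. cf g \<zeta> i \<noteq> cf g \<zeta> j}" using L0 by (metis bit_not_zero_iff)
  have "card V = card {\<zeta>\<in>V. cf g \<zeta> i = cf g \<zeta> j} + card {\<zeta>\<in>V. cf g \<zeta> i \<noteq> cf g \<zeta> j}"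
    using V(2) by (subst card_Un_disjoint[symmetric]) (auto intro: arg_cong[of _ _ card])
  then show "2 * card {\<zeta>\<in>V. cf g \<zeta> i = cf g \<zeta> j} = card V" "2 * card {\<zeta>\<in>V. cf g \<zeta> i \<noteq> cf g \<zeta> j} = card V"
    using c unfolding e1 e2 by simp_all
qed

text \<open>The classes of \<open>same g V\<close> are the distinct characters \<open>\<zeta> \<mapsto> (-1)\<^bsup>\<zeta>(i)\<^esup>\<close> of \<open>V\<close>, and these are
  orthogonal.\<close>

lemma blocks_balanced_iff:
  assumes V: "char_space.subspace V" "finite V"
  shows "blocks_balanced g V (Bset g) \<longleftrightarrow> (\<forall>\<zeta>\<in>V. exc {i\<in>Bset g. cf g \<zeta> i = 1} = 0)"
proof
  assume bal: "\<forall>\<zeta>\<in>V. exc {i\<in>Bset g. cf g \<zeta> i = 1} = 0"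
  \<comment> \<open>The value of the i-th character at \<zeta>. Because B_g itself is balanced,
    balance of the support of \<zeta> means that the signed sum of these values vanishes.\<close>
  define ch where "ch \<zeta> i = (if cf g \<zeta> i = 0 then 1 else - 1 :: int)" for \<zeta> i
  have sum0: "(\<Sum>i\<in>Bset g. sg i * ch \<zeta> i) = 0" if "\<zeta> \<in> V" for \<zeta>
  proof -
    have "(\<Sum>i\<in>Bset g. sg i * ch \<zeta> i) = (\<Sum>i\<in>Bset g. sg i - 2 * (if cf g \<zeta> i = 1 then sg i else 0))"
      by (intro sum.cong refl) (auto simp: ch_def)
    also have "\<dots> = exc (Bset g) - 2 * exc {i\<in>Bset g. cf g \<zeta> i = 1}"
      unfolding sum_subtractf sum_distrib_left[symmetric] exc_def by (simp add: sum.inter_filter)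
    finally show ?thesis using bal that exc_Bset by simp
  qed
  have orth: "(\<Sum>\<zeta>\<in>V. ch \<zeta> p * ch \<zeta> i) = (if same g V p i then int (card V) else 0)" for p i
  proof -
    have "ch \<zeta> p * ch \<zeta> i = of_bool (cf g \<zeta> p = cf g \<zeta> i) - of_bool (cf g \<zeta> p \<noteq> cf g \<zeta> i)" for \<zeta>
      by (cases "cf g \<zeta> p"; cases "cf g \<zeta> i"; simp add: ch_def)
    then have "(\<Sum>\<zeta>\<in>V. ch \<zeta> p * ch \<zeta> i) = int (card {\<zeta>\<in>V. cf g \<zeta> p = cf g \<zeta> i}) - int (card {\<zeta>\<in>V. cf g \<zeta> p \<noteq> cf g \<zeta> i})"
      using V(2) by (simp add: sum_subtractf Int_def)
    also have "\<dots> = (if same g V p i then int (card V) else 0)"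
    proof (cases "same g V p i")
      case True
      then have "{\<zeta>\<in>V. cf g \<zeta> p = cf g \<zeta> i} = V" "{\<zeta>\<in>V. cf g \<zeta> p \<noteq> cf g \<zeta> i} = {}" by (auto simp: same_def)
      then show ?thesis using True by (simp only: card.empty if_True)
    next
      case False
      then show ?thesis using card_half[OF V False] by simp
    qed
    finally show ?thesis .
  qed
  have "card V \<noteq> 0" using V by (auto simp: char_subspace_iff)
  show "blocks_balanced g V (Bset g)"
    unfolding blocks_balanced_def
  proof
    fix p assume "p \<in> Bset g"
    \<comment> \<open>Fourier inversion: weighting the vanishing sums by the character of p isolates
      the class of p.\<close>
    have "0 = (\<Sum>\<zeta>\<in>V. ch \<zeta> p * (\<Sum>i\<in>Bset g. sg i * ch \<zeta> i))" using sum0 by simp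
    also have "\<dots> = (\<Sum>\<zeta>\<in>V. \<Sum>i\<in>Bset g. sg i * (ch \<zeta> p * ch \<zeta> i))"
      by (simp add: sum_distrib_left mult_ac)
    also have "\<dots> = (\<Sum>i\<in>Bset g. sg i * (\<Sum>\<zeta>\<in>V. ch \<zeta> p * ch \<zeta> i))"
      by (subst sum.swap) (simp add: sum_distrib_left)
    also have "\<dots> = (\<Sum>i\<in>Bset g. if same g V p i then sg i * int (card V) else 0)"
      unfolding orth by (intro sum.cong) auto
    also have "\<dots> = exc {j\<in>Bset g. same g V p j} * int (card V)"
      by (simp add: exc_def sum.inter_filter sum_distrib_right) (intro sum.cong refl, simp)
    finally show "exc {j\<in>Bset g. same g V p j} = 0" using \<open>card V \<noteq> 0\<close> by simp
  qed
next
  assume bal: "blocks_balanced g V (Bset g)"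
  show "\<forall>\<zeta>\<in>V. exc {i\<in>Bset g. cf g \<zeta> i = 1} = 0"
  proof
    fix \<zeta> assume \<zeta>: "\<zeta> \<in> V"
    define X where "X = {i\<in>Bset g. cf g \<zeta> i = 1}"
    define bl where "bl i = {j\<in>Bset g. same g V i j}" for i
    have fX: "finite X" by (simp add: X_def)
    \<comment> \<open>The support of \<zeta> is a union of classes, each of excess 0.\<close>
    have "exc X = (\<Sum>y\<in>bl ` X. \<Sum>x\<in>{x\<in>X. bl x = y}. sg x)"
      unfolding exc_def using fX by (intro sum.group[symmetric]) auto
    also have "\<dots> = (\<Sum>y\<in>bl ` X. 0)"
    proof (rule sum.cong[OF refl])
      fix y assume "y \<in> bl ` X"
      then obtain i where i: "i \<in> X" "y = bl i" by auto
      have "{x\<in>X. bl x = y} = bl i"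
      proof (intro equalityI subsetI)
        fix x assume "x \<in> {x\<in>X. bl x = y}"
        then have x: "x \<in> Bset g" "bl x = bl i" using i by (auto simp: X_def)
        have "x \<in> bl x" using x(1) by (simp add: bl_def)
        then show "x \<in> bl i" unfolding x(2) .
      next
        fix x assume x: "x \<in> bl i"
        then have s: "same g V i x" "x \<in> Bset g" by (auto simp: bl_def)
        have "cf g \<zeta> x = cf g \<zeta> i" using s \<zeta> by (simp add: same_def)
        then have "x \<in> X" using i s by (simp add: X_def)
        moreover have "bl x = bl i" using s same_sym same_trans unfolding bl_def by blast
        ultimately show "x \<in> {x\<in>X. bl x = y}" using i by simp
      qed
      then show "(\<Sum>x\<in>{x\<in>X. bl x = y}. sg x) = 0"
        using bal i unfolding blocks_balanced_def bl_def X_def exc_def by simp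
    qed
    finally show "exc {i\<in>Bset g. cf g \<zeta> i = 1} = 0" by (simp add: X_def)
  qed
qed

lemma card_Uset: "card (Uset g) = g + 1"
proof (induction g)
  case (Suc g)
  have "Uset (Suc g) = insert (2 * g + 3) (Uset g)"
    by (auto simp: Uset_def Bset_def) presburger
  moreover have "2 * g + 3 \<notin> Uset g" "finite (Uset g)" by (auto simp: Uset_def Bset_def)
  ultimately show ?case using Suc by simp
next
  case 0
  have "Uset 0 = {1}" by (auto simp: Uset_def Bset_def) presburger
  then show ?case by simp
qed

text \<open>A balanced class contains an odd index, so an element of \<open>V\<close> is determined
  by its values at the g + 1 odd indices. One of these values is always 0, namely at an odd index in
  the class of 2g+2, which leaves at most 2^g elements. Thus the cutoff i \<le> g in K discards only
  vanishing terms.\<close>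

lemma dim_le_if_blocks_balanced:
  assumes V: "char_space.subspace V" "V \<subseteq> chars g" and bal: "blocks_balanced g V (Bset g)"
  shows "char_space.dim V \<le> g"
proof -
  have fV: "finite V" using V finite_chars finite_subset by blast
  have odd_mem: "\<exists>j\<in>Uset g. same g V i j" if i: "i \<in> Bset g" for i
  proof (rule ccontr)
    assume "\<not> (\<exists>j\<in>Uset g. same g V i j)"
    then have ev: "sg j = 1" if "j \<in> {j\<in>Bset g. same g V i j}" for j using that by (auto simp: Uset_def sg_def)
    have "exc {j\<in>Bset g. same g V i j} = int (card {j\<in>Bset g. same g V i j})"
      unfolding exc_def using ev by simp
    moreover have "card {j\<in>Bset g. same g V i j} \<noteq> 0" using i by auto
    ultimately show False using bal i by (auto simp: blocks_balanced_def)
  qed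
  have "2 * g + 2 \<in> Bset g" by (simp add: Bset_def)
  then obtain u where u: "u \<in> Uset g" "same g V (2 * g + 2) u" using odd_mem by blast
  have cu: "cf g \<zeta> u = 0" if "\<zeta> \<in> V" for \<zeta> using u(2) that unfolding same_def by (metis cf_def)
  define F where "F \<zeta> = {i\<in>Uset g - {u}. cf g \<zeta> i = 1}" for \<zeta>
  have finU: "finite (Uset g)" by (simp add: Uset_def)
  have "inj_on F V"
  proof (rule inj_onI)
    fix \<zeta> \<xi> assume h: "\<zeta> \<in> V" "\<xi> \<in> V" "F \<zeta> = F \<xi>"
    have U: "cf g \<zeta> j = cf g \<xi> j" if j: "j \<in> Uset g" for j
    proof (cases "j = u")
      case False
      then have "j \<in> F \<zeta> \<longleftrightarrow> j \<in> F \<xi>" using h by simp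
      then show ?thesis using j False by (cases "cf g \<zeta> j"; cases "cf g \<xi> j") (auto simp: F_def)
    qed (use cu h in simp)
    show "\<zeta> = \<xi>"
    proof (rule cf_eq_imp_eq)
      show "\<zeta> \<in> chars g" "\<xi> \<in> chars g" using h V by auto
      fix i assume "i \<in> {1..2 * g + 1}"
      then have "i \<in> Bset g" by (auto simp: Bset_def)
      then obtain j where "j \<in> Uset g" "same g V i j" using odd_mem by blast
      then show "cf g \<zeta> i = cf g \<xi> i" using U h by (simp add: same_def)
    qed
  qed
  then have "card V \<le> card (Pow (Uset g - {u}))"
    using finU by (intro card_inj_on_le[of F]) (auto simp: F_def)
  also have "\<dots> = 2 ^ g" using finU u card_Uset by (simp add: card_Pow)
  finally have "(2::nat) ^ char_space.dim V \<le> 2 ^ g" using card_subspace[OF V(1) fV] by simp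
  then show ?thesis by simp
qed

subsection \<open>Evaluation of polynomials\<close>

definition ring_hom :: "('a::comm_ring_1 \<Rightarrow> 'b::comm_ring_1) \<Rightarrow> bool" where
  "ring_hom \<phi> \<longleftrightarrow> \<phi> 1 = 1 \<and> (\<forall>x y. \<phi> (x + y) = \<phi> x + \<phi> y) \<and> (\<forall>x y. \<phi> (x * y) = \<phi> x * \<phi> y)"

lemma ring_hom_simps:
  assumes "ring_hom \<phi>"
  shows "\<phi> 1 = 1" "\<phi> (x + y) = \<phi> x + \<phi> y" "\<phi> (x * y) = \<phi> x * \<phi> y" "\<phi> 0 = 0" "\<phi> (- x) = - \<phi> x"
    "\<phi> (x - y) = \<phi> x - \<phi> y" "\<phi> (x ^ n) = \<phi> x ^ n"
proof -
  show a: "\<phi> 1 = 1" "\<phi> (x + y) = \<phi> x + \<phi> y" "\<phi> (x * y) = \<phi> x * \<phi> y" for x y using assms by (auto simp: ring_hom_def)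
  have "\<phi> 0 + \<phi> 0 = \<phi> 0" using a(2)[of 0 0] by simp
  then show z: "\<phi> 0 = 0" by simp
  show m: "\<phi> (- x) = - \<phi> x" for x using a(2)[of x "- x"] z by (simp add: eq_neg_iff_add_eq_0 add.commute)
  show "\<phi> (x - y) = \<phi> x - \<phi> y" using a(2)[of x "- y"] m by simp
  show "\<phi> (x ^ n) = \<phi> x ^ n" by (induction n) (auto simp: a)
qed

lemma ring_hom_sum: "ring_hom \<phi> \<Longrightarrow> \<phi> (\<Sum>i\<in>A. f i) = (\<Sum>i\<in>A. \<phi> (f i))"
  by (induction A rule: infinite_finite_induct) (auto simp: ring_hom_simps)

lemma ring_hom_prod: "ring_hom \<phi> \<Longrightarrow> \<phi> (\<Prod>i\<in>A. f i) = (\<Prod>i\<in>A. \<phi> (f i))"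
  by (induction A rule: infinite_finite_induct) (auto simp: ring_hom_simps)

lemma ring_hom_id [simp]: "ring_hom id" by (simp add: ring_hom_def)
lemma ring_hom_of_int [simp]: "ring_hom of_int" by (simp add: ring_hom_def)

definition mon :: "('v \<Rightarrow> 'b) \<Rightarrow> ('v \<Rightarrow>\<^sub>0 nat) \<Rightarrow> 'b::comm_ring_1" where
  "mon x m = (\<Prod>v\<in>Poly_Mapping.keys m. x v ^ Poly_Mapping.lookup m v)"

lemma mon_superset:
  assumes "finite A" "Poly_Mapping.keys m \<subseteq> A"
  shows "mon x m = (\<Prod>v\<in>A. x v ^ Poly_Mapping.lookup m v)"
  unfolding mon_def using assms by (intro prod.mono_neutral_left) (auto simp: in_keys_iff)

lemma mon_add: "mon x (m + n) = mon x m * mon x n"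
proof -
  let ?A = "Poly_Mapping.keys m \<union> Poly_Mapping.keys n"
  have "mon x (m + n) = (\<Prod>v\<in>?A. x v ^ Poly_Mapping.lookup (m + n) v)"
    by (intro mon_superset) (auto simp: keys_add)
  also have "\<dots> = mon x m * mon x n"
    by (simp add: mon_superset[of ?A] lookup_add power_add prod.distrib)
  finally show ?thesis .
qed

lemma msubst_superset:
  assumes "finite M" "Poly_Mapping.keys f \<subseteq> M" "\<kappa> 0 = 0"
  shows "msubst \<kappa> x f = (\<Sum>m\<in>M. \<kappa> (Poly_Mapping.lookup f m) * mon x m)"
  unfolding msubst_def mon_def using assms
  by (intro sum.mono_neutral_left) (auto simp: in_keys_iff)

lemma msubst_add:
  assumes "ring_hom \<kappa>"
  shows "msubst \<kappa> x (f + h) = msubst \<kappa> x f + msubst \<kappa> x h"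
proof -
  let ?M = "Poly_Mapping.keys f \<union> Poly_Mapping.keys h"
  have "msubst \<kappa> x (f + h) = (\<Sum>m\<in>?M. \<kappa> (Poly_Mapping.lookup (f + h) m) * mon x m)"
    using assms by (intro msubst_superset) (auto simp: keys_add ring_hom_simps)
  also have "\<dots> = msubst \<kappa> x f + msubst \<kappa> x h"
    using assms by (simp add: msubst_superset[of ?M] ring_hom_simps lookup_add distrib_right sum.distrib)
  finally show ?thesis .
qed

lemma msubst_zero [simp]: "msubst \<kappa> x 0 = 0"
  by (simp add: msubst_def)

lemma msubst_sum: "ring_hom \<kappa> \<Longrightarrow> msubst \<kappa> x (\<Sum>i\<in>A. f i) = (\<Sum>i\<in>A. msubst \<kappa> x (f i))"
  by (induction A rule: infinite_finite_induct) (auto simp: msubst_add)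

lemma msubst_single: "ring_hom \<kappa> \<Longrightarrow> msubst \<kappa> x (Poly_Mapping.single m c) = \<kappa> c * mon x m"
  by (subst msubst_superset[of "{m}"]) (auto simp: ring_hom_simps)

lemma poly_mapping_sum_single: "(f :: 'a \<Rightarrow>\<^sub>0 'b::comm_monoid_add) = (\<Sum>m\<in>Poly_Mapping.keys f. Poly_Mapping.single m (Poly_Mapping.lookup f m))"
proof (rule poly_mapping_eqI)
  fix k
  have "(\<Sum>m\<in>Poly_Mapping.keys f. Poly_Mapping.lookup (Poly_Mapping.single m (Poly_Mapping.lookup f m)) k)
      = (\<Sum>m\<in>Poly_Mapping.keys f. if m = k then Poly_Mapping.lookup f k else 0)"
    by (intro sum.cong) (auto simp: lookup_single when_def)
  then show "Poly_Mapping.lookup f k = Poly_Mapping.lookup (\<Sum>m\<in>Poly_Mapping.keys f. Poly_Mapping.single m (Poly_Mapping.lookup f m)) k"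
    by (simp add: lookup_sum in_keys_iff)
qed

lemma msubst_mult:
  assumes "ring_hom \<kappa>"
  shows "msubst \<kappa> x (f * h) = msubst \<kappa> x f * msubst \<kappa> x h"
proof -
  have "f * h = (\<Sum>m\<in>Poly_Mapping.keys f. \<Sum>n\<in>Poly_Mapping.keys h.
      Poly_Mapping.single (m + n) (Poly_Mapping.lookup f m * Poly_Mapping.lookup h n))"
    by (subst poly_mapping_sum_single[of f], subst poly_mapping_sum_single[of h])
       (simp add: sum_product mult_single)
  then have "msubst \<kappa> x (f * h) = (\<Sum>m\<in>Poly_Mapping.keys f. \<Sum>n\<in>Poly_Mapping.keys h.
      (\<kappa> (Poly_Mapping.lookup f m) * mon x m) * (\<kappa> (Poly_Mapping.lookup h n) * mon x n))"
    using assms by (simp add: msubst_sum msubst_single mon_add ring_hom_simps mult_ac)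
  also have "\<dots> = msubst \<kappa> x f * msubst \<kappa> x h"
    by (simp add: msubst_def mon_def sum_product)
  finally show ?thesis .
qed

lemma mon_zero [simp]: "mon x 0 = 1" by (simp add: mon_def)

lemma msubst_Const: "ring_hom \<kappa> \<Longrightarrow> msubst \<kappa> x (Const c) = \<kappa> c"
  by (simp add: Const_def msubst_single)

lemma msubst_Var: "ring_hom \<kappa> \<Longrightarrow> msubst \<kappa> x (Var v) = x v"
  by (simp add: Var_def msubst_single ring_hom_simps mon_def)

lemma ring_hom_msubst [simp]: "ring_hom \<kappa> \<Longrightarrow> ring_hom (msubst \<kappa> x)"
  unfolding ring_hom_def[of "msubst \<kappa> x"]
  by (auto simp: msubst_add msubst_mult msubst_single ring_hom_simps simp flip: single_one)

lemma ring_hom_Const: "ring_hom (Const :: _ \<Rightarrow> ('v, 'c::comm_ring_1) mpol)"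
  by (auto simp: ring_hom_def Const_def single_add mult_single)

lemma hom_msubst:
  assumes "ring_hom \<phi>"
  shows "\<phi> (msubst \<kappa> x f) = msubst (\<lambda>c. \<phi> (\<kappa> c)) (\<lambda>v. \<phi> (x v)) f"
  using assms by (simp add: msubst_def ring_hom_sum ring_hom_prod ring_hom_simps)

lemma msubst_rename:
  "msubst id a (rename \<sigma> f) = msubst id (\<lambda>v. a (\<sigma> v)) f"
  unfolding rename_def using hom_msubst[of "msubst id a" Const "\<lambda>v. Var (\<sigma> v)" f]
  by (simp add: msubst_Const msubst_Var id_def[symmetric])

lemma msubst_map_of_int:
  fixes a :: "'v \<Rightarrow> 'c::comm_ring_1"
  shows "msubst id a (Poly_Mapping.map of_int f) = msubst of_int a f"
proof -
  have l: "Poly_Mapping.lookup (Poly_Mapping.map of_int f :: ('v, 'c) mpol) m = of_int (Poly_Mapping.lookup f m)" for m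
    by (simp add: Poly_Mapping.map.rep_eq when_def)
  then have "Poly_Mapping.keys (Poly_Mapping.map of_int f :: ('v, 'c) mpol) \<subseteq> Poly_Mapping.keys f"
    by (auto simp: in_keys_iff)
  then show ?thesis using l by (simp add: msubst_superset[of "Poly_Mapping.keys f"])
qed

lemma msubst_cong:
  "(\<And>v. v \<in> mvars f \<Longrightarrow> x v = y v) \<Longrightarrow> msubst \<kappa> x f = msubst \<kappa> y f"
  unfolding msubst_def mvars_def
  by (intro sum.cong refl arg_cong2[of _ _ _ _ "(*)"] prod.cong arg_cong2[of _ _ _ _ "(^)"]) blast

lemma mvars_zero [simp]: "mvars 0 = {}" by (simp add: mvars_def)

lemma mvars_add: "mvars (f + h) \<subseteq> mvars f \<union> mvars h"
  unfolding mvars_def using keys_add[of f h] by blast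

lemma mvars_uminus: "mvars (- f) = mvars (f :: ('v, 'c::ab_group_add) mpol)"
proof -
  have "Poly_Mapping.keys (- f) = Poly_Mapping.keys f" by (auto simp: in_keys_iff)
  then show ?thesis by (simp add: mvars_def)
qed

lemma mvars_mult: "mvars (f * h) \<subseteq> mvars f \<union> mvars (h :: ('v, 'c::comm_ring_1) mpol)"
proof -
  have "Poly_Mapping.keys m \<subseteq> mvars f \<union> mvars h" if "m \<in> Poly_Mapping.keys (f * h)" for m
  proof -
    obtain m1 m2 where "m = m1 + m2" "m1 \<in> Poly_Mapping.keys f" "m2 \<in> Poly_Mapping.keys h"
      using keys_mult[of f h] \<open>m \<in> Poly_Mapping.keys (f * h)\<close> by blast
    then show ?thesis using keys_add[of m1 m2] unfolding mvars_def by blast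
  qed
  then show ?thesis unfolding mvars_def[of "f * h"] by blast
qed

lemma mvars_sum: "(\<And>i. i \<in> A \<Longrightarrow> mvars (f i) \<subseteq> X) \<Longrightarrow> mvars (\<Sum>i\<in>A. f i) \<subseteq> X"
  by (induction A rule: infinite_finite_induct) (use mvars_add in fastforce)+

lemma mvars_Const [simp]: "mvars (Const c) = {}"
  by (cases "c = 0") (auto simp: mvars_def Const_def)

lemma mvars_one [simp]: "mvars (1 :: ('v, 'c::comm_ring_1) mpol) = {}"
  by (simp add: mvars_def)

lemma mvars_prod: "(\<And>i. i \<in> A \<Longrightarrow> mvars (f i) \<subseteq> X) \<Longrightarrow> mvars (\<Prod>i\<in>A. f i :: ('v, 'c::comm_ring_1) mpol) \<subseteq> X"
proof (induction A rule: infinite_finite_induct)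
  case (insert i A)
  then show ?case using mvars_mult[of "f i" "prod f A"] by auto
qed auto

lemma mvars_power: "mvars (f ^ n) \<subseteq> mvars (f :: ('v, 'c::comm_ring_1) mpol)"
  using mvars_prod[of "{..<n}" "\<lambda>_. f"] by simp

lemma mvars_Var_diff: "mvars (Var i - Var j :: ('v, 'c::comm_ring_1) mpol) \<subseteq> {i, j}"
proof -
  have "mvars (Var v :: ('v, 'c) mpol) \<subseteq> {v}" for v by (auto simp: mvars_def Var_def)
  then show ?thesis using mvars_add[of "Var i" "- Var j :: ('v, 'c) mpol"] mvars_uminus[of "Var j :: ('v, 'c) mpol"] by fastforce
qed

text \<open>Kronecker substitution \<open>x\<^sub>v = s\<^bsup>N\<^bsup>i(v)\<^esup>\<^esup>\<close> separates the monomials, and it produces distinct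
  natural numbers.\<close>

lemma base_digits_unique:
  fixes d e :: "nat \<Rightarrow> nat"
  assumes "(\<Sum>i<n. d i * N ^ i) = (\<Sum>i<n. e i * N ^ i)" "\<And>i. i < n \<Longrightarrow> d i < N" "\<And>i. i < n \<Longrightarrow> e i < N" "i < n"
  shows "d i = e i"
  using assms
proof (induction n arbitrary: d e i)
  case (Suc n)
  have s: "(\<Sum>i<Suc n. f i * N ^ i) = f 0 + N * (\<Sum>i<n. f (Suc i) * N ^ i)" for f :: "nat \<Rightarrow> nat"
    by (simp add: sum.lessThan_Suc_shift sum_distrib_left mult_ac del: sum.lessThan_Suc)
  have eq: "d 0 + N * (\<Sum>i<n. d (Suc i) * N ^ i) = e 0 + N * (\<Sum>i<n. e (Suc i) * N ^ i)"
    using Suc.prems(1) unfolding s .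
  have lt: "d 0 < N" "e 0 < N" using Suc.prems by auto
  have "(d 0 + N * (\<Sum>i<n. d (Suc i) * N ^ i)) mod N = (e 0 + N * (\<Sum>i<n. e (Suc i) * N ^ i)) mod N"
    using eq by simp
  then have 0: "d 0 = e 0" using lt by simp
  then have "(\<Sum>i<n. d (Suc i) * N ^ i) = (\<Sum>i<n. e (Suc i) * N ^ i)" using eq lt by simp
  then have "d (Suc j) = e (Suc j)" if "j < n" for j
    using Suc.IH[of "\<lambda>i. d (Suc i)" "\<lambda>i. e (Suc i)" j] Suc.prems that by auto
  then show ?case using 0 Suc.prems(4) by (cases i) auto
qed simp

text \<open>The test points are restricted to distinct positive numbers since the values of K are
  computed only at distinct coordinates, and the inversion z to -1/z needs nonzero ones.\<close>

theorem mpol_eq_zeroI: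
  fixes f :: "('v, 'c::{idom, ring_char_0}) mpol"
  assumes "finite Vs" "mvars f \<subseteq> Vs"
    and zero: "\<And>y :: 'v \<Rightarrow> nat. inj_on y Vs \<Longrightarrow> (\<And>v. 0 < y v) \<Longrightarrow> msubst id (\<lambda>v. of_nat (y v)) f = 0"
  shows "f = 0"
proof -
  obtain idx n where idx: "bij_betw idx Vs {..<n::nat}" using assms(1) by (metis finite_imp_inj_to_nat_seg bij_betw_def lessThan_def)
  \<comment> \<open>N exceeds every exponent occurring in \<open>f\<close>, so the exponents of a
    monomial are base-N digits of \<open>E m\<close>; the second \<open>Suc\<close> ensures N \<ge>
    2, which makes the powers of N distinct.\<close>
  define N where "N = Suc (Suc (\<Sum>m\<in>Poly_Mapping.keys f. \<Sum>v\<in>Poly_Mapping.keys m. Poly_Mapping.lookup m v))"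
  have N2: "N \<ge> 2" by (simp add: N_def)
  have small: "Poly_Mapping.lookup m v < N" if m: "m \<in> Poly_Mapping.keys f" for m v
  proof (cases "v \<in> Poly_Mapping.keys m")
    case True
    have "Poly_Mapping.lookup m v \<le> (\<Sum>v\<in>Poly_Mapping.keys m. Poly_Mapping.lookup m v)"
      using True by (intro member_le_sum) auto
    also have "\<dots> \<le> (\<Sum>m\<in>Poly_Mapping.keys f. \<Sum>v\<in>Poly_Mapping.keys m. Poly_Mapping.lookup m v)"
      using m by (intro member_le_sum[of m _ "\<lambda>m. \<Sum>v\<in>Poly_Mapping.keys m. Poly_Mapping.lookup m v"]) auto
    finally show ?thesis by (simp add: N_def)
  qed (simp add: in_keys_iff N_def)
  define E where "E m = (\<Sum>v\<in>Vs. Poly_Mapping.lookup m v * N ^ idx v)" for m :: "'v \<Rightarrow>\<^sub>0 nat"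
  have keysV: "Poly_Mapping.keys m \<subseteq> Vs" if "m \<in> Poly_Mapping.keys f" for m
    using that assms(2) by (auto simp: mvars_def)
  define inv where "inv = the_inv_into Vs idx"
  have inv: "idx (inv i) = i" "inv i \<in> Vs" if "i < n" for i
    using idx that unfolding inv_def bij_betw_def by (auto simp: f_the_inv_into_f the_inv_into_into)
  have E_idx: "E m = (\<Sum>i<n. Poly_Mapping.lookup m (inv i) * N ^ i)" for m
    unfolding E_def
    by (rule sum.reindex_bij_witness[of _ inv idx])
       (use idx inv in \<open>auto simp: inv_def bij_betw_def the_inv_into_f_f\<close>)
  have injE: "inj_on E (Poly_Mapping.keys f)"
  proof (rule inj_onI)
    fix m m' assume m: "m \<in> Poly_Mapping.keys f" "m' \<in> Poly_Mapping.keys f" "E m = E m'"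
    have dig: "Poly_Mapping.lookup m (inv i) = Poly_Mapping.lookup m' (inv i)" if "i < n" for i
      by (rule base_digits_unique[of "\<lambda>i. Poly_Mapping.lookup m (inv i)" N n "\<lambda>i. Poly_Mapping.lookup m' (inv i)"])
         (use m that small in \<open>auto simp flip: E_idx\<close>)
    show "m = m'"
    proof (rule poly_mapping_eqI)
      fix v show "Poly_Mapping.lookup m v = Poly_Mapping.lookup m' v"
      proof (cases "v \<in> Vs")
        case True
        then have "idx v < n" "inv (idx v) = v" using idx by (auto simp: bij_betw_def inv_def the_inv_into_f_f)
        then show ?thesis using dig by metis
      next
        case False
        then show ?thesis using keysV[OF m(1)] keysV[OF m(2)] by (metis in_keys_iff subsetD)
      qed
    qed
  qed
  define p where "p = (\<Sum>m\<in>Poly_Mapping.keys f. monom (Poly_Mapping.lookup f m) (E m))"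
  have "poly p (of_nat s) = 0" if s: "s \<ge> 2" for s :: nat
  proof -
    define y where "y v = s ^ (N ^ idx v)" for v
    have "inj_on y Vs"
    proof (rule inj_onI)
      fix u v assume uv: "u \<in> Vs" "v \<in> Vs" "y u = y v"
      have "N ^ idx u = N ^ idx v" using uv(3) s power_inject_exp[of s] by (simp add: y_def)
      then have "idx u = idx v" using N2 power_inject_exp[of N] by simp
      then show "u = v" using uv idx by (auto simp: bij_betw_def inj_on_def)
    qed
    moreover have "0 < y v" for v using s by (simp add: y_def)
    ultimately have "0 = msubst id (\<lambda>v. of_nat (y v)) f" using zero by simp
    also have "\<dots> = (\<Sum>m\<in>Poly_Mapping.keys f. Poly_Mapping.lookup f m * mon (\<lambda>v. of_nat (y v)) m)"
      by (simp add: msubst_def mon_def)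
    also have "\<dots> = (\<Sum>m\<in>Poly_Mapping.keys f. Poly_Mapping.lookup f m * of_nat s ^ E m)"
    proof (intro sum.cong refl)
      fix m assume m: "m \<in> Poly_Mapping.keys f"
      have "mon (\<lambda>v. of_nat (y v)) m = (\<Prod>v\<in>Vs. (of_nat s :: 'c) ^ (Poly_Mapping.lookup m v * N ^ idx v))"
        unfolding mon_superset[OF assms(1) keysV[OF m]] y_def by (simp flip: power_mult add: mult.commute)
      also have "\<dots> = of_nat s ^ E m" by (simp add: E_def power_sum)
      finally show "Poly_Mapping.lookup f m * mon (\<lambda>v. of_nat (y v)) m = Poly_Mapping.lookup f m * of_nat s ^ E m" by simp
    qed
    also have "\<dots> = poly p (of_nat s)" by (simp add: p_def poly_sum poly_monom)
    finally show ?thesis by simp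
  qed
  then have "of_nat ` {2..} \<subseteq> {x. poly p x = 0}" by auto
  moreover have "infinite (of_nat ` {2::nat..} :: 'c set)"
    by (simp add: finite_image_iff inj_on_def infinite_Ici)
  ultimately have p0: "p = 0" using poly_roots_finite finite_subset by blast
  show "f = 0"
  proof (rule poly_mapping_eqI)
    fix m show "Poly_Mapping.lookup f m = Poly_Mapping.lookup 0 m"
    proof (cases "m \<in> Poly_Mapping.keys f")
      case True
      have "0 = coeff p (E m)" by (simp add: p0)
      also have "\<dots> = (\<Sum>m'\<in>Poly_Mapping.keys f. if m' = m then Poly_Mapping.lookup f m' else 0)"
        unfolding p_def coeff_sum using True injE by (intro sum.cong) (auto simp: coeff_monom inj_on_def)
      also have "\<dots> = Poly_Mapping.lookup f m" using True by simp
      finally show ?thesis by simp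
    qed (simp add: in_keys_iff)
  qed
qed

lemma mpol_eqI:
  fixes f h :: "('v, 'c::{idom, ring_char_0}) mpol"
  assumes "finite Vs" "mvars f \<subseteq> Vs" "mvars h \<subseteq> Vs"
    and "\<And>y :: 'v \<Rightarrow> nat. inj_on y Vs \<Longrightarrow> (\<And>v. 0 < y v) \<Longrightarrow> msubst id (\<lambda>v. of_nat (y v)) f = msubst id (\<lambda>v. of_nat (y v)) h"
  shows "f = h"
proof -
  have "f - h = 0"
  proof (rule mpol_eq_zeroI[OF assms(1)])
    show "mvars (f - h) \<subseteq> Vs" using mvars_add[of f "- h"] mvars_uminus[of h] assms(2,3) by auto
    fix y :: "'v \<Rightarrow> nat" assume "inj_on y Vs" "\<And>v. 0 < y v"
    then show "msubst id (\<lambda>v. of_nat (y v)) (f - h) = 0"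
      using assms(4) by (simp add: ring_hom_simps[OF ring_hom_msubst])
  qed
  then show ?thesis by simp
qed

lemma ring_hom_poly_map:
  assumes "ring_hom \<phi>"
  shows "ring_hom (\<lambda>P. poly (map_poly \<phi> P) t)"
proof -
  note h = ring_hom_simps[OF assms]
  have "map_poly \<phi> (p + q) = map_poly \<phi> p + map_poly \<phi> q" for p q
    by (rule poly_eqI) (simp add: coeff_map_poly h)
  moreover have "map_poly \<phi> (p * q) = map_poly \<phi> p * map_poly \<phi> q" for p q
    by (rule poly_eqI) (simp add: coeff_map_poly h coeff_mult ring_hom_sum[OF assms])
  moreover have "map_poly \<phi> 1 = 1" by (simp add: map_poly_1 h)
  ultimately show ?thesis by (simp add: ring_hom_def)
qed

lemma map_poly_const: "ring_hom \<phi> \<Longrightarrow> map_poly \<phi> [:c:] = [:\<phi> c:]"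
  by (simp add: map_poly_pCons ring_hom_simps)

lemma map_poly_linear: "ring_hom \<phi> \<Longrightarrow> map_poly \<phi> [:c, d:] = [:\<phi> c, \<phi> d:]"
  by (simp add: map_poly_pCons ring_hom_simps)

subsection \<open>The value of K at points with distinct coordinates\<close>

lemma Delta_pair_prod:
  assumes "finite T"
  shows "Delta T = pair_prod (\<lambda>i j. Var j - Var i) T"
proof -
  have "Delta T = (\<Prod>(j, i)\<in>Sigma T (\<lambda>j. {i\<in>T. i < j}). Var j - Var i)"
    unfolding Delta_def by (intro prod.cong) auto
  then show ?thesis unfolding pair_prod_def using assms by (subst prod.Sigma) auto
qed

lemma ring_hom_pair_prod: "ring_hom \<phi> \<Longrightarrow> \<phi> (pair_prod f S) = pair_prod (\<lambda>i j. \<phi> (f i j)) S"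
  by (simp add: pair_prod_def ring_hom_prod)

lemma pair_prod_subset:
  assumes "finite S" "T \<subseteq> S"
  shows "pair_prod f T = pair_prod (\<lambda>i j. if i \<in> T \<and> j \<in> T then f i j else 1) S"
proof -
  have "pair_prod (\<lambda>i j. if i \<in> T \<and> j \<in> T then f i j else 1) S
    = (\<Prod>j\<in>T. \<Prod>i\<in>{i\<in>S. i < j}. if i \<in> T \<and> j \<in> T then f i j else 1)"
    unfolding pair_prod_def using assms by (intro prod.mono_neutral_right) auto
  also have "\<dots> = (\<Prod>j\<in>T. \<Prod>i\<in>{i\<in>T. i < j}. if i \<in> T \<and> j \<in> T then f i j else 1)"
    using assms by (intro prod.cong refl prod.mono_neutral_right) auto
  also have "\<dots> = pair_prod f T" unfolding pair_prod_def by (intro prod.cong) auto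
  finally show ?thesis ..
qed

lemma prod_pair_prod: "(\<Prod>x\<in>X. pair_prod (f x) S) = pair_prod (\<lambda>i j. \<Prod>x\<in>X. f x i j) S"
proof -
  have "(\<Prod>x\<in>X. pair_prod (f x) S) = (\<Prod>j\<in>S. \<Prod>x\<in>X. \<Prod>i\<in>{i\<in>S. i < j}. f x i j)"
    unfolding pair_prod_def by (rule prod.swap)
  also have "\<dots> = pair_prod (\<lambda>i j. \<Prod>x\<in>X. f x i j) S"
    unfolding pair_prod_def by (intro prod.cong refl prod.swap)
  finally show ?thesis .
qed

lemma mvars_pair_prod:
  assumes "\<And>i j. i \<in> S \<Longrightarrow> j \<in> S \<Longrightarrow> mvars (f i j) \<subseteq> X"
  shows "mvars (pair_prod f S :: ('v, 'c::comm_ring_1) mpol) \<subseteq> X"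
  unfolding pair_prod_def using assms by (intro mvars_prod) auto

text \<open>The chosen \<open>S\<close> is known only up to complement, but \<open>cf\<close>
  decides whether two indices lie in the same factor: i is in \<open>T\<close> iff membership of i
  in \<open>S\<close> agrees with i being even.\<close>

lemma Ptheta_eq:
  assumes "\<zeta> \<in> chars g"
  shows "Ptheta g \<zeta> = (if exc {i\<in>Bset g. cf g \<zeta> i = 1} = 0
    then pair_prod (\<lambda>i j. if (cf g \<zeta> i = cf g \<zeta> j) = (even i = even j) then Var j - Var i else 1) (Bset g) else 0)"
proof -
  define S where "S = (SOME S. S \<subseteq> Bset g \<and> even (card S) \<and> eta_set g S = \<zeta>)"
  define T where "T = sym_diff S (Uset g)"
  have S: "S \<subseteq> Bset g" "even (card S)" "eta_set g S = \<zeta>"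
    using someI_ex[OF eta_set_surj[OF assms]] unfolding S_def by blast+
  have P: "Ptheta g \<zeta> = (if balanced S then Delta T * Delta (Bset g - T) else 0)"
    by (simp add: Ptheta_def S_def T_def Let_def)
  have fS: "finite S" using S(1) finite_Bset by (rule finite_subset)
  have cfS: "cf g \<zeta> i = of_bool (i \<in> S) + of_bool (2 * g + 2 \<in> S)" if "i \<in> Bset g" for i
    using cf_eta_set[OF S(1,2) that] S(3) by simp
  have "exc {i\<in>Bset g. cf g \<zeta> i = 1} = 0 \<longleftrightarrow> exc S = 0"
  proof (cases "2 * g + 2 \<in> S")
    case True
    then have "{i\<in>Bset g. cf g \<zeta> i = 1} = Bset g - S" using cfS by auto
    then show ?thesis using exc_Diff[OF finite_Bset S(1)] exc_Bset by simp
  next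
    case False
    then have "{i\<in>Bset g. cf g \<zeta> i = 1} = S" using cfS S(1) by auto
    then show ?thesis by simp
  qed
  then have bal: "balanced S \<longleftrightarrow> exc {i\<in>Bset g. cf g \<zeta> i = 1} = 0" using balanced_iff_exc[OF fS] by simp
  have TB: "T \<subseteq> Bset g" using S(1) by (auto simp: T_def Uset_def)
  have mem: "i \<in> T \<longleftrightarrow> (i \<in> S) = even i" if "i \<in> Bset g" for i
    using that by (auto simp: T_def Uset_def)
  have fT: "finite T" using TB finite_Bset by (rule finite_subset)
  have "Delta T * Delta (Bset g - T) = pair_prod (\<lambda>i j. Var j - Var i) T * pair_prod (\<lambda>i j. Var j - Var i :: (nat, int) mpol) (Bset g - T)"
    by (simp add: Delta_pair_prod fT)
  also have "\<dots> = pair_prod (\<lambda>i j. if i \<in> T \<and> j \<in> T then Var j - Var i else 1) (Bset g)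
      * pair_prod (\<lambda>i j. if i \<in> Bset g - T \<and> j \<in> Bset g - T then Var j - Var i else 1) (Bset g)"
    using pair_prod_subset[OF finite_Bset TB, of "\<lambda>i j. Var j - Var i :: (nat, int) mpol"]
      pair_prod_subset[OF finite_Bset, of "Bset g - T" g "\<lambda>i j. Var j - Var i :: (nat, int) mpol"] by simp
  also have "\<dots> = pair_prod (\<lambda>i j. if (cf g \<zeta> i = cf g \<zeta> j) = (even i = even j) then Var j - Var i else 1) (Bset g)"
    unfolding pair_prod_mult[symmetric]
  proof (rule pair_prod_cong)
    fix i j assume ij: "i \<in> Bset g" "j \<in> Bset g"
    have "(cf g \<zeta> i = cf g \<zeta> j) = (even i = even j) \<longleftrightarrow> (i \<in> T \<longleftrightarrow> j \<in> T)"
      using cf_separates[OF S(1,2) ij] S(3) mem[OF ij(1)] mem[OF ij(2)] by auto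
    then show "(if i \<in> T \<and> j \<in> T then Var j - Var i else 1) * (if i \<in> Bset g - T \<and> j \<in> Bset g - T then Var j - Var i else 1)
      = (if (cf g \<zeta> i = cf g \<zeta> j) = (even i = even j) then Var j - Var i else 1 :: (nat, int) mpol)"
      using ij by auto
  qed
  finally show ?thesis unfolding P bal by simp
qed

definition qe :: "nat \<Rightarrow> char_array set \<Rightarrow> nat \<Rightarrow> nat \<Rightarrow> nat" where
  "qe g V i j = (if same g V i j then (if even i = even j then 2 else 0) else 1)"

definition Q0 :: "nat \<Rightarrow> char_array set \<Rightarrow> (nat, int) mpol" where
  "Q0 g V = (if blocks_balanced g V (Bset g) then pair_prod (\<lambda>i j. (Var j - Var i) ^ qe g V i j) (Bset g) else 0)"

text \<open>The difference of a_i and a_j divides a nonzero P_\<zeta> according to whether equality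
  of \<open>cf\<close> at i and j matches equality of parity. If V does not separate i and j this
  happens for all \<zeta> or for none; otherwise the difference of the two coordinates is a nonzero
  linear form, and it happens for exactly half of V.\<close>

lemma Q0_power:
  assumes V: "char_space.subspace V" "V \<subseteq> chars g"
  shows "Q0 g V ^ (2 ^ char_space.dim V) = (\<Prod>\<zeta>\<in>V. (Ptheta g \<zeta>)\<^sup>2)"
proof -
  have fV: "finite V" using V finite_chars finite_subset by blast
  note bal_iff = blocks_balanced_iff[OF V(1) fV]
  show ?thesis
  proof (cases "blocks_balanced g V (Bset g)")
    case False
    then obtain \<zeta> where "\<zeta> \<in> V" "exc {i\<in>Bset g. cf g \<zeta> i = 1} \<noteq> 0" using bal_iff by blast
    then have "(Ptheta g \<zeta>)\<^sup>2 = 0" using Ptheta_eq[of \<zeta> g] V by auto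
    then have "(\<Prod>\<zeta>\<in>V. (Ptheta g \<zeta>)\<^sup>2) = 0" using \<open>\<zeta> \<in> V\<close> fV by (meson prod_zero)
    then show ?thesis using False by (simp add: Q0_def)
  next
    case True
    define cnt where "cnt i j = card {\<zeta>\<in>V. (cf g \<zeta> i = cf g \<zeta> j) = (even i = even j)}" for i j
    have cnt: "2 * cnt i j = qe g V i j * 2 ^ char_space.dim V" for i j
    proof (cases "same g V i j")
      case True
      then have "{\<zeta>\<in>V. (cf g \<zeta> i = cf g \<zeta> j) = (even i = even j)} = (if even i = even j then V else {})"
        by (auto simp: same_def)
      then show ?thesis using True card_subspace[OF V(1) fV] by (simp add: cnt_def qe_def)
    next
      case False
      then show ?thesis using card_half[OF V(1) fV False] card_subspace[OF V(1) fV]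
        by (cases "even i = even j") (simp_all add: cnt_def qe_def)
    qed
    have "(\<Prod>\<zeta>\<in>V. (Ptheta g \<zeta>)\<^sup>2)
      = (\<Prod>\<zeta>\<in>V. pair_prod (\<lambda>i j. (if (cf g \<zeta> i = cf g \<zeta> j) = (even i = even j) then Var j - Var i else 1)\<^sup>2) (Bset g))"
      using bal_iff True V(2) by (intro prod.cong refl) (auto simp: Ptheta_eq subset_iff pair_prod_power)
    also have "\<dots> = pair_prod (\<lambda>i j. \<Prod>\<zeta>\<in>V. (if (cf g \<zeta> i = cf g \<zeta> j) = (even i = even j) then Var j - Var i else 1)\<^sup>2) (Bset g)"
      by (rule prod_pair_prod)
    also have "\<dots> = pair_prod (\<lambda>i j. ((Var j - Var i) ^ qe g V i j) ^ (2 ^ char_space.dim V)) (Bset g)"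
    proof (rule pair_prod_cong)
      fix i j
      have "(\<Prod>\<zeta>\<in>V. (if (cf g \<zeta> i = cf g \<zeta> j) = (even i = even j) then Var j - Var i else 1)\<^sup>2)
        = (\<Prod>\<zeta>\<in>{\<zeta>\<in>V. (cf g \<zeta> i = cf g \<zeta> j) = (even i = even j)}. (Var j - Var i :: (nat, int) mpol)\<^sup>2)"
        using fV by (intro prod.mono_neutral_cong_right) auto
      also have "\<dots> = (Var j - Var i) ^ (2 * cnt i j)" by (simp add: cnt_def power_mult)
      finally show "(\<Prod>\<zeta>\<in>V. (if (cf g \<zeta> i = cf g \<zeta> j) = (even i = even j) then Var j - Var i else 1)\<^sup>2)
        = ((Var j - Var i :: (nat, int) mpol) ^ qe g V i j) ^ (2 ^ char_space.dim V)"
        unfolding cnt power_mult .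
    qed
    finally show ?thesis using True by (simp add: Q0_def pair_prod_power)
  qed
qed

lemma mvars_Q0: "mvars (Q0 g V) \<subseteq> Bset g"
proof -
  have "mvars ((Var j - Var i :: (nat, int) mpol) ^ n) \<subseteq> Bset g" if "i \<in> Bset g" "j \<in> Bset g" for i j n
    using mvars_power[of "Var j - Var i :: (nat, int) mpol" n] mvars_Var_diff[where 'c = int, of j i] that by blast
  then have "mvars (pair_prod (\<lambda>i j. (Var j - Var i :: (nat, int) mpol) ^ qe g V i j) (Bset g)) \<subseteq> Bset g"
    by (intro mvars_pair_prod)
  then show ?thesis by (simp add: Q0_def)
qed

lemma int_power_eq_imp_sq_eq:
  fixes x y :: int
  assumes "x ^ (2 ^ d) = y ^ (2 ^ d)"
  shows "x\<^sup>2 = y\<^sup>2"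
proof -
  have "\<bar>x\<bar> ^ (2 ^ d) = \<bar>y\<bar> ^ (2 ^ d)" using assms by (simp flip: power_abs)
  then have "\<bar>x\<bar> = \<bar>y\<bar>" by (rule power_eq_imp_eq_base) auto
  then show ?thesis by (metis power2_abs)
qed

text \<open>Integer coefficients matter: at an integer point, equality of the 2^d-th powers leaves
  only a sign undetermined, and squaring removes it.\<close>

lemma Qpoly_facts:
  assumes V: "char_space.subspace V" "V \<subseteq> chars g"
  shows "mvars (Qpoly g V) \<subseteq> Bset g" "(Qpoly g V)\<^sup>2 = (Q0 g V)\<^sup>2"
proof -
  have "mvars (Q0 g V) \<subseteq> Bset g \<and> Q0 g V ^ (2 ^ char_space.dim V) = (\<Prod>\<zeta>\<in>V. (Ptheta g \<zeta>)\<^sup>2)"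
    using mvars_Q0 Q0_power[OF V] by blast
  then have Q: "mvars (Qpoly g V) \<subseteq> Bset g \<and> Qpoly g V ^ (2 ^ char_space.dim V) = (\<Prod>\<zeta>\<in>V. (Ptheta g \<zeta>)\<^sup>2)"
    unfolding Qpoly_def by (rule someI)
  then show m: "mvars (Qpoly g V) \<subseteq> Bset g" by blast
  have eq: "Qpoly g V ^ (2 ^ char_space.dim V) = Q0 g V ^ (2 ^ char_space.dim V)"
    using Q Q0_power[OF V] by simp
  show "(Qpoly g V)\<^sup>2 = (Q0 g V)\<^sup>2"
  proof (rule mpol_eqI[OF finite_Bset[of g]])
    show "mvars ((Qpoly g V)\<^sup>2) \<subseteq> Bset g" "mvars ((Q0 g V)\<^sup>2) \<subseteq> Bset g"
      using m mvars_Q0[of g V] mvars_power[of "Qpoly g V" 2] mvars_power[of "Q0 g V" 2] by auto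
    fix y :: "nat \<Rightarrow> nat"
    note h = ring_hom_simps(7)[OF ring_hom_msubst[OF ring_hom_id], of "\<lambda>v. int (y v)"]
    have "msubst id (\<lambda>v. int (y v)) (Qpoly g V) ^ (2 ^ char_space.dim V) = msubst id (\<lambda>v. int (y v)) (Q0 g V) ^ (2 ^ char_space.dim V)"
      unfolding h[symmetric] eq ..
    then show "msubst id (\<lambda>v. int (y v)) ((Qpoly g V)\<^sup>2) = msubst id (\<lambda>v. int (y v)) ((Q0 g V)\<^sup>2)"
      unfolding h by (rule int_power_eq_imp_sq_eq)
  qed
qed

definition disc :: "(nat \<Rightarrow> complex) \<Rightarrow> nat set \<Rightarrow> complex" where
  "disc a S = pair_prod (\<lambda>i j. (a i - a j)\<^sup>2) S"

lemma Qpoly_eval: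
  assumes V: "char_space.subspace V" "V \<subseteq> chars g" and inj: "inj_on a (Bset g)"
  shows "msubst of_int a ((Qpoly g V)\<^sup>2) = disc a (Bset g) * TT g a V (Bset g)"
proof -
  note h = ring_hom_simps[OF ring_hom_msubst[OF ring_hom_of_int], of a]
  show ?thesis
  proof (cases "blocks_balanced g V (Bset g)")
    case False
    then show ?thesis unfolding Qpoly_facts(2)[OF V] by (simp add: Q0_def TT_def)
  next
    case True
    have "msubst of_int a ((Qpoly g V)\<^sup>2) = pair_prod (\<lambda>i j. ((a j - a i) ^ qe g V i j)\<^sup>2) (Bset g)"
      unfolding Qpoly_facts(2)[OF V] using True
      by (simp add: Q0_def h ring_hom_pair_prod[OF ring_hom_msubst[OF ring_hom_of_int]] msubst_Var pair_prod_power)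
    \<comment> \<open>Taking the discriminant out lowers the exponents 4, 0, 2 of the squared
      polynomial to 2, -2, 0.\<close>
    also have "\<dots> = pair_prod (\<lambda>i j. (a i - a j)\<^sup>2 * (if same g V i j then (kf a i j)\<^sup>2 else 1)) (Bset g)"
    proof (rule pair_prod_cong)
      fix i j assume ij: "i \<in> Bset g" "j \<in> Bset g" "i < j"
      then have "a i \<noteq> a j" using inj by (auto simp: inj_on_def)
      then show "((a j - a i) ^ qe g V i j)\<^sup>2 = (a i - a j)\<^sup>2 * (if same g V i j then (kf a i j)\<^sup>2 else 1)"
        by (simp add: qe_def kf_def power2_commute[of "a j" "a i"] power_divide power_mult_distrib power2_eq_square[of "(a i - a j)\<^sup>2"])
    qed
    also have "\<dots> = disc a (Bset g) * TT g a V (Bset g)"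
      using True by (simp add: pair_prod_mult disc_def TT_def)
    finally show ?thesis .
  qed
qed

theorem Kpoly_eval:
  assumes inj: "inj_on a (Bset g)" and p: "p \<in> Bset g"
  shows "msubst id a (Kpoly g) = 1 / 2 ^ g * disc a (Bset g) * kap a p (Bset g)"
proof -
  note h = ring_hom_simps[OF ring_hom_msubst[OF ring_hom_id], of a]
  have two: "msubst id a (2 :: (nat, complex) mpol) = 2"
    using h(2)[of 1 1] h(1) by simp
  define D where "D i = {V \<in> subs (chars g). char_space.dim V = i}" for i
  have D: "{V. char_space.subspace V \<and> V \<subseteq> chars g \<and> char_space.dim V = i} = D i" for i
    by (auto simp: D_def subs_def)
  have fD: "finite (D i)" for i by (simp add: D_def finite_chars)
  have G: "msubst id a (Poly_Mapping.map of_int (Gtilde g i)) = (\<Sum>V\<in>D i. disc a (Bset g) * TT g a V (Bset g))" for i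
    unfolding msubst_map_of_int Gtilde_def D msubst_sum[OF ring_hom_of_int]
    by (intro sum.cong refl Qpoly_eval inj) (auto simp: D_def subs_def)
  have "msubst id a (Kpoly g) = 1 / 2 ^ g * (\<Sum>i\<in>{0..g}. (- 1) ^ i * 2 ^ (i * (i - 1) div 2) * (\<Sum>V\<in>D i. disc a (Bset g) * TT g a V (Bset g)))"
    unfolding Kpoly_def
    by (simp only: h msubst_sum[OF ring_hom_id] msubst_Const[OF ring_hom_id] G two id_apply)
  also have "(\<Sum>i\<in>{0..g}. (- 1) ^ i * 2 ^ (i * (i - 1) div 2) * (\<Sum>V\<in>D i. disc a (Bset g) * TT g a V (Bset g)))
      = (\<Sum>i\<in>{0..g}. \<Sum>V\<in>D i. mu V * (disc a (Bset g) * TT g a V (Bset g)))"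
    unfolding sum_distrib_left by (intro sum.cong refl) (simp add: D_def mu_def)
  also have "\<dots> = (\<Sum>V\<in>(\<Union>i\<in>{0..g}. D i). mu V * (disc a (Bset g) * TT g a V (Bset g)))"
    using fD by (intro sum.UNION_disjoint[symmetric]) (auto simp: D_def)
  \<comment> \<open>Subspaces of dimension above g may be added: their classes cannot all be
    balanced, so they contribute 0.\<close>
  also have "\<dots> = (\<Sum>V\<in>subs (chars g). mu V * (disc a (Bset g) * TT g a V (Bset g)))"
  proof (rule sum.mono_neutral_left)
    show "finite (subs (chars g))" by (simp add: finite_chars)
    show "(\<Union>i\<in>{0..g}. D i) \<subseteq> subs (chars g)" by (auto simp: D_def)
    show "\<forall>V\<in>subs (chars g) - (\<Union>i\<in>{0..g}. D i). mu V * (disc a (Bset g) * TT g a V (Bset g)) = 0"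
    proof
      fix V assume "V \<in> subs (chars g) - (\<Union>i\<in>{0..g}. D i)"
      then have "char_space.subspace V" "V \<subseteq> chars g" "\<not> char_space.dim V \<le> g" by (auto simp: D_def subs_def)
      then have "\<not> blocks_balanced g V (Bset g)" using dim_le_if_blocks_balanced by blast
      then show "mu V * (disc a (Bset g) * TT g a V (Bset g)) = 0" by (simp add: TT_def)
    qed
  qed
  also have "\<dots> = disc a (Bset g) * Xi g a (chars g) (Bset g)"
    unfolding Xi_def sum_distrib_left by (simp add: mult_ac)
  also have "Xi g a (chars g) (Bset g) = kap a p (Bset g)" by (rule Xi_chars[OF inj p])
  finally show ?thesis by (simp only: mult.assoc)
qed

lemma mvars_Kpoly: "mvars (Kpoly g) \<subseteq> Bset g"
proof -
  have "mvars (Poly_Mapping.map of_int f :: (nat, complex) mpol) \<subseteq> mvars f" for f :: "(nat, int) mpol"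
  proof -
    have "Poly_Mapping.keys (Poly_Mapping.map of_int f :: (nat, complex) mpol) \<subseteq> Poly_Mapping.keys f"
      by (auto simp: in_keys_iff Poly_Mapping.map.rep_eq when_def)
    then show ?thesis by (auto simp: mvars_def)
  qed
  moreover have "mvars (Gtilde g i) \<subseteq> Bset g" for i
    unfolding Gtilde_def
  proof (rule mvars_sum)
    fix V assume "V \<in> {V. char_space.subspace V \<and> V \<subseteq> chars g \<and> char_space.dim V = i}"
    then show "mvars ((Qpoly g V)\<^sup>2) \<subseteq> Bset g" using Qpoly_facts(1)[of V g] mvars_power[of "Qpoly g V" 2] by blast
  qed
  ultimately have G: "mvars (Poly_Mapping.map of_int (Gtilde g i) :: (nat, complex) mpol) \<subseteq> Bset g" for i by blast
  have c: "(- 1) ^ i * 2 ^ k = (Const ((- 1) ^ i * 2 ^ k) :: (nat, complex) mpol)" for i k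
  proof -
    have "(2 :: (nat, complex) mpol) = Const 2" by (simp add: Const_def)
    then show ?thesis by (simp only: ring_hom_simps[OF ring_hom_Const])
  qed
  have "mvars (\<Sum>i\<in>{0..g}. (- 1) ^ i * 2 ^ (i * (i - 1) div 2) * (Poly_Mapping.map of_int (Gtilde g i) :: (nat, complex) mpol)) \<subseteq> Bset g"
    unfolding c
  proof (rule mvars_sum)
    fix i
    show "mvars (Const ((- 1) ^ i * 2 ^ (i * (i - 1) div 2)) * (Poly_Mapping.map of_int (Gtilde g i) :: (nat, complex) mpol)) \<subseteq> Bset g"
      using mvars_mult[of "Const ((- 1) ^ i * 2 ^ (i * (i - 1) div 2))" "Poly_Mapping.map of_int (Gtilde g i) :: (nat, complex) mpol"] G[of i] by auto
  qed
  then show ?thesis unfolding Kpoly_def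
    using mvars_mult[of "Const (1 / 2 ^ g)" "\<Sum>i\<in>{0..g}. (- 1) ^ i * 2 ^ (i * (i - 1) div 2) * (Poly_Mapping.map of_int (Gtilde g i) :: (nat, complex) mpol)"] by auto
qed

subsection \<open>Invariance and the formula for H\<close>

text \<open>The expression \<open>Xi g a (chars g) (Bset g)\<close> does not mention the base
  point.\<close>

lemma kap_independent:
  assumes "inj_on a (Bset g)" "p \<in> Bset g" "q \<in> Bset g"
  shows "kap a p (Bset g) = kap a q (Bset g)"
  using Xi_chars[OF assms(1,2)] Xi_chars[OF assms(1,3)] by simp

lemma bij_betw_map_permutes:
  assumes L: "L \<in> permutations_of_set B" and fin: "finite B"
  shows "bij_betw (\<lambda>\<sigma>. map \<sigma> L) {\<sigma>. \<sigma> permutes B} (permutations_of_set B)"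
proof -
  have sL: "set L = B" "distinct L" using L by (auto dest: permutations_of_setD)
  have inj: "inj_on (\<lambda>\<sigma>. map \<sigma> L) {\<sigma>. \<sigma> permutes B}"
  proof (rule inj_onI)
    fix \<sigma> \<tau> assume h: "\<sigma> \<in> {\<sigma>. \<sigma> permutes B}" "\<tau> \<in> {\<sigma>. \<sigma> permutes B}" "map \<sigma> L = map \<tau> L"
    show "\<sigma> = \<tau>"
    proof
      fix x show "\<sigma> x = \<tau> x"
      proof (cases "x \<in> B")
        case True
        then show ?thesis using h(3) sL by simp
      next
        case False
        then show ?thesis using h by (simp add: permutes_not_in)
      qed
    qed
  qed
  have "(\<lambda>\<sigma>. map \<sigma> L) ` {\<sigma>. \<sigma> permutes B} \<subseteq> permutations_of_set B"
  proof (rule image_subsetI)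
    fix \<sigma> assume "\<sigma> \<in> {\<sigma>. \<sigma> permutes B}"
    then have \<sigma>: "\<sigma> permutes B" by simp
    show "map \<sigma> L \<in> permutations_of_set B"
      using sL permutes_image[OF \<sigma>] permutes_inj_on[OF \<sigma>]
      by (intro permutations_of_setI) (auto simp: distinct_map)
  qed
  moreover have "card ((\<lambda>\<sigma>. map \<sigma> L) ` {\<sigma>. \<sigma> permutes B}) = card (permutations_of_set B)"
    unfolding card_image[OF inj] using fin card_permutations[OF refl fin] by simp
  ultimately have "(\<lambda>\<sigma>. map \<sigma> L) ` {\<sigma>. \<sigma> permutes B} = permutations_of_set B"
    by (intro card_subset_eq) auto
  with inj show ?thesis by (simp add: bij_betw_def)
qed

text \<open>The weight \<open>h\<close> of the starting point is constantly 1 for the sum over all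
  cycles, and the indicator of odd indices when the permutations in \<open>Eset\<close> are to be
  selected.\<close>

lemma sum_cyclic_chains:
  assumes "finite B" "B \<noteq> {}"
  shows "(\<Sum>xs\<in>permutations_of_set B. h (hd xs) * chain w (xs @ [hd xs])) = (\<Sum>p\<in>B. h p * path_sum w p (B - {p}) p)"
proof -
  have "(\<Sum>xs\<in>permutations_of_set B. h (hd xs) * chain w (xs @ [hd xs]))
    = (\<Sum>p\<in>B. \<Sum>xs\<in>(\<lambda>xs. p # xs) ` permutations_of_set (B - {p}). h (hd xs) * chain w (xs @ [hd xs]))"
    unfolding permutations_of_set_nonempty[OF assms(2)]
    by (rule sum.UNION_disjoint) (use assms in auto)
  also have "\<dots> = (\<Sum>p\<in>B. h p * path_sum w p (B - {p}) p)"
    by (intro sum.cong refl) (simp add: sum.reindex path_sum_def sum_distrib_left)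
  finally show ?thesis .
qed

lemma chain_snoc: "chain w (xs @ [y, z]) = chain w (xs @ [y]) * w y z"
proof (induction xs)
  case (Cons x xs)
  then show ?case by (cases xs) (auto simp: mult.assoc)
qed simp

lemma chain_map_upt: "chain w (map e [1..<Suc (Suc n)]) = (\<Prod>i\<in>{1..n}. w (e i) (e (i + 1)))"
proof (induction n)
  case (Suc n)
  have "map e [1..<Suc (Suc (Suc n))] = map e [1..<Suc n] @ [e (Suc n), e (Suc (Suc n))]" by simp
  then have "chain w (map e [1..<Suc (Suc (Suc n))]) = chain w (map e [1..<Suc n] @ [e (Suc n)]) * w (e (Suc n)) (e (Suc (Suc n)))"
    by (simp only: chain_snoc)
  also have "map e [1..<Suc n] @ [e (Suc n)] = map e [1..<Suc (Suc n)]" by simp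
  finally show ?case using Suc.IH by simp
qed simp

lemma chain_cycle:
  assumes "r \<ge> 1"
  shows "chain w (map e [1..<Suc r] @ [e 1]) = (\<Prod>i\<in>{1..r - 1}. w (e i) (e (i + 1))) * w (e r) (e 1)"
proof -
  obtain n where r: "r = Suc n" using assms by (cases r) auto
  have "map e [1..<Suc r] @ [e 1] = map e [1..<Suc n] @ [e r, e 1]" by (simp add: r)
  then have "chain w (map e [1..<Suc r] @ [e 1]) = chain w (map e [1..<Suc n] @ [e r]) * w (e r) (e 1)"
    by (simp only: chain_snoc)
  also have "map e [1..<Suc n] @ [e r] = map e [1..<Suc (Suc n)]" by (simp add: r)
  finally show ?thesis unfolding chain_map_upt by (simp add: r)
qed

lemma sum_permutes_cycle:
  fixes r :: nat
  assumes "r \<ge> 1"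
  shows "(\<Sum>e | e permutes {1..r}. h (e 1) * ((\<Prod>i\<in>{1..r - 1}. w (e i) (e (i + 1))) * w (e r) (e 1)))
    = (\<Sum>p\<in>{1..r}. h p * path_sum w p ({1..r} - {p}) p)"
proof -
  have L: "[1..<Suc r] \<in> permutations_of_set {1..r}" by (rule permutations_of_setI) auto
  have hd: "hd (map e [1..<Suc r]) = e 1" for e :: "nat \<Rightarrow> nat" using assms by (simp add: upt_conv_Cons del: upt_Suc)
  have "(\<Sum>p\<in>{1..r}. h p * path_sum w p ({1..r} - {p}) p) = (\<Sum>xs\<in>permutations_of_set {1..r}. h (hd xs) * chain w (xs @ [hd xs]))"
    using assms by (subst sum_cyclic_chains) auto
  also have "\<dots> = (\<Sum>e | e permutes {1..r}. h (e 1) * chain w (map e [1..<Suc r] @ [e 1]))"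
    unfolding sum.reindex_bij_betw[OF bij_betw_map_permutes[OF L finite_atLeastAtMost], symmetric] hd ..
  finally show ?thesis unfolding chain_cycle[OF assms] ..
qed

lemma Kpoly_eqI:
  fixes f h :: "(nat, complex) mpol"
  assumes "mvars f \<subseteq> Bset g" "mvars h \<subseteq> Bset g"
    and "\<And>a. inj_on a (Bset g) \<Longrightarrow> msubst id a f = msubst id a h"
  shows "f = h"
  by (rule mpol_eqI[OF finite_Bset assms(1,2)], rule assms(3)) (auto simp: inj_on_def)

lemma mvars_rename:
  fixes f :: "('v, 'c::comm_ring_1) mpol" and \<sigma> :: "'v \<Rightarrow> 'w"
  shows "mvars (rename \<sigma> f) \<subseteq> \<sigma> ` mvars f"
  unfolding rename_def msubst_def
proof (rule mvars_sum)
  fix m assume m: "m \<in> Poly_Mapping.keys f"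
  have V: "mvars (Var v :: ('w, 'c) mpol) \<subseteq> {v}" for v by (auto simp: mvars_def Var_def)
  have "mvars (Var (\<sigma> v) ^ Poly_Mapping.lookup m v :: ('w, 'c) mpol) \<subseteq> \<sigma> ` mvars f" if "v \<in> Poly_Mapping.keys m" for v
    using mvars_power[of "Var (\<sigma> v)" "Poly_Mapping.lookup m v"] V[of "\<sigma> v"] that m by (auto simp: mvars_def)
  then have "mvars (\<Prod>v\<in>Poly_Mapping.keys m. Var (\<sigma> v) ^ Poly_Mapping.lookup m v :: ('w, 'c) mpol) \<subseteq> \<sigma> ` mvars f"
    by (rule mvars_prod)
  then show "mvars (Const (Poly_Mapping.lookup f m) * (\<Prod>v\<in>Poly_Mapping.keys m. Var (\<sigma> v) ^ Poly_Mapping.lookup m v) :: ('w, 'c) mpol) \<subseteq> \<sigma> ` mvars f"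
    using mvars_mult[of "Const (Poly_Mapping.lookup f m)" "\<Prod>v\<in>Poly_Mapping.keys m. Var (\<sigma> v) ^ Poly_Mapping.lookup m v :: ('w, 'c) mpol"] by auto
qed

lemma disc_permute:
  assumes "\<sigma> permutes Bset g"
  shows "disc (\<lambda>v. a (\<sigma> v)) (Bset g) = disc a (Bset g)"
proof -
  have "pair_prod (\<lambda>i j. (a i - a j)\<^sup>2) (\<sigma> ` Bset g) = pair_prod (\<lambda>i j. (a (\<sigma> i) - a (\<sigma> j))\<^sup>2) (Bset g)"
    using permutes_inj_on[OF assms] by (intro pair_prod_image) (auto simp: power2_commute)
  then show ?thesis using permutes_image[OF assms] by (simp add: disc_def)
qed

lemma inj_on_permute:
  assumes "\<sigma> permutes X" "inj_on a X"
  shows "inj_on (\<lambda>v. a (\<sigma> v)) X"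
  using comp_inj_on[of \<sigma> X a] permutes_inj_on[OF assms(1)] permutes_image[OF assms(1)] assms(2) by (simp add: comp_def)

lemma SU_parity:
  assumes "\<sigma> \<in> SU g" "u \<in> Bset g" "v \<in> Bset g"
  shows "even (\<sigma> u) = even (\<sigma> v) \<longleftrightarrow> even u = even v"
proof -
  have perm: "\<sigma> permutes Bset g" and im: "\<sigma> ` Uset g = Uset g \<or> \<sigma> ` Uset g = Uset' g"
    using assms(1) by (auto simp: SU_def)
  have U: "\<sigma> i \<in> \<sigma> ` Uset g \<longleftrightarrow> odd i" if "i \<in> Bset g" for i
    using that permutes_inj[OF perm] by (auto simp: Uset_def inj_image_mem_iff)
  have B: "\<sigma> i \<in> Bset g" if "i \<in> Bset g" for i using permutes_in_image[OF perm] that by simp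
  show ?thesis using im U[OF assms(2)] U[OF assms(3)] B[OF assms(2)] B[OF assms(3)]
    by (auto simp: Uset_def Uset'_def)
qed

text \<open>The weight \<open>wt\<close> depends on parities only through their agreement, which
  \<sigma> preserves even if it exchanges the odd and the even indices; the moved base point is
  absorbed by evaluating K at \<sigma>(1).\<close>

lemma Kpoly_SU_invariant:
  assumes "\<sigma> \<in> SU g"
  shows "rename \<sigma> (Kpoly g) = Kpoly g"
proof (rule Kpoly_eqI)
  have perm: "\<sigma> permutes Bset g" using assms by (simp add: SU_def)
  show "mvars (rename \<sigma> (Kpoly g)) \<subseteq> Bset g"
    using mvars_rename[of \<sigma> "Kpoly g"] mvars_Kpoly[of g] permutes_image[OF perm] by blast
  show "mvars (Kpoly g) \<subseteq> Bset g" by (rule mvars_Kpoly)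
  fix a :: "nat \<Rightarrow> complex" assume inj: "inj_on a (Bset g)"
  have p: "1 \<in> Bset g" by (simp add: Bset_def)
  have inj': "inj_on (\<lambda>v. a (\<sigma> v)) (Bset g)"
    by (rule inj_on_permute[OF perm inj])
  have p': "\<sigma> 1 \<in> Bset g" using permutes_in_image[OF perm] p by simp
  have "path_sum (wt (\<lambda>v. a (\<sigma> v))) 1 (Bset g - {1}) 1 = path_sum (\<lambda>u v. wt a (\<sigma> u) (\<sigma> v)) 1 (Bset g - {1}) 1"
    using SU_parity[OF assms] p by (intro path_sum_cong) (auto simp: wt_def)
  also have "\<dots> = path_sum (wt a) (\<sigma> 1) (\<sigma> ` (Bset g - {1})) (\<sigma> 1)"
    using permutes_inj_on[OF perm] by (intro path_sum_image[symmetric])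
  also have "\<sigma> ` (Bset g - {1}) = Bset g - {\<sigma> 1}"
    using permutes_image[OF perm] permutes_inj[OF perm] by (simp add: image_set_diff)
  finally have k: "kap (\<lambda>v. a (\<sigma> v)) 1 (Bset g) = kap a (\<sigma> 1) (Bset g)" by (simp add: kap_def)
  show "msubst id a (rename \<sigma> (Kpoly g)) = msubst id a (Kpoly g)"
    unfolding msubst_rename Kpoly_eval[OF inj' p] Kpoly_eval[OF inj p'] k disc_permute[OF perm] ..
qed

lemma chain_mult: "chain (\<lambda>u v. c u v * d u v) xs = chain c xs * chain d xs"
  by (induction "\<lambda>u v. c u v * d u v" xs rule: chain.induct) (auto simp: mult_ac)

text \<open>Separate the alternation pattern of a fixed cycle from the differences, which alone are
  moved by \<sigma>. For each fixed cycle the sum over \<sigma> runs through all Hamiltonian cycles,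
  alternating or not, and vanishes by \<open>path_sum_all\<close> with exponent 2g > 0.\<close>

lemma Kpoly_sum_permutations:
  assumes "g \<ge> 1"
  shows "(\<Sum>\<sigma> | \<sigma> permutes Bset g. rename \<sigma> (Kpoly g)) = 0"
proof (rule Kpoly_eqI)
  show "mvars (\<Sum>\<sigma> | \<sigma> permutes Bset g. rename \<sigma> (Kpoly g)) \<subseteq> Bset g"
  proof (rule mvars_sum)
    fix \<sigma> assume "\<sigma> \<in> {\<sigma>. \<sigma> permutes Bset g}"
    then have perm: "\<sigma> permutes Bset g" by simp
    show "mvars (rename \<sigma> (Kpoly g)) \<subseteq> Bset g"
      using mvars_rename[of \<sigma> "Kpoly g"] mvars_Kpoly[of g] permutes_image[OF perm] by blast
  qed
  show "mvars (0 :: (nat, complex) mpol) \<subseteq> Bset g" by simp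
  fix a :: "nat \<Rightarrow> complex" assume inj: "inj_on a (Bset g)"
  have p: "1 \<in> Bset g" by (simp add: Bset_def)
  define w where "w u v = 1 / (a u - a v)" for u v
  have zero: "(\<Sum>\<sigma> | \<sigma> permutes Bset g. chain (\<lambda>u v. w (\<sigma> u) (\<sigma> v)) (1 # xs @ [1])) = 0"
    if xs: "xs \<in> permutations_of_set (Bset g - {1})" for xs
  proof -
    have L: "1 # xs \<in> permutations_of_set (Bset g)" using xs p permutations_of_set_nonempty[of "Bset g"] by auto
    have "(\<Sum>\<sigma> | \<sigma> permutes Bset g. chain (\<lambda>u v. w (\<sigma> u) (\<sigma> v)) (1 # xs @ [1]))
      = (\<Sum>\<sigma> | \<sigma> permutes Bset g. chain w (map \<sigma> (1 # xs) @ [hd (map \<sigma> (1 # xs))]))"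
      by (simp flip: chain_map)
    also have "\<dots> = (\<Sum>ys\<in>permutations_of_set (Bset g). chain w (ys @ [hd ys]))"
      by (rule sum.reindex_bij_betw[OF bij_betw_map_permutes[OF L finite_Bset]])
    also have "\<dots> = (\<Sum>p\<in>Bset g. path_sum w p (Bset g - {p}) p)"
      using sum_cyclic_chains[of "Bset g" "\<lambda>_. 1" w] p by auto
    also have "\<dots> = 0"
    proof (rule sum.neutral, rule ballI)
      fix p assume p: "p \<in> Bset g"
      have c: "card (Bset g - {p}) = 2 * g + 1" using p by (simp add: Bset_def)
      have "Bset g - {p} \<noteq> {}" using c by (metis card.empty add_is_0 zero_neq_one)
      then have "path_sum w p (Bset g - {p}) p = (a p - a p) ^ (card (Bset g - {p}) - 1) / (\<Prod>s\<in>Bset g - {p}. (a p - a s) * (a s - a p))"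
        unfolding w_def using inj p by (intro path_sum_all) (auto simp: inj_on_def)
      then show "path_sum w p (Bset g - {p}) p = 0" using c assms by simp
    qed
    finally show ?thesis .
  qed
  have K: "msubst id a (rename \<sigma> (Kpoly g)) = 1 / 2 ^ g * disc a (Bset g) *
      - (\<Sum>xs\<in>permutations_of_set (Bset g - {1}). chain (\<lambda>u v. of_bool (even u \<noteq> even v)) (1 # xs @ [1]) * chain (\<lambda>u v. w (\<sigma> u) (\<sigma> v)) (1 # xs @ [1]))"
    if "\<sigma> permutes Bset g" for \<sigma>
  proof -
    have inj': "inj_on (\<lambda>v. a (\<sigma> v)) (Bset g)"
      by (rule inj_on_permute[OF that inj])
    have "wt (\<lambda>v. a (\<sigma> v)) = (\<lambda>u v. of_bool (even u \<noteq> even v) * w (\<sigma> u) (\<sigma> v))"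
      by (auto simp: wt_def w_def fun_eq_iff)
    then show ?thesis
      unfolding msubst_rename Kpoly_eval[OF inj' p] disc_permute[OF that] kap_def path_sum_def by (simp add: chain_mult)
  qed
  have "msubst id a (\<Sum>\<sigma> | \<sigma> permutes Bset g. rename \<sigma> (Kpoly g))
    = (\<Sum>\<sigma> | \<sigma> permutes Bset g. 1 / 2 ^ g * disc a (Bset g) *
      - (\<Sum>xs\<in>permutations_of_set (Bset g - {1}). chain (\<lambda>u v. of_bool (even u \<noteq> even v)) (1 # xs @ [1]) * chain (\<lambda>u v. w (\<sigma> u) (\<sigma> v)) (1 # xs @ [1])))"
    unfolding msubst_sum[OF ring_hom_id] by (intro sum.cong refl K) simp
  also have "\<dots> = 1 / 2 ^ g * disc a (Bset g) *
      - (\<Sum>xs\<in>permutations_of_set (Bset g - {1}). chain (\<lambda>u v. of_bool (even u \<noteq> even v)) (1 # xs @ [1]) * (\<Sum>\<sigma> | \<sigma> permutes Bset g. chain (\<lambda>u v. w (\<sigma> u) (\<sigma> v)) (1 # xs @ [1])))"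
    unfolding sum_distrib_left[symmetric] sum_negf by (subst sum.swap) (simp add: sum_distrib_left)
  also have "\<dots> = 0" using zero by (simp del: chain.simps append_Cons)
  finally show "msubst id a (\<Sum>\<sigma> | \<sigma> permutes Bset g. rename \<sigma> (Kpoly g)) = msubst id a 0" by simp
qed

section \<open>Invariance under Moebius transformations\<close>

lemma path_sum_scale:
  assumes "finite A"
  shows "path_sum (\<lambda>u v. w u v * (c u * c v)) p A q = path_sum w p A q * (c p * (\<Prod>u\<in>A. (c u)\<^sup>2) * (c q :: 'c::comm_ring_1))"
  using assms
proof (induction "card A" arbitrary: A p)
  case (Suc n)
  have ne: "A \<noteq> {}" using Suc.hyps(2) by auto
  show ?case unfolding path_sum_rec[OF Suc.prems ne] sum_distrib_right
  proof (intro sum.cong refl)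
    fix x assume x: "x \<in> A"
    have "path_sum (\<lambda>u v. w u v * (c u * c v)) x (A - {x}) q = path_sum w x (A - {x}) q * (c x * (\<Prod>u\<in>A - {x}. (c u)\<^sup>2) * c q)"
      using Suc x by (intro Suc.hyps(1)) auto
    then show "w p x * (c p * c x) * path_sum (\<lambda>u v. w u v * (c u * c v)) x (A - {x}) q = w p x * path_sum w x (A - {x}) q * (c p * (\<Prod>u\<in>A. (c u)\<^sup>2) * c q)"
      using prod.remove[OF Suc.prems x, of "\<lambda>u. (c u)\<^sup>2"] by (simp add: power2_eq_square mult_ac)
  qed
qed (simp add: mult_ac)

lemma pair_prod_scale:
  assumes "finite S"
  shows "pair_prod (\<lambda>i j. c i * c j) S = (\<Prod>i\<in>S. c i :: 'c::comm_ring_1) ^ (card S - 1)"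
  using assms
proof (induction S rule: finite_induct)
  case (insert x S)
  show ?case
  proof (cases "S = {}")
    case False
    then obtain n where n: "card S = Suc n" using insert.hyps by (cases "card S") auto
    show ?thesis using insert n
      by (subst pair_prod_insert) (auto simp: mult.commute prod.distrib power_mult_distrib mult_ac)
  next
    case True
    then show ?thesis by (simp add: pair_prod_insert mult.commute)
  qed
qed simp

lemma tendsto_msubst:
  assumes "\<And>v. ((\<lambda>t. x t v) \<longlongrightarrow> (y v :: complex)) F"
  shows "((\<lambda>t. msubst id (x t) f) \<longlongrightarrow> msubst id y f) F"
  unfolding msubst_def by (intro tendsto_sum tendsto_mult tendsto_const tendsto_prod tendsto_power assms)

text \<open>With c_i = C a_i + D and b_i the image of a_i, one has a_i - a_j = (b_i - b_j) c_i c_j.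
  Each index lies in 2g+1 pairs, so the discriminant yields c_i^(4g+2); each lies on two edges of a
  cycle, which takes c_i^2 away. The weight is 4g.\<close>

lemma Kpoly_moebius_injective:
  fixes A B C D :: complex
  assumes det: "A * D - B * C = 1" and inj: "inj_on a (Bset g)" and nz: "\<And>i. i \<in> Bset g \<Longrightarrow> C * a i + D \<noteq> 0"
  shows "msubst id a (Kpoly g) = msubst id (\<lambda>i. (A * a i + B) / (C * a i + D)) (Kpoly g) * (\<Prod>i\<in>Bset g. (C * a i + D) ^ (4 * g))"
proof -
  define c where "c i = C * a i + D" for i
  define b where "b i = (A * a i + B) / c i" for i
  define P where "P = (\<Prod>i\<in>Bset g. c i)"
  have cnz: "c i \<noteq> 0" if "i \<in> Bset g" for i using nz that by (simp add: c_def)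
  have Pnz: "P \<noteq> 0" using cnz by (simp add: P_def)
  have diff: "(a i - a j) = (b i - b j) * (c i * c j)" if "i \<in> Bset g" "j \<in> Bset g" for i j
  proof -
    have "(b i - b j) * (c i * c j) = (A * a i + B) * c j - (A * a j + B) * c i"
      using cnz[OF that(1)] cnz[OF that(2)] by (simp add: b_def field_simps)
    also have "\<dots> = (A * D - B * C) * (a i - a j)" by (simp add: c_def algebra_simps)
    finally show ?thesis using det by simp
  qed
  have injb: "inj_on b (Bset g)"
  proof (rule inj_onI)
    fix i j assume "i \<in> Bset g" "j \<in> Bset g" "b i = b j"
    then show "i = j" using diff[of i j] inj by (auto simp: inj_on_def)
  qed
  have p: "1 \<in> Bset g" by (simp add: Bset_def)
  have "disc a (Bset g) = pair_prod (\<lambda>i j. (b i - b j)\<^sup>2 * (c i * c j)\<^sup>2) (Bset g)"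
    unfolding disc_def by (rule pair_prod_cong) (simp add: diff power_mult_distrib)
  also have "\<dots> = disc b (Bset g) * (P ^ (2 * g + 1))\<^sup>2"
  proof -
    have "pair_prod (\<lambda>i j. (c i * c j)\<^sup>2) (Bset g) = (P ^ (2 * g + 1))\<^sup>2"
      unfolding pair_prod_power pair_prod_scale[OF finite_Bset] P_def by (simp add: Bset_def)
    then show ?thesis by (simp only: pair_prod_mult disc_def)
  qed
  finally have d: "disc a (Bset g) = disc b (Bset g) * (P ^ (2 * g + 1))\<^sup>2" .
  have "path_sum (wt b) 1 (Bset g - {1}) 1 = path_sum (\<lambda>u v. wt a u v * (c u * c v)) 1 (Bset g - {1}) 1"
  proof (rule path_sum_cong)
    fix u v assume "u \<in> insert 1 (insert 1 (Bset g - {1}))" "v \<in> insert 1 (insert 1 (Bset g - {1}))"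
    then have uv: "u \<in> Bset g" "v \<in> Bset g" using p by auto
    show "wt b u v = wt a u v * (c u * c v)"
      using diff[OF uv] cnz[OF uv(1)] cnz[OF uv(2)] by (simp add: wt_def)
  qed
  also have "\<dots> = path_sum (wt a) 1 (Bset g - {1}) 1 * (c 1 * (\<Prod>u\<in>Bset g - {1}. (c u)\<^sup>2) * c 1)"
    by (rule path_sum_scale) simp
  also have "c 1 * (\<Prod>u\<in>Bset g - {1}. (c u)\<^sup>2) * c 1 = P\<^sup>2"
    unfolding P_def prod_power_distrib using prod.remove[OF finite_Bset p, of "\<lambda>u. (c u)\<^sup>2"] by (simp add: power2_eq_square mult_ac)
  finally have k: "kap b 1 (Bset g) = kap a 1 (Bset g) * P\<^sup>2" by (simp add: kap_def)
  have "(\<Prod>i\<in>Bset g. c i ^ (4 * g)) = P ^ (4 * g)" by (simp add: P_def prod_power_distrib)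
  moreover have "(P ^ (2 * g + 1))\<^sup>2 = P ^ (4 * g) * P\<^sup>2" by (simp add: power_mult[symmetric] power_add[symmetric] power2_eq_square algebra_simps)
  ultimately have "msubst id a (Kpoly g) = msubst id b (Kpoly g) * (\<Prod>i\<in>Bset g. c i ^ (4 * g))"
    unfolding Kpoly_eval[OF inj p] Kpoly_eval[OF injb p] d k by (simp add: mult_ac)
  moreover have "b = (\<lambda>i. (A * a i + B) / (C * a i + D))" by (simp add: fun_eq_iff b_def c_def)
  ultimately show ?thesis by (simp only: c_def)
qed

text \<open>Points with coinciding coordinates are reached by continuity: a_i + t i has distinct
  coordinates for all small nonzero t.\<close>

lemma Kpoly_Sinv: "Kpoly g \<in> Sinv (4 * g) (2 * g + 2)"
proof -
  have "msubst id a (Kpoly g) = msubst id (\<lambda>i. (of_real A * a i + of_real B) / (of_real C * a i + of_real D)) (Kpoly g)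
      * (\<Prod>i\<in>Bset g. (of_real C * a i + of_real D) ^ (4 * g))"
    if det: "A * D - B * C = 1" and nz: "\<And>i. i \<in> Bset g \<Longrightarrow> of_real C * a i + of_real D \<noteq> 0"
    for A B C D :: real and a :: "nat \<Rightarrow> complex"
  proof -
    have det': "complex_of_real A * of_real D - of_real B * of_real C = 1" using det by (metis of_real_1 of_real_diff of_real_mult)
    define x where "x t i = a i + of_real t * of_nat i" for t :: real and i :: nat
    have xlim: "((\<lambda>t. x t v) \<longlongrightarrow> a v) (at 0)" for v
    proof -
      have "((\<lambda>t. a v + of_real t * of_nat v) \<longlongrightarrow> a v + of_real 0 * of_nat v) (at 0)" by (intro tendsto_intros)
      then show ?thesis by (simp add: x_def)
    qed
    have clim: "((\<lambda>t. of_real C * x t v + of_real D) \<longlongrightarrow> of_real C * a v + of_real D) (at 0)" for v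
      by (intro tendsto_intros xlim)
    have evnz: "\<forall>\<^sub>F t in at 0. \<forall>i\<in>Bset g. of_real C * x t i + of_real D \<noteq> 0"
      using tendsto_imp_eventually_ne[OF clim nz] by (intro eventually_ball_finite) auto
    have evinj: "\<forall>\<^sub>F t in at 0. \<forall>i\<in>Bset g. \<forall>j\<in>Bset g. i \<noteq> j \<longrightarrow> x t i \<noteq> x t j"
    proof (intro eventually_ball_finite ballI finite_Bset)
      fix i j assume "i \<in> Bset g" "j \<in> Bset g"
      show "\<forall>\<^sub>F t in at 0. i \<noteq> j \<longrightarrow> x t i \<noteq> x t j"
      proof (cases "a i = a j")
        case True
        have "\<forall>\<^sub>F t in at (0::real). t \<noteq> 0" by (simp add: eventually_at_filter)
        then show ?thesis by eventually_elim (use True in \<open>auto simp: x_def\<close>)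
      next
        case False
        have "((\<lambda>t. x t i - x t j) \<longlongrightarrow> a i - a j) (at 0)" by (intro tendsto_diff xlim)
        then have "\<forall>\<^sub>F t in at 0. x t i - x t j \<noteq> 0" using False by (intro tendsto_imp_eventually_ne) auto
        then show ?thesis by eventually_elim auto
      qed
    qed
    have ev: "\<forall>\<^sub>F t in at 0. msubst id (\<lambda>i. (of_real A * x t i + of_real B) / (of_real C * x t i + of_real D)) (Kpoly g)
       * (\<Prod>i\<in>Bset g. (of_real C * x t i + of_real D) ^ (4 * g)) = msubst id (x t) (Kpoly g)"
      using evnz evinj
    proof eventually_elim
      case (elim t)
      have "inj_on (x t) (Bset g)" using elim(2) by (auto simp: inj_on_def)
      then show ?case using Kpoly_moebius_injective[OF det', of "x t" g] elim(1) by simp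
    qed
    \<comment> \<open>Outside \<open>Bset g\<close> the denominator may vanish; setting these
      coordinates to 0 makes every coordinate converge without changing the value of K.\<close>
    define y where "y t i = (if i \<in> Bset g then (of_real A * x t i + of_real B) / (of_real C * x t i + of_real D) else 0)" for t i
    define z where "z i = (if i \<in> Bset g then (of_real A * a i + of_real B) / (of_real C * a i + of_real D) else 0)" for i
    have yeq: "msubst id (\<lambda>i. (of_real A * x t i + of_real B) / (of_real C * x t i + of_real D)) (Kpoly g) = msubst id (y t) (Kpoly g)" for t
      using mvars_Kpoly[of g] by (intro msubst_cong) (auto simp: y_def)
    have zeq: "msubst id (\<lambda>i. (of_real A * a i + of_real B) / (of_real C * a i + of_real D)) (Kpoly g) = msubst id z (Kpoly g)"
      using mvars_Kpoly[of g] by (intro msubst_cong) (auto simp: z_def)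
    have ylim: "((\<lambda>t. y t v) \<longlongrightarrow> z v) (at 0)" for v
      using nz by (cases "v \<in> Bset g") (auto simp: y_def z_def intro!: tendsto_intros xlim)
    have "((\<lambda>t. msubst id (y t) (Kpoly g) * (\<Prod>i\<in>Bset g. (of_real C * x t i + of_real D) ^ (4 * g)))
      \<longlongrightarrow> msubst id z (Kpoly g) * (\<Prod>i\<in>Bset g. (of_real C * a i + of_real D) ^ (4 * g))) (at 0)"
      by (intro tendsto_mult tendsto_msubst ylim tendsto_prod tendsto_power clim)
    then have "((\<lambda>t. msubst id (x t) (Kpoly g)) \<longlongrightarrow> msubst id z (Kpoly g) * (\<Prod>i\<in>Bset g. (of_real C * a i + of_real D) ^ (4 * g))) (at 0)"
      using ev unfolding yeq by (rule Lim_transform_eventually)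
    moreover have "((\<lambda>t. msubst id (x t) (Kpoly g)) \<longlongrightarrow> msubst id a (Kpoly g)) (at 0)"
      by (intro tendsto_msubst xlim)
    ultimately show ?thesis unfolding zeq using tendsto_unique[of "at (0::real)"] by (metis at_neq_bot)
  qed
  then show ?thesis using mvars_Kpoly[of g] unfolding Sinv_def Bset_def by blast
qed

lemma Kpoly_1: "Kpoly 1 = Delta (Bset 1) * Delta (Uset 1) * Delta (Uset' 1)"
proof (rule Kpoly_eqI)
  have B: "Bset 1 = {1, 2, 3, 4}" by (auto simp: Bset_def)
  have U: "Uset 1 = {1, 3}" "Uset' 1 = {2, 4}" unfolding Uset_def Uset'_def B by auto
  note sets = B U
  show "mvars (Kpoly 1) \<subseteq> Bset 1" by (rule mvars_Kpoly)
  have m: "mvars (Delta S :: (nat, complex) mpol) \<subseteq> Bset 1" if "S \<subseteq> Bset 1" for S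
  proof -
    have "finite S" using that finite_Bset by (rule finite_subset)
    then show ?thesis unfolding Delta_pair_prod[OF \<open>finite S\<close>]
      using that mvars_Var_diff by (intro mvars_pair_prod) fastforce
  qed
  have "mvars (Delta (Bset 1) :: (nat, complex) mpol) \<subseteq> Bset 1" "mvars (Delta (Uset 1) :: (nat, complex) mpol) \<subseteq> Bset 1"
    "mvars (Delta (Uset' 1) :: (nat, complex) mpol) \<subseteq> Bset 1"
    by (rule m, force simp: Uset_def Uset'_def)+
  then show "mvars (Delta (Bset 1) * Delta (Uset 1) * Delta (Uset' 1) :: (nat, complex) mpol) \<subseteq> Bset 1"
    using mvars_mult[of "Delta (Bset 1) * Delta (Uset 1) :: (nat, complex) mpol" "Delta (Uset' 1)"]
      mvars_mult[of "Delta (Bset 1) :: (nat, complex) mpol" "Delta (Uset 1)"] by blast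
  fix a :: "nat \<Rightarrow> complex" assume inj: "inj_on a (Bset 1)"
  note h = ring_hom_simps[OF ring_hom_msubst[OF ring_hom_id], of a]
  have D: "msubst id a (Delta S) = pair_prod (\<lambda>i j. a j - a i) S" if "finite S" for S
    unfolding Delta_pair_prod[OF that] ring_hom_pair_prod[OF ring_hom_msubst[OF ring_hom_id]] h(6) msubst_Var[OF ring_hom_id] ..
  have s4: "{i \<in> {1, 2, 3, 4::nat}. i < 1} = {}" "{i \<in> {1, 2, 3, 4::nat}. i < 2} = {1}"
    "{i \<in> {1, 2, 3, 4::nat}. i < 3} = {1, 2}" "{i \<in> {1, 2, 3, 4::nat}. i < 4} = {1, 2, 3}"
    "{i \<in> {1, 3::nat}. i < 1} = {}" "{i \<in> {1, 3::nat}. i < 3} = {1}"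
    "{i \<in> {2, 4::nat}. i < 2} = {}" "{i \<in> {2, 4::nat}. i < 4} = {2}"
    by auto
  have g4: "(\<Prod>j\<in>{1, 2, 3, 4::nat}. G j) = G 1 * (G 2 * (G 3 * G 4))" for G :: "nat \<Rightarrow> complex" by simp
  have g2: "(\<Prod>j\<in>{1, 3::nat}. G j) = G 1 * G 3" "(\<Prod>j\<in>{2, 4::nat}. G j) = G 2 * G 4" for G :: "nat \<Rightarrow> complex" by simp_all
  have expand4: "pair_prod f {1, 2, 3, 4} = f 1 2 * (f 1 3 * f 2 3) * (f 1 4 * (f 2 4 * f 3 4))" for f :: "nat \<Rightarrow> nat \<Rightarrow> complex"
    unfolding pair_prod_def g4 s4 by (simp add: mult_ac)
  have expandU: "pair_prod f {1, 3} = f 1 3" "pair_prod f {2, 4} = f 2 4" for f :: "nat \<Rightarrow> nat \<Rightarrow> complex"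
    unfolding pair_prod_def g2 s4 by simp_all
  have ps: "path_sum w 1 {2, 3, 4} 1 = w 1 2 * (w 2 3 * (w 3 4 * w 4 1) + w 2 4 * (w 4 3 * w 3 1))
    + w 1 3 * (w 3 2 * (w 2 4 * w 4 1) + w 3 4 * (w 4 2 * w 2 1))
    + w 1 4 * (w 4 2 * (w 2 3 * w 3 1) + w 4 3 * (w 3 2 * w 2 1))" for w :: "nat \<Rightarrow> nat \<Rightarrow> complex"
    by (simp add: path_sum_rec insert_Diff_if)
  define u v w where "u = a 2 - a 1" and "v = a 3 - a 2" and "w = a 4 - a 3"
  have a: "a 2 = a 1 + u" "a 3 = a 1 + u + v" "a 4 = a 1 + u + v + w" by (simp_all add: u_def v_def w_def)
  have nz: "u \<noteq> 0" "v \<noteq> 0" "w \<noteq> 0" "u + v + w \<noteq> 0"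
    using inj unfolding sets by (auto simp: u_def v_def w_def inj_on_def)
  \<comment> \<open>There is one alternating 4-cycle on {1, 2, 3, 4}; its two orientations give the
    factor 2, which cancels the normalisation 1/2^g.\<close>
  have k: "kap a 1 (Bset 1) = 2 / (u * v * w * (u + v + w))"
  proof -
    have B1: "Bset 1 - {1} = {2, 3, 4}" unfolding sets by auto
    have w': "wt a 1 2 = - (1 / u)" "wt a 2 3 = - (1 / v)" "wt a 3 4 = - (1 / w)" "wt a 4 1 = 1 / (u + v + w)"
      "wt a 1 4 = - (1 / (u + v + w))" "wt a 4 3 = 1 / w" "wt a 3 2 = 1 / v" "wt a 2 1 = 1 / u" "wt a 2 4 = 0" "wt a 1 3 = 0" "wt a 4 2 = 0"
      by (simp_all add: wt_def u_def v_def w_def minus_divide_right)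
    show ?thesis unfolding kap_def B1 ps w' using nz by (simp add: field_simps)
  qed
  have d: "disc a (Bset 1) = (u * v * w * (u + v) * (v + w) * (u + v + w))\<^sup>2"
    unfolding disc_def sets expand4 a by (simp add: power_mult_distrib power2_commute[of "a 1"]) (simp add: power2_eq_square algebra_simps)
  have "msubst id a (Kpoly 1) = 1 / 2 * disc a (Bset 1) * kap a 1 (Bset 1)"
    using Kpoly_eval[OF inj, of 1] by (simp add: Bset_def)
  also have "\<dots> = u * v * w * (u + v)\<^sup>2 * (v + w)\<^sup>2 * (u + v + w)"
    unfolding d k using nz by (simp add: power2_eq_square divide_simps) 
  also have "\<dots> = msubst id a (Delta (Bset 1) * Delta (Uset 1) * Delta (Uset' 1))"
  proof -
    have "msubst id a (Delta (Bset 1) * Delta (Uset 1) * Delta (Uset' 1)) = pair_prod (\<lambda>i j. a j - a i) {1, 2, 3, 4} * pair_prod (\<lambda>i j. a j - a i) {1, 3} * pair_prod (\<lambda>i j. a j - a i) {2, 4}"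
      unfolding h(3) sets by (simp add: D)
    also have "\<dots> = u * v * w * (u + v)\<^sup>2 * (v + w)\<^sup>2 * (u + v + w)"
      unfolding expand4 expandU a by (simp add: power2_eq_square algebra_simps)
    finally show ?thesis by simp
  qed
  finally show "msubst id a (Kpoly 1) = msubst id a (Delta (Bset 1) * Delta (Uset 1) * Delta (Uset' 1))" .
qed

section \<open>Comparison with H\<close>

lemma psi_eval: "msubst id a (psi r e) = (a (e r) - a (e 1)) * (\<Prod>i\<in>{1..r - 1}. a (e i) - a (e (i + 1)))"
  unfolding psi_def psi'_def
  by (simp add: ring_hom_simps[OF ring_hom_msubst[OF ring_hom_id]] ring_hom_prod[OF ring_hom_msubst[OF ring_hom_id]] msubst_Var)

text \<open>Permutations in \<open>Eset\<close> are the alternating cycles with a marked odd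
  starting point. There are g + 1 such points and each contributes the same value, which explains
  the factor 1/(g+1) in H.\<close>

lemma sum_Eset:
  assumes inj: "inj_on a (Bset g)" and p: "p \<in> Bset g"
  shows "(\<Sum>e\<in>Eset (2 * g + 2). 1 / msubst id a (psi (2 * g + 2) e)) = - of_nat (g + 1) * kap a p (Bset g)"
proof -
  define r where "r = 2 * g + 2"
  have B: "Bset g = {1..r}" and r1: "r \<ge> 1" and er: "even r" by (auto simp: Bset_def r_def)
  define cyc where "cyc e = (\<Prod>i\<in>{1..r - 1}. wt a (e i) (e (i + 1))) * wt a (e r) (e 1)" for e :: "nat \<Rightarrow> nat"
  have fin: "finite {e. e permutes {1..r}}" by (simp add: finite_permutations)
  have "(\<Sum>e\<in>Eset r. 1 / msubst id a (psi r e)) = (\<Sum>e\<in>Eset r. of_bool (odd (e 1)) * cyc e)"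
  proof (intro sum.cong refl)
    fix e assume "e \<in> Eset r"
    then have "\<And>i. i \<in> {1..r} \<Longrightarrow> e i mod 2 = i mod 2" by (simp add: Eset_def)
    then have e: "even (e i) = even i" if "i \<in> {1..r}" for i
      using that by (simp only: even_iff_mod_2_eq_zero)
    have "odd (e 1)" using e[of 1] r1 by simp
    moreover have "wt a (e r) (e 1) = 1 / (a (e r) - a (e 1))" using e[of r] e[of 1] r1 er by (simp add: wt_def)
    moreover have "(\<Prod>i\<in>{1..r - 1}. wt a (e i) (e (i + 1))) = (\<Prod>i\<in>{1..r - 1}. 1 / (a (e i) - a (e (i + 1))))"
    proof (intro prod.cong refl)
      fix i assume "i \<in> {1..r - 1}"
      then have "i \<in> {1..r}" "i + 1 \<in> {1..r}" using r1 by auto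
      then show "wt a (e i) (e (i + 1)) = 1 / (a (e i) - a (e (i + 1)))"
        using e[of i] e[of "i + 1"] by (simp add: wt_def)
    qed
    ultimately show "1 / msubst id a (psi r e) = of_bool (odd (e 1)) * cyc e"
      unfolding psi_eval cyc_def by (simp add: prod_dividef)
  qed
  also have "\<dots> = (\<Sum>e | e permutes {1..r}. of_bool (odd (e 1)) * cyc e)"
  proof (rule sum.mono_neutral_left[OF fin])
    show "Eset r \<subseteq> {e. e permutes {1..r}}" by (auto simp: Eset_def)
    show "\<forall>e\<in>{e. e permutes {1..r}} - Eset r. of_bool (odd (e 1)) * cyc e = 0"
    proof
      fix e assume e: "e \<in> {e. e permutes {1..r}} - Eset r"
      show "of_bool (odd (e 1)) * cyc e = 0"
      proof (rule ccontr)
        assume "of_bool (odd (e 1)) * cyc e \<noteq> 0"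
        then have o: "odd (e 1)" and nz: "(\<Prod>i\<in>{1..r - 1}. wt a (e i) (e (i + 1))) \<noteq> 0"
          by (auto simp: cyc_def split: if_splits)
        have "even (e i) = even i" if "i \<in> {1..r}" for i
        proof -
          have "1 \<le> i \<Longrightarrow> i \<le> r \<Longrightarrow> even (e i) = even i" for i
          proof (induction i rule: dec_induct)
            case base
            then show ?case using o by simp
          next
            case (step n)
            have "wt a (e n) (e (n + 1)) \<noteq> 0" using nz step by auto
            then have "even (e n) \<noteq> even (e (Suc n))" by (metis wt_def Suc_eq_plus1)
            then show ?case using step by auto
          qed
          then show ?thesis using that by simp
        qed
        then have "e \<in> Eset r" using e unfolding Eset_def by (auto simp: mod2_eq_if)
        then show False using e by simp
      qed
    qed
  qed
  also have "\<dots> = (\<Sum>q\<in>{1..r}. of_bool (odd q) * path_sum (wt a) q ({1..r} - {q}) q)"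
    unfolding cyc_def by (rule sum_permutes_cycle[OF r1])
  also have "\<dots> = (\<Sum>q\<in>{1..r}. of_bool (odd q) * - kap a p (Bset g))"
  proof (intro sum.cong refl)
    fix q assume "q \<in> {1..r}"
    then have "kap a q (Bset g) = kap a p (Bset g)" using B p by (intro kap_independent[OF inj]) auto
    then show "of_bool (odd q) * path_sum (wt a) q ({1..r} - {q}) q = of_bool (odd q) * - kap a p (Bset g)"
      by (simp add: kap_def B)
  qed
  also have "\<dots> = (\<Sum>q\<in>{1..r}. of_bool (odd q)) * - kap a p (Bset g)" by (rule sum_distrib_right[symmetric])
  also have "(\<Sum>q\<in>{1..r}. of_bool (odd q) :: complex) = of_nat (card (Uset g))"
    by (simp add: Uset_def B Int_def)
  finally show ?thesis by (simp only: card_Uset r_def mult_minus_left mult_minus_right)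
qed

lemma ring_hom_of_nat: "ring_hom \<phi> \<Longrightarrow> \<phi> (of_nat n) = of_nat n"
  by (induction n) (auto simp: ring_hom_simps)

lemma ring_hom_2: "ring_hom \<phi> \<Longrightarrow> \<phi> 2 = 2"
  using ring_hom_of_nat[of \<phi> 2] by simp

lemma ring_hom_to_fract: "ring_hom (to_fract :: 'a::idom \<Rightarrow> 'a fract)"
  by (simp add: ring_hom_def)

lemma finite_Eset: "finite (Eset r)"
  by (rule finite_subset[of _ "{e. e permutes {1..r}}"]) (auto simp: Eset_def finite_permutations)

text \<open>Elements of the fraction field are not evaluated directly: the sum of 1/psi is written
  as \<open>N / Dn\<close>, the identity is cleared of denominators and checked as a polynomial
  identity at points, and only then transported to the fraction field.\<close>

lemma Kpoly_Hrat: "to_fract (Kpoly g) = Hrat g"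
proof -
  define r where "r = 2 * g + 2"
  define N where "N = (\<Sum>e\<in>Eset r. \<Prod>e'\<in>Eset r - {e}. psi r e')"
  define Dn where "Dn = (\<Prod>e\<in>Eset r. psi r e)"
  have B: "Bset g = {1..r}" by (simp add: Bset_def r_def)
  note hom = ring_hom_msubst[OF ring_hom_id]
  have psi_nz: "msubst id a (psi r e) \<noteq> 0" if e: "e \<in> Eset r" and inj: "inj_on a (Bset g)" for a e
  proof -
    have perm: "e permutes {1..r}" using e by (simp add: Eset_def)
    have ne: "a (e i) \<noteq> a (e j)" if "i \<in> {1..r}" "j \<in> {1..r}" "i \<noteq> j" for i j
    proof -
      have "e i \<in> Bset g" "e j \<in> Bset g"
        using permutes_in_image[OF perm, of i] permutes_in_image[OF perm, of j] that unfolding B by blast+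
      moreover have "e i \<noteq> e j" using permutes_inj[OF perm] that(3) by (meson injD)
      ultimately show ?thesis using inj_onD[OF inj] by blast
    qed
    have "a (e i) - a (e (i + 1)) \<noteq> 0" if "i \<in> {1..r - 1}" for i
    proof -
      have "i \<in> {1..r}" "i + 1 \<in> {1..r}" "i \<noteq> i + 1" using that by (auto simp: r_def)
      then show ?thesis using ne by simp
    qed
    moreover have "a (e r) - a (e 1) \<noteq> 0" using ne[of r 1] by (simp add: r_def)
    ultimately show ?thesis unfolding psi_eval by simp
  qed
  have mpsi: "mvars (psi r e) \<subseteq> Bset g" if e: "e \<in> Eset r" for e
  proof -
    have perm: "e permutes {1..r}" using e by (simp add: Eset_def)
    have im: "e i \<in> Bset g" if "i \<in> {1..r}" for i using permutes_in_image[OF perm] that by (simp add: B)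
    have "mvars (Var (e i) - Var (e (i + 1)) :: (nat, complex) mpol) \<subseteq> Bset g" if "i \<in> {1..r - 1}" for i
    proof -
      have "i \<in> {1..r}" "i + 1 \<in> {1..r}" using that by (auto simp: r_def)
      then have "{e i, e (i + 1)} \<subseteq> Bset g" using im by blast
      then show ?thesis using mvars_Var_diff[where 'c = complex, of "e i" "e (i + 1)"] by blast
    qed
    then have "mvars (psi' r e) \<subseteq> Bset g" unfolding psi'_def by (rule mvars_prod)
    moreover have "mvars (Var (e r) - Var (e 1) :: (nat, complex) mpol) \<subseteq> Bset g"
    proof -
      have "{e r, e 1} \<subseteq> Bset g" using im[of r] im[of 1] by (simp add: r_def)
      then show ?thesis using mvars_Var_diff[where 'c = complex, of "e r" "e 1"] by blast
    qed
    ultimately show ?thesis unfolding psi_def using mvars_mult[of "Var (e r) - Var (e 1)" "psi' r e"] by blast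
  qed
  have psi0: "psi r e \<noteq> 0" if "e \<in> Eset r" for e
    using psi_nz[OF that, of of_nat] by (auto simp: inj_on_def)
  have id: "2 ^ g * of_nat (g + 1) * Kpoly g * Dn = - ((Delta (Bset g))\<^sup>2 * N)"
  proof (rule Kpoly_eqI)
    have mc: "mvars (2 ^ g * of_nat (g + 1) :: (nat, complex) mpol) = {}"
    proof -
      have "(2 ^ g * of_nat (g + 1) :: (nat, complex) mpol) = Const (2 ^ g * of_nat (g + 1))"
        by (simp only: ring_hom_simps[OF ring_hom_Const] ring_hom_2[OF ring_hom_Const] ring_hom_of_nat[OF ring_hom_Const])
      then show ?thesis by simp
    qed
    have mD: "mvars Dn \<subseteq> Bset g" unfolding Dn_def by (intro mvars_prod mpsi)
    have mN: "mvars N \<subseteq> Bset g" unfolding N_def by (intro mvars_sum mvars_prod mpsi) auto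
    have mDelta: "mvars (Delta (Bset g) :: (nat, complex) mpol) \<subseteq> Bset g"
      unfolding Delta_pair_prod[OF finite_Bset]
    proof (rule mvars_pair_prod)
      fix i j assume "i \<in> Bset g" "j \<in> Bset g"
      then have "{j, i} \<subseteq> Bset g" by simp
      then show "mvars (Var j - Var i :: (nat, complex) mpol) \<subseteq> Bset g"
        using mvars_Var_diff[where 'c = complex, of j i] by blast
    qed
    show "mvars (2 ^ g * of_nat (g + 1) * Kpoly g * Dn) \<subseteq> Bset g"
      using mvars_mult[of "2 ^ g * of_nat (g + 1) * Kpoly g" Dn] mvars_mult[of "2 ^ g * of_nat (g + 1)" "Kpoly g"] mc mD mvars_Kpoly[of g] by blast
    show "mvars (- ((Delta (Bset g))\<^sup>2 * N)) \<subseteq> Bset g"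
      unfolding mvars_uminus using mvars_mult[of "(Delta (Bset g))\<^sup>2" N] mvars_power[of "Delta (Bset g) :: (nat, complex) mpol" 2] mN mDelta by blast
    fix a :: "nat \<Rightarrow> complex" assume inj: "inj_on a (Bset g)"
    have p: "1 \<in> Bset g" by (simp add: Bset_def)
    define x where "x e = msubst id a (psi r e)" for e
    have x0: "x e \<noteq> 0" if "e \<in> Eset r" for e using psi_nz[OF that inj] by (simp add: x_def)
    have D: "msubst id a ((Delta (Bset g))\<^sup>2) = disc a (Bset g)"
    proof -
      have "msubst id a ((Delta (Bset g))\<^sup>2) = (pair_prod (\<lambda>i j. a j - a i) (Bset g))\<^sup>2"
        unfolding Delta_pair_prod[OF finite_Bset] ring_hom_simps(7)[OF hom] ring_hom_pair_prod[OF hom] ring_hom_simps(6)[OF hom] msubst_Var[OF ring_hom_id] ..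
      also have "\<dots> = disc a (Bset g)" unfolding disc_def pair_prod_power[symmetric] by (simp add: power2_commute)
      finally show ?thesis .
    qed
    have Dn: "msubst id a Dn = (\<Prod>e\<in>Eset r. x e)" unfolding Dn_def x_def by (rule ring_hom_prod[OF hom])
    have Nn: "msubst id a N = (\<Sum>e\<in>Eset r. \<Prod>e'\<in>Eset r - {e}. x e')"
      unfolding N_def x_def ring_hom_sum[OF hom] ring_hom_prod[OF hom] ..
    have "(\<Sum>e\<in>Eset r. \<Prod>e'\<in>Eset r - {e}. x e') = (\<Sum>e\<in>Eset r. (\<Prod>e\<in>Eset r. x e) * (1 / x e))"
    proof (intro sum.cong refl)
      fix e assume e: "e \<in> Eset r"
      show "(\<Prod>e'\<in>Eset r - {e}. x e') = (\<Prod>e\<in>Eset r. x e) * (1 / x e)"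
        using prod.remove[OF finite_Eset e, of x] x0[OF e] by simp
    qed
    also have "\<dots> = (\<Prod>e\<in>Eset r. x e) * (- of_nat (g + 1) * kap a 1 (Bset g))"
    proof -
      have "(\<Sum>e\<in>Eset r. 1 / x e) = - of_nat (g + 1) * kap a 1 (Bset g)"
        using sum_Eset[OF inj p] unfolding x_def r_def .
      then show ?thesis by (simp only: sum_distrib_left[symmetric])
    qed
    finally have N': "msubst id a N = (\<Prod>e\<in>Eset r. x e) * (- of_nat (g + 1) * kap a 1 (Bset g))" unfolding Nn .
    have aux: "t * n * (1 / t * d * k) * X = - (d * (X * (- n * k)))" if "t \<noteq> 0" for t n d k X :: complex
      using that by simp
    show "msubst id a (2 ^ g * of_nat (g + 1) * Kpoly g * Dn) = msubst id a (- ((Delta (Bset g))\<^sup>2 * N))"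
      unfolding ring_hom_simps(3,5)[OF hom] ring_hom_simps(7)[OF hom, of a 2 g] ring_hom_2[OF hom] ring_hom_of_nat[OF hom] D Dn N' Kpoly_eval[OF inj p]
      by (rule aux) simp
  qed
  note F = ring_hom_to_fract[where 'a = "(nat, complex) mpol"]
  have Dn0: "to_fract Dn \<noteq> 0" unfolding Dn_def using psi0 finite_Eset by simp
  have "(\<Sum>e\<in>Eset r. - 1 / to_fract (psi r e)) = - (to_fract N / to_fract Dn)"
  proof -
    have "to_fract N / to_fract Dn = (\<Sum>e\<in>Eset r. (\<Prod>e'\<in>Eset r - {e}. to_fract (psi r e')) / to_fract Dn)"
      unfolding N_def ring_hom_sum[OF F] ring_hom_prod[OF F] by (rule sum_divide_distrib)
    also have "\<dots> = (\<Sum>e\<in>Eset r. 1 / to_fract (psi r e))"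
    proof (intro sum.cong refl)
      fix e assume e: "e \<in> Eset r"
      have "to_fract Dn = to_fract (psi r e) * (\<Prod>e'\<in>Eset r - {e}. to_fract (psi r e'))"
        unfolding Dn_def ring_hom_prod[OF F] by (rule prod.remove[OF finite_Eset e])
      then show "(\<Prod>e'\<in>Eset r - {e}. to_fract (psi r e')) / to_fract Dn = 1 / to_fract (psi r e)"
        using Dn0 by auto
    qed
    finally show ?thesis by (simp add: sum_negf)
  qed
  then have H: "Hrat g = 1 / 2 ^ g * (1 / of_nat (g + 1)) * (to_fract (Delta (Bset g)))\<^sup>2 * - (to_fract N / to_fract Dn)"
    unfolding Hrat_def r_def by simp
  have "2 ^ g * of_nat (g + 1) * to_fract (Kpoly g) * to_fract Dn = - ((to_fract (Delta (Bset g)))\<^sup>2 * to_fract N)"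
    using arg_cong[OF id, of to_fract] unfolding ring_hom_simps(3,5)[OF F] ring_hom_simps(7)[OF F, of 2 g] ring_hom_simps(7)[OF F, of "Delta (Bset g)" 2] ring_hom_2[OF F] ring_hom_of_nat[OF F] .
  moreover have "(2 :: (nat, complex) mpol fract) ^ g \<noteq> 0" "(of_nat (g + 1) :: (nat, complex) mpol fract) \<noteq> 0"
  proof -
    have "(of_nat n :: (nat, complex) mpol fract) \<noteq> 0" if "n \<noteq> 0" for n
    proof -
      have "(of_nat n :: (nat, complex) mpol) \<noteq> 0" using that by simp
      then have "to_fract (of_nat n :: (nat, complex) mpol) \<noteq> 0" by simp
      then show ?thesis by (simp only: ring_hom_of_nat[OF F] not_False_eq_True)
    qed
    from this[of 2] this[of "g + 1"] show "(2 :: (nat, complex) mpol fract) ^ g \<noteq> 0" "(of_nat (g + 1) :: (nat, complex) mpol fract) \<noteq> 0" by simp_all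
  qed
  moreover have "k = 1 / t * (1 / n) * d * - (m / e)" if "t * n * k * e = - (d * m)" "t \<noteq> 0" "n \<noteq> 0" "e \<noteq> 0" for t n k e d m :: "(nat, complex) mpol fract"
  proof -
    have "t * n * k * e / (t * n * e) = k" using that(2-4) by simp
    then have "k = - (d * m) / (t * n * e)" unfolding that(1) by simp
    then show ?thesis by simp
  qed
  ultimately show ?thesis unfolding H using Dn0 by blast
qed

subsection \<open>The star map and the degeneration of K\<close>

lemma poly_over_power_tendsto:
  fixes P :: "complex poly"
  assumes "degree P \<le> m"
  shows "((\<lambda>t. poly P (of_real t) / of_real t ^ m) \<longlongrightarrow> coeff P m) at_top"
proof -
  have trm: "((\<lambda>t. coeff P i * (complex_of_real t ^ i / of_real t ^ m)) \<longlongrightarrow> (if i = m then coeff P m else 0)) at_top"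
    if "i \<le> m" for i
  proof (cases "i = m")
    case True
    have "\<forall>\<^sub>F t in at_top. coeff P m = coeff P i * (complex_of_real t ^ i / of_real t ^ m)"
      using eventually_gt_at_top[of 0] by eventually_elim (simp add: True)
    then show ?thesis using True by (auto intro: Lim_transform_eventually[OF tendsto_const])
  next
    case False
    then have im: "m - i > 0" "m = i + (m - i)" using that by auto
    have "((\<lambda>t. (1 / complex_of_real t) ^ (m - i)) \<longlongrightarrow> 0 ^ (m - i)) at_top"
      using tendsto_inverse_linear[of 0] by (intro tendsto_power) simp
    then have "((\<lambda>t. coeff P i * (1 / complex_of_real t) ^ (m - i)) \<longlongrightarrow> coeff P i * 0) at_top"
      using im(1) by (intro tendsto_mult tendsto_const) (simp add: power_0_left)
    moreover have "\<forall>\<^sub>F t in at_top. coeff P i * (1 / complex_of_real t) ^ (m - i) = coeff P i * (complex_of_real t ^ i / of_real t ^ m)"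
      using eventually_gt_at_top[of 0]
    proof eventually_elim
      case (elim t)
      have "complex_of_real t ^ m = of_real t ^ i * of_real t ^ (m - i)" using im(2) by (metis power_add)
      then show ?case using elim by (simp add: power_one_over field_simps)
    qed
    ultimately show ?thesis using False by (auto intro: Lim_transform_eventually)
  qed
  have "((\<lambda>t. \<Sum>i\<le>m. coeff P i * (complex_of_real t ^ i / of_real t ^ m)) \<longlongrightarrow> (\<Sum>i\<le>m. if i = m then coeff P m else 0)) at_top"
    by (intro tendsto_sum trm) simp
  moreover have "poly P x = (\<Sum>i\<le>m. coeff P i * x ^ i)" for x
    unfolding poly_altdef using assms by (intro sum.mono_neutral_left) (auto simp: coeff_eq_0)
  ultimately show ?thesis by (simp add: sum_divide_distrib)
qed

text \<open>Were the degree larger than n, dividing by t to the full degree would give the limit 0,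
  although that limit is the leading coefficient.\<close>

lemma poly_limit_coeff:
  fixes P :: "complex poly"
  assumes lim: "((\<lambda>t. poly P (of_real t) / of_real t ^ n) \<longlongrightarrow> L) at_top"
  shows "degree P \<le> n \<and> coeff P n = L"
proof -
  have deg: "degree P \<le> n"
  proof (rule ccontr)
    assume "\<not> degree P \<le> n"
    then have d: "degree P - n > 0" "degree P = n + (degree P - n)" by auto
    have "((\<lambda>t. (1 / complex_of_real t) ^ (degree P - n)) \<longlongrightarrow> 0 ^ (degree P - n)) at_top"
      using tendsto_inverse_linear[of 0] by (intro tendsto_power) simp
    from tendsto_mult[OF lim this] have "((\<lambda>t. poly P (of_real t) / of_real t ^ n * (1 / complex_of_real t) ^ (degree P - n)) \<longlongrightarrow> 0) at_top"
      using d(1) by (simp add: power_0_left)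
    moreover have "poly P (of_real t) / of_real t ^ n * (1 / complex_of_real t) ^ (degree P - n) = poly P (of_real t) / of_real t ^ degree P" for t
    proof -
      have "complex_of_real t ^ degree P = of_real t ^ n * of_real t ^ (degree P - n)" using d(2) by (metis power_add)
      then show ?thesis by (simp add: power_one_over)
    qed
    ultimately have "((\<lambda>t. poly P (of_real t) / of_real t ^ degree P) \<longlongrightarrow> 0) at_top" by simp
    then have "coeff P (degree P) = 0" using poly_over_power_tendsto[of P "degree P"] tendsto_unique[OF trivial_limit_at_top_linorder] by blast
    then show False using d by (simp add: leading_coeff_0_iff)
  qed
  then show ?thesis using poly_over_power_tendsto[OF deg] lim tendsto_unique[OF trivial_limit_at_top_linorder] by blast
qed

lemma finite_mvars: "finite (mvars f)"
  by (simp add: mvars_def)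

definition at_nat :: "('v \<Rightarrow> nat) \<Rightarrow> ('v, complex) mpol \<Rightarrow> complex" where
  "at_nat y = msubst id (\<lambda>v. of_nat (y v))"

lemma ring_hom_at_nat [simp]: "ring_hom (at_nat y)"
  by (simp add: at_nat_def)

lemma mpol_zero_at_nat:
  fixes f :: "('v, complex) mpol"
  assumes "finite Vs" "\<And>y. inj_on y Vs \<Longrightarrow> (\<And>v. 0 < y v) \<Longrightarrow> at_nat y f = 0"
  shows "f = 0"
proof (rule mpol_eq_zeroI[of "Vs \<union> mvars f"])
  fix y :: "'v \<Rightarrow> nat" assume "inj_on y (Vs \<union> mvars f)" "\<And>v. 0 < y v"
  then show "msubst id (\<lambda>v. of_nat (y v)) f = 0"
    using assms(2)[of y] inj_on_subset[of y "Vs \<union> mvars f" Vs] by (simp add: at_nat_def)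
qed (use assms(1) finite_mvars in auto)

lemma mpol_eq_at_nat:
  fixes f h :: "('v, complex) mpol"
  assumes "finite Vs" "\<And>y. inj_on y Vs \<Longrightarrow> (\<And>v. 0 < y v) \<Longrightarrow> at_nat y f = at_nat y h"
  shows "f = h"
proof -
  have "f - h = 0"
    by (rule mpol_zero_at_nat[OF assms(1)]) (use assms(2) in \<open>simp add: ring_hom_simps(6)[OF ring_hom_at_nat]\<close>)
  then show ?thesis by simp
qed

lemma mpol_poly_limit_degree:
  fixes P :: "('v, complex) mpol poly"
  assumes "finite Vs"
    and "\<And>y. inj_on y Vs \<Longrightarrow> (\<And>v. 0 < y v) \<Longrightarrow>
      ((\<lambda>t. poly (map_poly (at_nat y) P) (of_real t) / of_real t ^ n) \<longlongrightarrow> L y) at_top"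
  shows "degree P \<le> n" "\<And>y. inj_on y Vs \<Longrightarrow> (\<And>v. 0 < y v) \<Longrightarrow> at_nat y (coeff P n) = L y"
proof -
  have c: "coeff (map_poly (at_nat y) P) k = at_nat y (coeff P k)" for y k
    by (simp add: coeff_map_poly ring_hom_simps(4)[OF ring_hom_at_nat])
  show "degree P \<le> n"
  proof (rule degree_le, intro allI impI)
    fix k assume k: "n < k"
    show "coeff P k = 0"
    proof (rule mpol_zero_at_nat[OF assms(1)])
      fix y :: "'v \<Rightarrow> nat" assume y: "inj_on y Vs" "\<And>v. 0 < y v"
      have "degree (map_poly (at_nat y) P) \<le> n" using poly_limit_coeff[OF assms(2)[OF y]] by blast
      then show "at_nat y (coeff P k) = 0" using k c[of y k] by (metis coeff_eq_0 le_less_trans)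
    qed
  qed
  show "at_nat y (coeff P n) = L y" if "inj_on y Vs" "\<And>v. 0 < y v" for y
    using poly_limit_coeff[OF assms(2)[OF that]] c[of y n] by simp
qed

section \<open>The star map on invariants and its injectivity\<close>

definition last_poly :: "nat \<Rightarrow> (nat, complex) mpol \<Rightarrow> (nat, complex) mpol poly" where
  "last_poly r f = msubst (\<lambda>c. [:Const c:]) (\<lambda>i. if i = r then [:0, 1:] else [:Var i:]) f"

lemma star_last_poly: "star r f = lead_coeff (last_poly r f)"
  by (simp add: star_def last_poly_def)

lemma last_poly_eval:
  "poly (map_poly (msubst id a) (last_poly r f)) t = msubst id (a(r := t)) f"
proof -
  note hom = ring_hom_msubst[OF ring_hom_id, of a]
  have "poly (map_poly (msubst id a) (last_poly r f)) t
    = msubst (\<lambda>c. poly (map_poly (msubst id a) [:Const c:]) t)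
        (\<lambda>i. poly (map_poly (msubst id a) (if i = r then [:0, 1:] else [:Var i:])) t) f"
    unfolding last_poly_def by (rule hom_msubst[OF ring_hom_poly_map[OF hom]])
  also have "(\<lambda>c. poly (map_poly (msubst id a) [:Const c:]) t) = id"
    by (simp add: fun_eq_iff map_poly_const[OF hom] msubst_Const)
  also have "(\<lambda>i. poly (map_poly (msubst id a) (if i = r then [:0, 1:] else [:Var i:])) t) = a(r := t)"
    by (auto simp: fun_eq_iff map_poly_const[OF hom] map_poly_linear[OF hom] msubst_Var ring_hom_simps[OF hom])
  finally show ?thesis .
qed

lemma SinvD:
  fixes A B C D :: real
  assumes "f \<in> Sinv w r" "A * D - B * C = 1" "\<forall>i\<in>{1..r}. of_real C * a i + of_real D \<noteq> 0"
  shows "msubst id a f = msubst id (\<lambda>i. (of_real A * a i + of_real B) / (of_real C * a i + of_real D)) f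
    * (\<Prod>i\<in>{1..r}. (of_real C * a i + of_real D) ^ w)"
  using assms unfolding Sinv_def by blast

text \<open>The inversion \<open>z \<mapsto> -1/z\<close> moves \<open>a\<^sub>r = \<infinity>\<close> to \<open>a\<^sub>r = 0\<close>.\<close>

lemma Sinv_last_limit:
  assumes f: "f \<in> Sinv w r" and r: "r \<ge> 1" and nz: "\<And>i. i \<in> {1..<r} \<Longrightarrow> a i \<noteq> 0"
  shows "((\<lambda>t. msubst id (a(r := of_real t)) f / of_real t ^ w)
    \<longlongrightarrow> (\<Prod>i\<in>{1..<r}. a i ^ w) * msubst id (\<lambda>i. if i = r then 0 else - 1 / a i) f) at_top"
proof -
  have split: "{1..r} = insert r {1..<r}" using r by auto
  have "((\<lambda>t. - 1 / complex_of_real t) \<longlongrightarrow> 0) at_top"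
    using tendsto_minus[OF tendsto_inverse_linear[of 0]] by simp
  then have "((\<lambda>t. if i = r then - 1 / complex_of_real t else - 1 / a i) \<longlongrightarrow> (if i = r then 0 else - 1 / a i)) at_top" for i
    by (cases "i = r") simp_all
  then have "((\<lambda>t. (\<Prod>i\<in>{1..<r}. a i ^ w) * msubst id (\<lambda>i. if i = r then - 1 / complex_of_real t else - 1 / a i) f)
    \<longlongrightarrow> (\<Prod>i\<in>{1..<r}. a i ^ w) * msubst id (\<lambda>i. if i = r then 0 else - 1 / a i) f) at_top"
    by (intro tendsto_mult tendsto_const tendsto_msubst)
  moreover have "\<forall>\<^sub>F t in at_top. (\<Prod>i\<in>{1..<r}. a i ^ w) * msubst id (\<lambda>i. if i = r then - 1 / complex_of_real t else - 1 / a i) f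
     = msubst id (a(r := of_real t)) f / of_real t ^ w"
    using eventually_gt_at_top[of 0]
  proof eventually_elim
    case (elim t)
    let ?b = "a(r := complex_of_real t)"
    have "\<forall>i\<in>{1..r}. of_real 1 * ?b i + of_real 0 \<noteq> 0" using nz elim by auto
    then have "msubst id ?b f = msubst id (\<lambda>i. (of_real 0 * ?b i + of_real (- 1)) / (of_real 1 * ?b i + of_real 0)) f
        * (\<Prod>i\<in>{1..r}. (of_real 1 * ?b i + of_real 0) ^ w)"
      by (intro SinvD[OF f]) simp_all
    also have "(\<lambda>i. (of_real 0 * ?b i + of_real (- 1)) / (of_real 1 * ?b i + of_real 0)) = (\<lambda>i. if i = r then - 1 / complex_of_real t else - 1 / a i)"
      by (auto simp: fun_eq_iff)
    also have "(\<Prod>i\<in>{1..r}. (of_real 1 * ?b i + of_real 0) ^ w) = of_real t ^ w * (\<Prod>i\<in>{1..<r}. a i ^ w)"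
      unfolding split by simp
    finally have e: "msubst id ?b f = msubst id (\<lambda>i. if i = r then - 1 / complex_of_real t else - 1 / a i) f * (of_real t ^ w * (\<Prod>i\<in>{1..<r}. a i ^ w))" .
    show ?case unfolding e using elim by (simp add: mult_ac)
  qed
  ultimately show ?thesis by (rule Lim_transform_eventually)
qed

lemma Sinv_last_coeff:
  assumes f: "f \<in> Sinv w r" and r: "r \<ge> 1"
  shows "degree (last_poly r f) \<le> w"
    and "\<And>a. (\<And>i. i \<in> {1..<r} \<Longrightarrow> a i \<noteq> 0) \<Longrightarrow>
      msubst id a (coeff (last_poly r f) w) = (\<Prod>i\<in>{1..<r}. a i ^ w) * msubst id (\<lambda>i. if i = r then 0 else - 1 / a i) f"
proof -
  show "degree (last_poly r f) \<le> w"
  proof (rule mpol_poly_limit_degree(1)[of "{}"])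
    fix y :: "nat \<Rightarrow> nat" assume "\<And>v. 0 < y v"
    then show "((\<lambda>t. poly (map_poly (at_nat y) (last_poly r f)) (of_real t) / of_real t ^ w)
      \<longlongrightarrow> (\<Prod>i\<in>{1..<r}. of_nat (y i) ^ w) * msubst id (\<lambda>i. if i = r then 0 else - 1 / of_nat (y i)) f) at_top"
      unfolding at_nat_def last_poly_eval by (intro Sinv_last_limit[OF f r]) simp
  qed simp
  fix a :: "nat \<Rightarrow> complex" assume a: "\<And>i. i \<in> {1..<r} \<Longrightarrow> a i \<noteq> 0"
  have "coeff (map_poly (msubst id a) (last_poly r f)) w = (\<Prod>i\<in>{1..<r}. a i ^ w) * msubst id (\<lambda>i. if i = r then 0 else - 1 / a i) f"
    by (rule conjunct2[OF poly_limit_coeff], unfold last_poly_eval, rule Sinv_last_limit[OF f r a])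
  then show "msubst id a (coeff (last_poly r f) w) = (\<Prod>i\<in>{1..<r}. a i ^ w) * msubst id (\<lambda>i. if i = r then 0 else - 1 / a i) f"
    by (simp add: coeff_map_poly)
qed

text \<open>Translation takes b_r to 0 and inversion takes it on to infinity, so the coefficient of
  a_r^w determines the invariant. The point is real because the translation by -b_r has to be a real
  Moebius map.\<close>

lemma Sinv_reconstruct_coeff:
  fixes b :: "nat \<Rightarrow> real"
  assumes f: "f \<in> Sinv w r" and r: "r \<ge> 1" and ne: "\<And>i. i \<in> {1..<r} \<Longrightarrow> b i \<noteq> b r"
  shows "msubst id (\<lambda>i. of_real (b i)) f =
    (\<Prod>i\<in>{1..<r}. of_real (b r - b i) ^ w) * msubst id (\<lambda>i. of_real (1 / (b r - b i))) (coeff (last_poly r f) w)"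
proof -
  have mv: "mvars f \<subseteq> {1..r}" using f by (simp add: Sinv_def)
  have "\<forall>i\<in>{1..r}. of_real 0 * complex_of_real (b i) + of_real 1 \<noteq> 0" by simp
  then have "msubst id (\<lambda>i. of_real (b i)) f = msubst id (\<lambda>i. (of_real 1 * complex_of_real (b i) + of_real (- b r)) / (of_real 0 * of_real (b i) + of_real 1)) f
        * (\<Prod>i\<in>{1..r}. (of_real 0 * complex_of_real (b i) + of_real 1) ^ w)"
    by (intro SinvD[OF f]) simp_all
  then have 1: "msubst id (\<lambda>i. of_real (b i)) f = msubst id (\<lambda>i. of_real (b i - b r)) f" by simp
  also have "\<dots> = msubst id (\<lambda>i. if i = r then 0 else - 1 / complex_of_real (1 / (b r - b i))) f"
    using mv by (intro msubst_cong) (auto simp: field_simps)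
  finally have 2: "msubst id (\<lambda>i. of_real (b i)) f = msubst id (\<lambda>i. if i = r then 0 else - 1 / complex_of_real (1 / (b r - b i))) f" .
  have "msubst id (\<lambda>i. of_real (1 / (b r - b i))) (coeff (last_poly r f) w)
    = (\<Prod>i\<in>{1..<r}. of_real (1 / (b r - b i)) ^ w) * msubst id (\<lambda>i. if i = r then 0 else - 1 / complex_of_real (1 / (b r - b i))) f"
  proof (rule Sinv_last_coeff(2)[OF f r])
    fix i assume "i \<in> {1..<r}"
    from ne[OF this] show "complex_of_real (1 / (b r - b i)) \<noteq> 0" by (simp del: of_real_diff)
  qed
  moreover have "(\<Prod>i\<in>{1..<r}. complex_of_real (b r - b i) ^ w) * (\<Prod>i\<in>{1..<r}. of_real (1 / (b r - b i)) ^ w) = 1"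
    unfolding prod.distrib[symmetric]
  proof (rule prod.neutral, rule ballI)
    fix i assume "i \<in> {1..<r}"
    from ne[OF this] have "b r - b i \<noteq> 0" by simp
    then have "complex_of_real (b r - b i) * of_real (1 / (b r - b i)) = 1"
      unfolding of_real_mult[symmetric] by simp
    then show "complex_of_real (b r - b i) ^ w * of_real (1 / (b r - b i)) ^ w = 1"
      unfolding power_mult_distrib[symmetric] by simp
  qed
  ultimately show ?thesis unfolding 2 by (simp only: mult.assoc[symmetric] mult_1_left)
qed

text \<open>The degree in the last variable is at most the weight, and it could only drop below w if
  the coefficient at w vanished; but then reconstruction gives f = 0.\<close>

lemma Sinv_star:
  assumes f: "f \<in> Sinv w r" and r: "r \<ge> 1"
  shows "star r f = coeff (last_poly r f) w"
proof (cases "coeff (last_poly r f) w = 0")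
  case True
  have "f = 0"
  proof (rule mpol_zero_at_nat[of "{1..r}"])
    fix y :: "nat \<Rightarrow> nat" assume y: "inj_on y {1..r}"
    have ne: "real (y i) \<noteq> real (y r)" if "i \<in> {1..<r}" for i
    proof
      assume "real (y i) = real (y r)"
      then have "i = r" using inj_onD[OF y, of i r] that r by simp
      then show False using that by simp
    qed
    have "msubst id (\<lambda>i. of_real (real (y i))) f = 0"
      using Sinv_reconstruct_coeff[OF f r, of "\<lambda>i. real (y i)", OF ne] unfolding True msubst_zero mult_zero_right .
    then show "at_nat y f = 0" unfolding at_nat_def of_real_of_nat_eq .
  qed simp
  then show ?thesis by (simp add: star_last_poly last_poly_def)
next
  case False
  then have "degree (last_poly r f) = w" using Sinv_last_coeff(1)[OF f r] le_degree by (metis le_antisym)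
  then show ?thesis by (simp add: star_last_poly)
qed

lemma Sinv_reconstruct:
  fixes b :: "nat \<Rightarrow> real"
  assumes "f \<in> Sinv w r" "r \<ge> 1" "\<And>i. i \<in> {1..<r} \<Longrightarrow> b i \<noteq> b r"
  shows "msubst id (\<lambda>i. of_real (b i)) f =
    (\<Prod>i\<in>{1..<r}. of_real (b r - b i) ^ w) * msubst id (\<lambda>i. of_real (1 / (b r - b i))) (star r f)"
  unfolding Sinv_star[OF assms(1,2)] using assms(3) by (rule Sinv_reconstruct_coeff[OF assms(1,2), of b])

lemma tensor_eval: "msubst id x (tensor f h) = msubst id (\<lambda>i. x (Inl i)) f * msubst id (\<lambda>i. x (Inr i)) h"
  by (simp add: tensor_def ring_hom_simps(3)[OF ring_hom_msubst[OF ring_hom_id]] msubst_rename)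

text \<open>Reconstruct both tensor factors of every summand. The prefactor \<open>k\<close> and the
  point \<open>z\<close> are the same for all summands, so the value of \<open>X\<close> is
  expressed by \<open>Y\<close> alone, whichever decomposition was chosen.\<close>

lemma star_tensor_unique:
  assumes "star_tensor w1 r1 w2 r2 X Y" "star_tensor w1 r1 w2 r2 X' Y" "r1 \<ge> 1" "r2 \<ge> 1"
  shows "X = X'"
proof (rule mpol_eq_at_nat[of "Inl ` {1..r1} \<union> Inr ` {1..r2}"])
  fix y :: "nat + nat \<Rightarrow> nat" assume inj: "inj_on y (Inl ` {1..r1} \<union> Inr ` {1..r2})"
  define b c where "b i = real (y (Inl i))" and "c i = real (y (Inr i))" for i
  have bne: "b i \<noteq> b r1" if "i \<in> {1..<r1}" for i
    using inj_onD[OF inj, of "Inl i" "Inl r1"] that assms(3) by (auto simp: b_def)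
  have cne: "c i \<noteq> c r2" if "i \<in> {1..<r2}" for i
    using inj_onD[OF inj, of "Inr i" "Inr r2"] that assms(4) by (auto simp: c_def)
  define z where "z = case_sum (\<lambda>i. complex_of_real (1 / (b r1 - b i))) (\<lambda>i. complex_of_real (1 / (c r2 - c i)))"
  define k where "k = (\<Prod>i\<in>{1..<r1}. complex_of_real (b r1 - b i) ^ w1) * (\<Prod>i\<in>{1..<r2}. complex_of_real (c r2 - c i) ^ w2)"
  have "at_nat y X = k * msubst id z Y" if X: "star_tensor w1 r1 w2 r2 X Y" for X
  proof -
    obtain n f h where F: "\<forall>k<n::nat. f k \<in> Sinv w1 r1 \<and> h k \<in> Sinv w2 r2"
      and X: "X = (\<Sum>k<n. tensor (f k) (h k))" and Y: "Y = (\<Sum>k<n. tensor (star r1 (f k)) (star r2 (h k)))"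
      using X unfolding star_tensor_def by blast
    have e: "at_nat y (tensor (f j) (h j)) = k * msubst id z (tensor (star r1 (f j)) (star r2 (h j)))" if "j < n" for j
    proof -
      have f: "f j \<in> Sinv w1 r1" and h: "h j \<in> Sinv w2 r2" using F that by auto
      have "at_nat y (tensor (f j) (h j)) = msubst id (\<lambda>i. of_real (b i)) (f j) * msubst id (\<lambda>i. of_real (c i)) (h j)"
        by (simp add: at_nat_def tensor_eval b_def c_def)
      also have "\<dots> = k * (msubst id (\<lambda>i. of_real (1 / (b r1 - b i))) (star r1 (f j)) * msubst id (\<lambda>i. of_real (1 / (c r2 - c i))) (star r2 (h j)))"
      proof -
        have "msubst id (\<lambda>i. of_real (b i)) (f j) =
          (\<Prod>i\<in>{1..<r1}. of_real (b r1 - b i) ^ w1) * msubst id (\<lambda>i. of_real (1 / (b r1 - b i))) (star r1 (f j))"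
          by (rule Sinv_reconstruct[OF f assms(3)]) (rule bne)
        moreover have "msubst id (\<lambda>i. of_real (c i)) (h j) =
          (\<Prod>i\<in>{1..<r2}. of_real (c r2 - c i) ^ w2) * msubst id (\<lambda>i. of_real (1 / (c r2 - c i))) (star r2 (h j))"
          by (rule Sinv_reconstruct[OF h assms(4)]) (rule cne)
        ultimately show ?thesis unfolding k_def by (simp only: mult_ac)
      qed
      also have "\<dots> = k * msubst id z (tensor (star r1 (f j)) (star r2 (h j)))"
        by (simp only: tensor_eval z_def sum.case)
      finally show ?thesis .
    qed
    have "at_nat y X = (\<Sum>j<n. at_nat y (tensor (f j) (h j)))" unfolding X by (rule ring_hom_sum[OF ring_hom_at_nat])
    also have "\<dots> = (\<Sum>j<n. k * msubst id z (tensor (star r1 (f j)) (star r2 (h j))))" using e by (intro sum.cong) auto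
    also have "\<dots> = k * msubst id z Y"
      unfolding Y ring_hom_sum[OF ring_hom_msubst[OF ring_hom_id]] by (rule sum_distrib_left[symmetric])
    finally show ?thesis .
  qed
  then show "at_nat y X = at_nat y X'" using assms(1,2) by simp
qed simp

section \<open>Limits of K for two separating blocks\<close>

lemma disc_shift_tendsto:
  assumes "finite S1" "finite S2" "S1 \<inter> T = {}" "S2 \<subseteq> T"
  shows "((\<lambda>t. disc (shift a T t) (S1 \<union> S2) / of_real t ^ (2 * (card S1 * card S2))) \<longlongrightarrow> disc a S1 * disc a S2) at_top"
proof -
  have d1: "disc (shift a T t) S1 = disc a S1" for t
    unfolding disc_def using assms(3) by (intro pair_prod_cong) (auto simp: shift_def disjoint_iff)
  have d2: "disc (shift a T t) S2 = disc a S2" for t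
    unfolding disc_def using assms(4) by (intro pair_prod_cong) (auto simp: shift_def subset_iff)
  have d: "disc (shift a T t) (S1 \<union> S2) = disc a S1 * disc a S2 * (\<Prod>i\<in>S1. \<Prod>j\<in>S2. (shift a T t i - shift a T t j)\<^sup>2)" for t
  proof -
    have "disc (shift a T t) (S1 \<union> S2) = disc (shift a T t) S1 * disc (shift a T t) S2 * (\<Prod>i\<in>S1. \<Prod>j\<in>S2. (shift a T t i - shift a T t j)\<^sup>2)"
      unfolding disc_def using assms by (intro pair_prod_Un) (auto simp: power2_commute)
    then show ?thesis by (simp only: d1 d2)
  qed
  have lim: "((\<lambda>t. ((shift a T t i - shift a T t j) / of_real t)\<^sup>2) \<longlongrightarrow> 1) at_top" if "i \<in> S1" "j \<in> S2" for i j
  proof -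
    have "((\<lambda>t. ((a i - a j) / complex_of_real t - 1)\<^sup>2) \<longlongrightarrow> (0 - 1)\<^sup>2) at_top"
      by (intro tendsto_intros tendsto_divide_0[OF tendsto_const of_real_filterlim_infinity])
    moreover have "\<forall>\<^sub>F t in at_top. ((a i - a j) / complex_of_real t - 1)\<^sup>2 = ((shift a T t i - shift a T t j) / of_real t)\<^sup>2"
      using eventually_gt_at_top[of 0]
    proof eventually_elim
      case (elim t)
      have "shift a T t i - shift a T t j = a i - a j - of_real t" using that assms(3,4) by (auto simp: shift_def)
      then show ?case using elim by (simp add: diff_divide_distrib)
    qed
    ultimately show ?thesis by (simp add: tendsto_cong)
  qed
  have "((\<lambda>t. disc a S1 * disc a S2 * (\<Prod>i\<in>S1. \<Prod>j\<in>S2. ((shift a T t i - shift a T t j) / of_real t)\<^sup>2))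
    \<longlongrightarrow> disc a S1 * disc a S2 * (\<Prod>i\<in>S1. \<Prod>j\<in>S2. 1)) at_top"
    by (intro tendsto_mult tendsto_const tendsto_prod lim)
  moreover have "disc a S1 * disc a S2 * (\<Prod>i\<in>S1. \<Prod>j\<in>S2. ((shift a T t i - shift a T t j) / of_real t)\<^sup>2)
    = disc (shift a T t) (S1 \<union> S2) / of_real t ^ (2 * (card S1 * card S2))" for t
    unfolding d by (simp add: power_divide prod_dividef power_mult[symmetric] mult_ac)
  ultimately show ?thesis by simp
qed

text \<open>Each of the cross pairs gives t^2 in the discriminant and the cycles take away t^2,
  hence \<open>m\<close>. A single far variable gives m = 4g, the weight of K; blocks of 2g1+1 and
  2g2+1 variables give the exponent of the degeneration.\<close>

lemma Kpoly_shift_tendsto: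
  assumes B: "Bset g = S1 \<union> S2" and "S1 \<inter> T = {}" "S2 \<subseteq> T" "inj_on a S1" "inj_on a S2"
    and exc: "\<bar>exc S1\<bar> = 1" and m: "2 * (card S1 * card S2) = m + 2"
  shows "((\<lambda>t. msubst id (shift a T t) (Kpoly g) / of_real t ^ m)
    \<longlongrightarrow> 1 / 2 ^ g * (disc a S1 * disc a S2) * (lam a S1 * lam a S2)) at_top"
proof -
  have fin: "finite S1" "finite S2" using finite_Bset[of g] unfolding B by auto
  have disj: "S1 \<inter> S2 = {}" using assms by auto
  have exc2: "exc S2 = - exc S1" using exc_Un[OF fin disj] exc_Bset[of g] unfolding B by simp
  have "S1 \<noteq> {}" using exc by auto
  then obtain p where p: "p \<in> S1" by auto
  note l1 = disc_shift_tendsto[OF fin assms(2,3), of a]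
  note l2 = kap_shift_tendsto[OF fin assms(2-5) exc exc2 p]
  have "((\<lambda>t. 1 / 2 ^ g * (disc (shift a T t) (S1 \<union> S2) / of_real t ^ (m + 2)) * ((of_real t)\<^sup>2 * kap (shift a T t) p (S1 \<union> S2)))
    \<longlongrightarrow> 1 / 2 ^ g * (disc a S1 * disc a S2) * (lam a S1 * lam a S2)) at_top"
    using l1 unfolding m by (intro tendsto_mult tendsto_const l2)
  moreover have "\<forall>\<^sub>F t in at_top. 1 / 2 ^ g * (disc (shift a T t) (S1 \<union> S2) / of_real t ^ (m + 2)) * ((of_real t)\<^sup>2 * kap (shift a T t) p (S1 \<union> S2))
    = msubst id (shift a T t) (Kpoly g) / of_real t ^ m"
    using eventually_inj_on_shift[OF fin assms(2-5)] eventually_gt_at_top[of 0]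
  proof eventually_elim
    case (elim t)
    have pB: "p \<in> Bset g" using p B by simp
    have inj: "inj_on (shift a T t) (Bset g)" using elim(1) B by simp
    show ?case unfolding Kpoly_eval[OF inj pB] unfolding B using elim(2) by (simp add: power_add power2_eq_square)
  qed
  ultimately show ?thesis by (rule Lim_transform_eventually)
qed

lemma exc_odd_interval: "exc {1..2 * n + 1} = - 1"
proof -
  have "Bset n = insert (2 * n + 2) {1..2 * n + 1}" by (auto simp: Bset_def)
  then show ?thesis using exc_Bset[of n] by (simp add: exc_insert sg_def)
qed

lemma star_Kpoly_eval:
  assumes inj: "inj_on y {1..2 * g + 1}"
  shows "at_nat y (star (2 * g + 2) (Kpoly g))
    = 1 / 2 ^ g * disc (\<lambda>i. of_nat (y i)) {1..2 * g + 1} * lam (\<lambda>i. of_nat (y i)) {1..2 * g + 1}"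
proof -
  define r where "r = 2 * g + 2"
  \<comment> \<open>The value 0 at r makes the shifted coordinate equal to t itself.\<close>
  define a where "a i = (if i = r then 0 else complex_of_nat (y i))" for i
  have B: "Bset g = {1..2 * g + 1} \<union> {r}" by (auto simp: Bset_def r_def)
  have injS: "inj_on a {1..2 * g + 1}"
    using inj by (auto simp: inj_on_def a_def r_def)
  have "((\<lambda>t. msubst id (shift a {r} t) (Kpoly g) / of_real t ^ (4 * g))
    \<longlongrightarrow> 1 / 2 ^ g * (disc a {1..2 * g + 1} * disc a {r}) * (lam a {1..2 * g + 1} * lam a {r})) at_top"
    by (rule Kpoly_shift_tendsto[OF B _ _ injS]) (use exc_odd_interval[of g] in \<open>auto simp: r_def\<close>)
  moreover have "disc a {r} = 1"
    using pair_prod_insert[of "{}" r "\<lambda>i j. (a i - a j)\<^sup>2"] by (simp add: disc_def power2_commute)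
  moreover have "disc a {1..2 * g + 1} = disc (\<lambda>i. of_nat (y i)) {1..2 * g + 1}"
    unfolding disc_def by (intro pair_prod_cong) (auto simp: a_def r_def)
  moreover have "lam a {1..2 * g + 1} = lam (\<lambda>i. of_nat (y i)) {1..2 * g + 1}"
    by (intro lam_cong) (auto simp: a_def r_def)
  moreover have "shift a {r} t = (\<lambda>i. of_nat (y i))(r := of_real t)" for t
    by (auto simp: fun_eq_iff shift_def a_def)
  ultimately have lim: "((\<lambda>t. msubst id ((\<lambda>i. of_nat (y i))(r := of_real t)) (Kpoly g) / of_real t ^ (4 * g))
    \<longlongrightarrow> 1 / 2 ^ g * disc (\<lambda>i. of_nat (y i)) {1..2 * g + 1} * lam (\<lambda>i. of_nat (y i)) {1..2 * g + 1}) at_top"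
    by (simp only: lam_singleton mult_1_right)
  have "coeff (map_poly (at_nat y) (last_poly r (Kpoly g))) (4 * g)
    = 1 / 2 ^ g * disc (\<lambda>i. of_nat (y i)) {1..2 * g + 1} * lam (\<lambda>i. of_nat (y i)) {1..2 * g + 1}"
    by (rule conjunct2[OF poly_limit_coeff], unfold at_nat_def last_poly_eval, rule lim)
  moreover have "star r (Kpoly g) = coeff (last_poly r (Kpoly g)) (4 * g)"
    using Kpoly_Sinv[of g] by (intro Sinv_star) (simp_all add: r_def)
  ultimately show ?thesis unfolding r_def[symmetric]
    by (simp only: coeff_map_poly ring_hom_simps(4)[OF ring_hom_at_nat])
qed

lemma shift_poly_eval:
  "poly (map_poly (msubst id x) (shift_poly r1 f)) t = msubst id (\<lambda>i. if i \<le> r1 then x (Inl i) else x (Inr (i - r1)) + t) f"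
proof -
  note hom = ring_hom_msubst[OF ring_hom_id, of x]
  have "poly (map_poly (msubst id x) (shift_poly r1 f)) t
    = msubst (\<lambda>c. poly (map_poly (msubst id x) [:Const c:]) t)
        (\<lambda>i. poly (map_poly (msubst id x) (if i \<le> r1 then [:Var (Inl i):] else [:Var (Inr (i - r1)), 1:])) t) f"
    unfolding shift_poly_def by (rule hom_msubst[OF ring_hom_poly_map[OF hom]])
  also have "(\<lambda>c. poly (map_poly (msubst id x) [:Const c:]) t) = id"
    by (simp add: fun_eq_iff map_poly_const[OF hom] msubst_Const)
  also have "(\<lambda>i. poly (map_poly (msubst id x) (if i \<le> r1 then [:Var (Inl i):] else [:Var (Inr (i - r1)), 1:])) t)
      = (\<lambda>i. if i \<le> r1 then x (Inl i) else x (Inr (i - r1)) + t)"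
    by (auto simp: fun_eq_iff map_poly_const[OF hom] map_poly_linear[OF hom] msubst_Var ring_hom_simps[OF hom])
  finally show ?thesis .
qed

text \<open>The stars on the right are themselves limits of the same kind, with a single far
  variable. Both sides are therefore products of \<open>disc\<close> and \<open>lam\<close> over the
  two blocks, and 2^g splits accordingly.\<close>

lemma Kpoly_degeneration:
  assumes g: "g1 + g2 = g" and inj: "inj_on y (Inl ` {1..2 * g1 + 1} \<union> Inr ` {1..2 * g2 + 1})"
  shows "((\<lambda>t. poly (map_poly (at_nat y) (shift_poly (2 * g1 + 1) (Kpoly g))) (of_real t) / of_real t ^ (4 * (2 * g1 * g2 + g1 + g2)))
    \<longlongrightarrow> at_nat y (tensor (star (2 * g1 + 2) (Kpoly g1)) (star (2 * g2 + 2) (Kpoly g2)))) at_top"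
proof -
  define r1 where "r1 = 2 * g1 + 1"
  define S where "S = {1..2 * g2 + 1}"
  define \<phi> where "\<phi> j = r1 + j" for j :: nat
  define a where "a i = complex_of_nat (if i \<le> r1 then y (Inl i) else y (Inr (i - r1)))" for i
  define y1 y2 where "y1 i = y (Inl i)" and "y2 i = y (Inr i)" for i
  have B: "Bset g = {1..r1} \<union> \<phi> ` S"
  proof -
    have "\<phi> ` S = {r1 + 1..r1 + (2 * g2 + 1)}" unfolding \<phi>_def S_def by (simp add: image_add_atLeastAtMost add.commute)
    then show ?thesis using g by (auto simp: Bset_def r1_def)
  qed
  have inj\<phi>: "inj_on \<phi> S" by (auto simp: \<phi>_def inj_on_def)
  have inj1: "inj_on y1 {1..2 * g1 + 1}"
  proof (rule inj_onI)
    fix i j assume "i \<in> {1..2 * g1 + 1}" "j \<in> {1..2 * g1 + 1}" "y1 i = y1 j"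
    then show "i = j" using inj_onD[OF inj, of "Inl i" "Inl j"] by (simp add: y1_def)
  qed
  have inj2: "inj_on y2 {1..2 * g2 + 1}"
  proof (rule inj_onI)
    fix i j assume "i \<in> {1..2 * g2 + 1}" "j \<in> {1..2 * g2 + 1}" "y2 i = y2 j"
    then show "i = j" using inj_onD[OF inj, of "Inr i" "Inr j"] by (simp add: y2_def)
  qed
  have a1: "a i = of_nat (y1 i)" if "i \<in> {1..r1}" for i using that by (simp add: a_def y1_def)
  have a2: "a (\<phi> j) = of_nat (y2 j)" if "j \<in> S" for j using that by (simp add: a_def y2_def \<phi>_def S_def)
  have ia1: "inj_on a {1..r1}" using inj1 a1 by (auto simp: inj_on_def r1_def)
  have ia2: "inj_on a (\<phi> ` S)" using inj2 a2 by (auto simp: inj_on_def S_def)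
  have card: "2 * (card {1..r1} * card (\<phi> ` S)) = 4 * (2 * g1 * g2 + g1 + g2) + 2"
    using card_image[OF inj\<phi>] by (simp add: S_def r1_def algebra_simps)
  have lim: "((\<lambda>t. msubst id (shift a {r1<..} t) (Kpoly g) / of_real t ^ (4 * (2 * g1 * g2 + g1 + g2)))
    \<longlongrightarrow> 1 / 2 ^ g * (disc a {1..r1} * disc a (\<phi> ` S)) * (lam a {1..r1} * lam a (\<phi> ` S))) at_top"
    by (rule Kpoly_shift_tendsto[OF B _ _ ia1 ia2 _ card])
       (use exc_odd_interval[of g1] in \<open>auto simp: r1_def \<phi>_def S_def\<close>)
  have sh: "(\<lambda>i. if i \<le> r1 then complex_of_nat (y (Inl i)) else of_nat (y (Inr (i - r1))) + of_real t) = shift a {r1<..} t" for t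
    by (auto simp: fun_eq_iff shift_def a_def)
  have d1: "disc a {1..r1} = disc (\<lambda>i. of_nat (y1 i)) {1..2 * g1 + 1}"
    unfolding disc_def r1_def[symmetric] using a1 by (intro pair_prod_cong) simp
  have d2: "disc a (\<phi> ` S) = disc (\<lambda>i. of_nat (y2 i)) {1..2 * g2 + 1}"
  proof -
    have "disc a (\<phi> ` S) = pair_prod (\<lambda>i j. (a (\<phi> i) - a (\<phi> j))\<^sup>2) S"
      unfolding disc_def using inj\<phi> by (intro pair_prod_image) (auto simp: S_def power2_commute)
    also have "\<dots> = disc (\<lambda>i. of_nat (y2 i)) S"
      unfolding disc_def using a2 by (intro pair_prod_cong) simp
    finally show ?thesis by (simp only: S_def)
  qed
  have l1: "lam a {1..r1} = lam (\<lambda>i. of_nat (y1 i)) {1..2 * g1 + 1}"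
    unfolding r1_def[symmetric] using a1 by (intro lam_cong) auto
  have l2: "lam a (\<phi> ` S) = lam (\<lambda>i. of_nat (y2 i)) {1..2 * g2 + 1}"
  proof -
    have "lam a (\<phi> ` S) = lam (a \<circ> \<phi>) S"
      by (rule lam_image[OF _ inj\<phi>, of "- 1"]) (auto simp: S_def \<phi>_def sg_def r1_def)
    also have "\<dots> = lam (\<lambda>i. of_nat (y2 i)) S" using a2 by (intro lam_cong) (auto simp: S_def)
    finally show ?thesis by (simp only: S_def)
  qed
  have t: "at_nat y (tensor f h) = at_nat y1 f * at_nat y2 h" for f h
    by (simp only: at_nat_def tensor_eval y1_def y2_def)
  have "at_nat y (tensor (star (2 * g1 + 2) (Kpoly g1)) (star (2 * g2 + 2) (Kpoly g2)))
    = 1 / 2 ^ g * (disc a {1..r1} * disc a (\<phi> ` S)) * (lam a {1..r1} * lam a (\<phi> ` S))"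
    unfolding t star_Kpoly_eval[OF inj1] star_Kpoly_eval[OF inj2] d1 d2 l1 l2 g[symmetric]
    by (simp add: power_add)
  then show ?thesis using lim unfolding at_nat_def shift_poly_eval r1_def[symmetric] sh by simp
qed

lemma Kpoly_shift_degree:
  assumes "g1 + g2 = g"
  shows "degree (shift_poly (2 * g1 + 1) (Kpoly g)) \<le> 4 * (2 * g1 * g2 + g1 + g2)"
    and "Tcoeff (4 * (2 * g1 * g2 + g1 + g2)) (2 * g1 + 1) (Kpoly g)
      = tensor (star (2 * g1 + 2) (Kpoly g1)) (star (2 * g2 + 2) (Kpoly g2))"
proof -
  let ?Vs = "Inl ` {1..2 * g1 + 1} \<union> Inr ` {1..2 * g2 + 1} :: (nat + nat) set"
  have fin: "finite ?Vs" by simp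
  note lim = mpol_poly_limit_degree[OF fin Kpoly_degeneration[OF assms]]
  show "degree (shift_poly (2 * g1 + 1) (Kpoly g)) \<le> 4 * (2 * g1 * g2 + g1 + g2)"
    by (rule lim(1))
  show "Tcoeff (4 * (2 * g1 * g2 + g1 + g2)) (2 * g1 + 1) (Kpoly g)
      = tensor (star (2 * g1 + 2) (Kpoly g1)) (star (2 * g2 + 2) (Kpoly g2))"
    unfolding Tcoeff_def by (rule mpol_eq_at_nat[OF fin], rule lim(2))
qed

lemma Kpoly_B8: "Kpoly g \<in> B8 g"
proof -
  have "real (nu (2 * g1 + 1) (Kpoly g)) \<le> real (4 * g) / real g * real (2 * g1 * g2 + g1 + g2)"
    if "g1 \<ge> 1" "g2 \<ge> 1" "g1 + g2 = g" for g1 g2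
  proof -
    have "real (nu (2 * g1 + 1) (Kpoly g)) \<le> real (4 * (2 * g1 * g2 + g1 + g2))"
      unfolding nu_def of_nat_le_iff using Kpoly_shift_degree(1)[OF that(3)] .
    moreover have "real (4 * g) / real g = 4" using that by simp
    ultimately show ?thesis by simp
  qed
  then show ?thesis unfolding B8_def Sinv0_def using Kpoly_Sinv Kpoly_SU_invariant by blast
qed

lemma Kpoly_W:
  assumes "g1 + g2 = g"
  shows "W 4 g1 g2 (Kpoly g) = tensor (Kpoly g1) (Kpoly g2)"
proof -
  have Y: "Tcoeff (4 * (2 * g1 * g2 + g1 + g2)) (2 * g1 + 1) (Kpoly g)
      = tensor (star (2 * g1 + 2) (Kpoly g1)) (star (2 * g2 + 2) (Kpoly g2))"
    by (rule Kpoly_shift_degree(2)[OF assms])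
  have "star_tensor (g1 * 4) (2 * g1 + 2) (g2 * 4) (2 * g2 + 2) (tensor (Kpoly g1) (Kpoly g2))
      (tensor (star (2 * g1 + 2) (Kpoly g1)) (star (2 * g2 + 2) (Kpoly g2)))"
    unfolding star_tensor_def using Kpoly_Sinv[of g1] Kpoly_Sinv[of g2]
    by (intro exI[of _ 1] exI[of _ "\<lambda>_. Kpoly g1"] exI[of _ "\<lambda>_. Kpoly g2"]) (simp add: mult.commute)
  then show ?thesis unfolding W_def Y
    by (intro the_equality) (auto intro: star_tensor_unique)
qed

theorem theorem4p10:
  shows "hyperelliptic_ansatz Kpoly \<and> (\<forall>g\<ge>1. to_fract (Kpoly g) = Hrat g)"
  unfolding hyperelliptic_ansatz_def
  using Kpoly_B8 Kpoly_W Kpoly_sum_permutations Kpoly_1 Kpoly_Hrat by blast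


end
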